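(* Let $d\ge1$ and $n\ge1$ be integers. Let $w\in L^\infty(\mathbb{R}^d)$ be nonnegative, such that $\int_{\mathbb{R}^d}w\,d\mu=1$ and $$\int_{\mathbb{R}^d}w\,H_k\,d\mu=0\quad\text{for every }k\in\mathbb{N}^d\text{ such that }0<|k|<n.$$ Then $$\int_{\mathbb{R}^d}w\log w\,d\mu\le\frac{\mathcal{H}_1[w]}{n}\int_{\mathbb{R}^d}\frac{|\nabla w|^2}{w}\,d\mu,$$ and the constant is optimal, in the sense that the factor $\frac1n$ multiplying $\mathcal{H}_1[w]$ cannot be replaced by any smaller constant in the inequality for all such $w$.
   Context: $\mathbb{N}=\{0,1,2,\dots\}$. $d\mu:=v_\infty\,dx$ is the Gaussian probability measure on $\mathbb{R}^d$, with $v_\infty(x):=(2\pi)^{-d/2}e^{-|x|^2/2}$. For $k=(k_1,\dots,k_d)\in\mathbb{N}^d$, $|k|:=\sum_{j=1}^dk_j$ and $H_k(x):=\prod_{j=1}^dh_{k_j}(x_j)$, where for $m\in\mathbb{N}$ and $y\in\mathbb{R}$, $h_m(y):=(-1)^m(m!)^{-1/2}e^{y^2/2}\frac{d^m}{dy^m}\big(e^{-y^2/2}\big)$ (normalized Hermite polynomials). Define the auxiliary function $\mathsf{h}_1:[0,\infty)\to\mathbb{R}$ (denoted $h_1$ in the paper, not to be confused with the Hermite polynomial) by $\mathsf{h}_1(0)=1$, $\mathsf{h}_1(1)=\frac12$ and $\mathsf{h}_1(s):=\frac{s\log s-(s-1)}{|s-1|^2}$ for $s\in(0,1)\cup(1,\infty)$;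 it is continuous, nonnegative and decreasing. For nonnegative $w\in L^\infty(\mathbb{R}^d)$, $$\mathcal{H}_1[w]:=\|w\|_{L^\infty(\mathbb{R}^d)}\,\sup_{x\in\mathbb{R}^d}\mathsf{h}_1(w(x))=\|w\|_{L^\infty(\mathbb{R}^d)}\,\mathsf{h}_1\Big(\inf_{x\in\mathbb{R}^d}w(x)\Big),$$ where sup and inf are essential. Conventions: $0\log0=0$, and $\int\frac{|\nabla w|^2}{w}\,d\mu$ is understood as $4\int|\nabla\sqrt w|^2\,d\mu$, equal to $+\infty$ if $\sqrt w$ does not have a weak gradient in $L^2(\mathbb{R}^d,d\mu)$. *)

theory Defs
  imports "HOL-Probability.Probability"
begin

text \<open>
  The space \<open>\<real>\<^sup>d\<close> is \<open>real ^ 'd\<close> with \<open>d = CARD('d)\<close>. Functions are not identified modulo null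
  sets, so measurability is with respect to \<open>lebesgue\<close> (not only \<open>lborel\<close>), in order that every
  representative of a class is admitted.
\<close>

definition gauss :: "(real ^ 'd) measure" where
  "gauss = density lebesgue
     (\<lambda>x. ennreal ((2 * pi) powr (- (real CARD('d) / 2)) * exp (- (norm x)\<^sup>2 / 2)))"

definition hermite :: "nat \<Rightarrow> real \<Rightarrow> real" where
  "hermite m y = (- 1) ^ m / sqrt (fact m) * exp (y\<^sup>2 / 2) * (deriv ^^ m) (\<lambda>t. exp (- t\<^sup>2 / 2)) y"

definition Hermite :: "nat ^ 'd \<Rightarrow> real ^ 'd \<Rightarrow> real" where
  "Hermite k x = (\<Prod>j\<in>UNIV. hermite (k $ j) (x $ j))"

definition mi_length :: "nat ^ 'd \<Rightarrow> nat" where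
  "mi_length k = (\<Sum>j\<in>UNIV. k $ j)"

definition Linf_norm :: "(real ^ 'd \<Rightarrow> real) \<Rightarrow> ereal" where
  "Linf_norm w = esssup lebesgue (\<lambda>x. ereal \<bar>w x\<bar>)"

definition Linf :: "(real ^ 'd \<Rightarrow> real) set" where
  "Linf = {w. w \<in> borel_measurable lebesgue \<and> Linf_norm w < \<infinity>}"

text \<open>Only the values on \<open>[0, \<infinity>)\<close> are relevant.\<close>

definition h1 :: "real \<Rightarrow> real" where
  "h1 s = (if s = 0 then 1 else if s = 1 then 1 / 2
           else (s * ln s - (s - 1)) / \<bar>s - 1\<bar>\<^sup>2)"

definition H1 :: "(real ^ 'd \<Rightarrow> real) \<Rightarrow> ereal" where
  "H1 w = Linf_norm w * esssup lebesgue (\<lambda>x. ereal (h1 (w x)))"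

definition partial :: "'d \<Rightarrow> (real ^ 'd \<Rightarrow> real) \<Rightarrow> real ^ 'd \<Rightarrow> real" where
  "partial i f x = frechet_derivative f (at x) (axis i 1)"

primrec Ck :: "nat \<Rightarrow> (real ^ 'd \<Rightarrow> real) \<Rightarrow> bool" where
  "Ck 0 f \<longleftrightarrow> continuous_on UNIV f"
| "Ck (Suc k) f \<longleftrightarrow> (\<forall>x. f differentiable (at x)) \<and> (\<forall>i. Ck k (partial i f))"

definition test_functions :: "(real ^ 'd \<Rightarrow> real) set" where
  "test_functions = {\<phi>. (\<forall>k. Ck k \<phi>) \<and> compact (closure {x. \<phi> x \<noteq> 0})}"

definition loc_integrable :: "(real ^ 'd \<Rightarrow> 'b::euclidean_space) \<Rightarrow> bool" where
  "loc_integrable u \<longleftrightarrow> (\<forall>K. compact K \<longrightarrow> set_integrable lebesgue K u)"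

definition has_weak_gradient :: "(real ^ 'd \<Rightarrow> real) \<Rightarrow> (real ^ 'd \<Rightarrow> real ^ 'd) \<Rightarrow> bool" where
  "has_weak_gradient u g \<longleftrightarrow> loc_integrable u \<and> loc_integrable g \<and>
     (\<forall>\<phi>\<in>test_functions. \<forall>i.
        (\<integral>x. u x * partial i \<phi> x \<partial>lebesgue) = - (\<integral>x. g x $ i * \<phi> x \<partial>lebesgue))"

text \<open>Weak gradients are unique up to null sets, so the choice below does not affect integrals.\<close>

definition weak_gradient :: "(real ^ 'd \<Rightarrow> real) \<Rightarrow> real ^ 'd \<Rightarrow> real ^ 'd" where
  "weak_gradient u = (SOME g. has_weak_gradient u g)"

text \<open>
  If the weak gradient of \<open>\<surd>w\<close> exists but is not in \<open>L\<^sup>2\<close> of the Gaussian measure, the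
  nonnegative integral is already \<open>\<infinity>\<close>.
\<close>

definition fisher :: "(real ^ 'd \<Rightarrow> real) \<Rightarrow> ennreal" where
  "fisher w =
     (if \<exists>g. has_weak_gradient (\<lambda>x. sqrt (w x)) g
      then 4 * (\<integral>\<^sup>+ x. ennreal ((norm (weak_gradient (\<lambda>x. sqrt (w x)) x))\<^sup>2) \<partial>gauss)
      else \<infinity>)"

text \<open>The convention \<open>0 log 0 = 0\<close> holds automatically since \<open>0 * ln 0 = 0\<close>.\<close>

definition entropy_gauss :: "(real ^ 'd \<Rightarrow> real) \<Rightarrow> real" where
  "entropy_gauss w = (\<integral>x. w x * ln (w x) \<partial>gauss)"

definition admissible :: "nat \<Rightarrow> (real ^ 'd \<Rightarrow> real) \<Rightarrow> bool" where
  "admissible n w \<longleftrightarrow>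
     w \<in> Linf \<and> (AE x in lebesgue. 0 \<le> w x) \<and> (\<integral>x. w x \<partial>gauss) = 1 \<and>
     (\<forall>k. 0 < mi_length k \<and> mi_length k < n \<longrightarrow> (\<integral>x. w x * Hermite k x \<partial>gauss) = 0)"

end

theory Submission
  imports Defs
begin

text \<open>
  Since \<open>w log w - (w - 1) = h\<^sub>1(w) (w - 1)\<^sup>2\<close>, the entropy is at most
  \<open>sup h\<^sub>1(w) \<cdot> \<parallel>w - 1\<parallel>\<^sup>2\<close>, and it remains to show \<open>n \<parallel>w - 1\<parallel>\<^sup>2 \<le> 4 \<parallel>w\<parallel>\<^sub>\<infinity> \<integral>\<bar>\<nabla>u\<bar>\<^sup>2\<close> for \<open>u = \<surd>w\<close>.
  Let \<open>P\<^sub>r\<close> be the Ornstein--Uhlenbeck operator with \<open>P\<^sub>r H\<^sub>k = r\<^bsup>\<bar>k\<bar>\<^esup> H\<^sub>k\<close>. The vanishing of the low modes of \<open>w - 1\<close> gives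
  \<open>\<langle>w - 1, (1 - P\<^sub>r)(w - 1)\<rangle> \<ge> (1 - r\<^sup>n) \<parallel>w - 1\<parallel>\<^sup>2\<close>; integration by parts against Hermite functions gives
  \<open>\<langle>u, (1 - P\<^sub>r) u\<rangle> \<le> (1 - r) \<integral>\<bar>\<nabla>u\<bar>\<^sup>2\<close>; and because \<open>P\<^sub>r\<close> has a positive kernel, the first form is at most
  \<open>4 \<parallel>w\<parallel>\<^sub>\<infinity>\<close> times the second. Divide by \<open>1 - r\<close> and let \<open>r \<rightarrow> 1\<close>.

  For optimality take \<open>w = 1 + \<epsilon> f\<close> with \<open>\<epsilon> \<rightarrow> 0\<close>, where \<open>f\<close> is a bounded trigonometric sum without modes
  of degree \<open>< n\<close> whose Rayleigh quotient is close to \<open>n\<close>.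
\<close>

section \<open>The Gaussian measure\<close>

text \<open>The heuristic is a Poincare inequality for w - 1 combined with |grad w|^2 = 4 w |grad
  u|^2. To make it rigorous for a merely bounded w, everything is phrased through the form <f, P_r
  f> with r < 1, which has two descriptions. It is a convergent series in the Hermite levels of f,
  where vanishing low modes and gradients are visible. It is also an expectation over two correlated
  Gaussian vectors, where increments of u^2 and of u compare pointwise and where r -> 1 is a plain
  continuity statement. The limit in the second description does what completeness of the Hermite
  functions would do at r = 1 in the first.

  The constant 1/n comes from linearising at w = 1: there the sup norm tends to 1 and
  \<open>h1\<close> to 1/2, so for w = 1 + eps f the entropy is about eps^2/2 times the squared norm
  of f and the Fisher information about eps^2 times its energy. The eigenfunction itself is an
  unbounded polynomial for n \<ge> 1, so it has to be replaced by bounded functions.\<close>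

lemma Basis_vec_real: "(Basis :: (real ^ 'd) set) = range (\<lambda>j. axis j 1)"
  by (auto simp: Basis_vec_def)

lemma inj_axis_1: "inj (\<lambda>j. axis j (1::real) :: real ^ 'd)"
  by (auto simp: inj_on_def axis_eq_axis)

text \<open>\<open>lborel\<close> on a Euclidean space is a product measure indexed by basis
  vectors, while densities and Hermite polynomials are products over coordinates. Reindexing along
  \<open>axis j 1\<close> lets one-dimensional integrals be multiplied.\<close>

lemma vec_prod_Basis:
  fixes F :: "'d::finite \<Rightarrow> real \<Rightarrow> 'c::comm_monoid_mult"
  shows "(\<Prod>j\<in>UNIV. F j ((\<Sum>b\<in>Basis. f b *\<^sub>R b) $ j))
    = (\<Prod>b\<in>(Basis :: (real ^ 'd) set). F (inv (\<lambda>j. axis j 1) b) (f b))"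
proof -
  have c: "(\<Sum>b\<in>(Basis :: (real ^ 'd) set). f b *\<^sub>R b) $ j = f (axis j 1)" for j
  proof -
    have "(\<Sum>b\<in>(Basis :: (real ^ 'd) set). f b *\<^sub>R b) $ j = (\<Sum>b\<in>Basis. f b *\<^sub>R b) \<bullet> axis j 1"
      by (simp add: inner_axis)
    also have "\<dots> = f (axis j 1)"
      by (rule inner_sum_left_Basis) (auto simp: Basis_vec_real)
    finally show ?thesis .
  qed
  have "(\<Prod>b\<in>(Basis :: (real ^ 'd) set). F (inv (\<lambda>j. axis j 1) b) (f b))
      = (\<Prod>j\<in>UNIV. F j (f (axis j 1)))"
    unfolding Basis_vec_real
    by (subst prod.reindex) (auto simp: inj_axis_1 inv_f_f[OF inj_axis_1])
  then show ?thesis by (simp only: c)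
qed

lemma
  fixes F :: "'d::finite \<Rightarrow> real \<Rightarrow> 'c::{real_normed_field, banach, second_countable_topology}"
  assumes F: "\<And>j. integrable lborel (F j)"
  shows lborel_integrable_prod_vec: "integrable (lborel :: (real ^ 'd) measure) (\<lambda>x. \<Prod>j\<in>UNIV. F j (x $ j))"
    and lborel_integral_prod_vec:
      "(\<integral>x. (\<Prod>j\<in>UNIV. F j (x $ j)) \<partial>(lborel :: (real ^ 'd) measure)) = (\<Prod>j\<in>UNIV. \<integral>t. F j t \<partial>lborel)"
proof -
  interpret product_sigma_finite "\<lambda>_::real ^ 'd. lborel :: real measure" ..
  have [measurable]: "F j \<in> borel_measurable borel" for j
    using F[of j] by (auto dest: borel_measurable_integrable)
  let ?m = "\<lambda>f. \<Sum>b\<in>(Basis :: (real ^ 'd) set). f b *\<^sub>R b"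
  have m: "?m \<in> Pi\<^sub>M Basis (\<lambda>_. lborel) \<rightarrow>\<^sub>M borel" by measurable
  have Fm: "(\<lambda>x::real ^ 'd. \<Prod>j\<in>UNIV. F j (x $ j)) \<in> borel_measurable borel"
    by (intro borel_measurable_prod) simp
  show "integrable (lborel :: (real ^ 'd) measure) (\<lambda>x. \<Prod>j\<in>UNIV. F j (x $ j))"
    unfolding lborel_eq[where 'a="real ^ 'd"] integrable_distr_eq[OF m Fm] vec_prod_Basis
    by (rule product_integrable_prod) (auto simp: F)
  show "(\<integral>x. (\<Prod>j\<in>UNIV. F j (x $ j)) \<partial>(lborel :: (real ^ 'd) measure)) = (\<Prod>j\<in>UNIV. \<integral>t. F j t \<partial>lborel)"
    unfolding lborel_eq[where 'a="real ^ 'd"] integral_distr[OF m Fm] vec_prod_Basis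
    by (subst product_integral_prod) (auto simp: F Basis_vec_real prod.reindex inj_axis_1 inv_f_f[OF inj_axis_1])
qed

definition phi :: "real ^ 'd \<Rightarrow> real" where
  "phi x = (2 * pi) powr (- (real CARD('d) / 2)) * exp (- (norm x)\<^sup>2 / 2)"

text \<open>The Borel version of \<^const>\<open>gauss\<close>, for which Fubini is available.\<close>

definition gam :: "(real ^ 'd) measure" where
  "gam = density lborel (\<lambda>x. ennreal (phi x))"

abbreviation N01 :: "real measure" where "N01 \<equiv> std_normal_distribution"

lemma norm_sq_vec: "(norm (x :: real ^ 'd))\<^sup>2 = (\<Sum>j\<in>UNIV. (x $ j)\<^sup>2)"
  by (simp add: norm_vec_def L2_set_def sum_nonneg)

lemma phi_prod:
  fixes x :: "real ^ 'd"
  shows "phi x = (\<Prod>j\<in>UNIV. std_normal_density (x $ j))"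
proof -
  have 1: "(1 / sqrt (2 * pi)) ^ CARD('d) = (2 * pi) powr (- (real CARD('d) / 2))"
    by (simp add: powr_half_sqrt[symmetric] powr_minus_divide[symmetric] powr_realpow[symmetric] powr_powr)
  have 2: "(\<Prod>j\<in>UNIV. exp (- (x $ j)\<^sup>2 / 2)) = exp (- (norm x)\<^sup>2 / 2)"
    by (simp add: exp_sum[symmetric] norm_sq_vec sum_divide_distrib sum_negf)
  have "(\<Prod>j\<in>UNIV. std_normal_density (x $ j)) = (\<Prod>j\<in>UNIV. (1 / sqrt (2 * pi)) * exp (- (x $ j)\<^sup>2 / 2))"
    by (simp add: normal_density_def)
  also have "\<dots> = (1 / sqrt (2 * pi)) ^ CARD('d) * (\<Prod>j\<in>UNIV. exp (- (x $ j)\<^sup>2 / 2))"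
    by (simp only: prod.distrib prod_constant)
  finally show ?thesis by (simp only: 1 2 phi_def)
qed

lemma phi_pos: "0 < phi x" by (simp add: phi_def)
lemma phi_nonneg: "0 \<le> phi x" by (simp add: phi_def)

lemma phi_measurable[measurable]: "phi \<in> borel_measurable borel"
  unfolding phi_def[abs_def] by measurable

lemma sets_gam[measurable_cong, simp]: "sets gam = sets borel" by (simp add: gam_def)
lemma space_gam[simp]: "space gam = UNIV" by (simp add: gam_def)

lemma integrable_gam:
  fixes f :: "real ^ 'd \<Rightarrow> 'b::{banach, second_countable_topology}"
  assumes "f \<in> borel_measurable borel"
  shows "integrable gam f \<longleftrightarrow> integrable lborel (\<lambda>x. phi x *\<^sub>R f x)"
  unfolding gam_def using assms by (subst integrable_density) (auto simp: phi_nonneg)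

lemma integral_gam:
  fixes f :: "real ^ 'd \<Rightarrow> 'b::{banach, second_countable_topology}"
  assumes "f \<in> borel_measurable borel"
  shows "(\<integral>x. f x \<partial>gam) = (\<integral>x. phi x *\<^sub>R f x \<partial>lborel)"
  unfolding gam_def using assms by (subst integral_density) (auto simp: phi_nonneg)

lemma
  fixes F :: "'d::finite \<Rightarrow> real \<Rightarrow> 'c::{real_normed_field, banach, second_countable_topology}"
  assumes F: "\<And>j. integrable N01 (F j)"
  shows gam_integrable_prod: "integrable (gam :: (real ^ 'd) measure) (\<lambda>x. \<Prod>j\<in>UNIV. F j (x $ j))"
    and gam_integral_prod:
      "(\<integral>x. (\<Prod>j\<in>UNIV. F j (x $ j)) \<partial>(gam :: (real ^ 'd) measure)) = (\<Prod>j\<in>UNIV. \<integral>t. F j t \<partial>N01)"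
proof -
  have [measurable]: "F j \<in> borel_measurable borel" for j
    using F[of j] by (auto dest: borel_measurable_integrable)
  have Fm: "(\<lambda>x::real ^ 'd. \<Prod>j\<in>UNIV. F j (x $ j)) \<in> borel_measurable borel"
    by (intro borel_measurable_prod) simp
  have eq: "phi x *\<^sub>R (\<Prod>j\<in>UNIV. F j (x $ j)) = (\<Prod>j\<in>UNIV. std_normal_density (x $ j) *\<^sub>R F j (x $ j))" for x :: "real ^ 'd"
    by (simp add: phi_prod scaleR_conv_of_real prod.distrib)
  have F': "integrable lborel (\<lambda>t. std_normal_density t *\<^sub>R F j t)" for j
    using F[of j] by (subst (asm) integrable_density) auto
  show "integrable (gam :: (real ^ 'd) measure) (\<lambda>x. \<Prod>j\<in>UNIV. F j (x $ j))"
    unfolding integrable_gam[OF Fm] eq by (rule lborel_integrable_prod_vec[OF F'])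
  show "(\<integral>x. (\<Prod>j\<in>UNIV. F j (x $ j)) \<partial>(gam :: (real ^ 'd) measure)) = (\<Prod>j\<in>UNIV. \<integral>t. F j t \<partial>N01)"
    unfolding integral_gam[OF Fm] eq lborel_integral_prod_vec[OF F']
    by (subst integral_density) auto
qed

interpretation N01: real_distribution N01 by (rule real_dist_normal_dist)

lemma emeasure_gam_UNIV: "emeasure (gam :: (real ^ 'd) measure) UNIV = 1"
proof -
  let ?M = "gam :: (real ^ 'd) measure"
  have i: "integrable ?M (\<lambda>x. 1 :: real)" and v: "(\<integral>x. (1::real) \<partial>?M) = 1"
    using gam_integrable_prod[of "\<lambda>_ _. 1::real"]
      gam_integral_prod[of "\<lambda>_ _. 1::real"] N01.prob_space by auto
  then have "(\<integral>\<^sup>+x. ennreal 1 \<partial>?M) = ennreal 1"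
    by (subst nn_integral_eq_integral) auto
  then show ?thesis by simp
qed

interpretation gam: prob_space "gam :: (real ^ 'd) measure"
  by (rule prob_spaceI) (simp add: emeasure_gam_UNIV)

text \<open>Completing the square: an exponential tilt of the standard Gaussian is a translation of
  it, the one-dimensional Cameron-Martin formula.\<close>

lemma N01_shift:
  fixes f :: "real \<Rightarrow> 'b::{banach, second_countable_topology}"
  assumes [measurable]: "f \<in> borel_measurable borel"
  shows "integrable N01 (\<lambda>t. exp (a * t - a\<^sup>2 / 2) *\<^sub>R f t) \<longleftrightarrow> integrable N01 (\<lambda>t. f (t + a))"
    and "(\<integral>t. exp (a * t - a\<^sup>2 / 2) *\<^sub>R f t \<partial>N01) = (\<integral>t. f (t + a) \<partial>N01)"
proof -
  have e: "std_normal_density t *\<^sub>R exp (a * t - a\<^sup>2 / 2) *\<^sub>R f t = std_normal_density (t - a) *\<^sub>R f t" for t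
  proof -
    have "std_normal_density t * exp (a * t - a\<^sup>2 / 2) = std_normal_density (t - a)"
      by (simp add: normal_density_def exp_add[symmetric] power2_eq_square algebra_simps add_divide_distrib diff_divide_distrib)
    then show ?thesis by simp
  qed
  let ?g = "\<lambda>t. std_normal_density (t - a) *\<^sub>R f t"
  have c: "(\<lambda>t. f (t + a)) = (\<lambda>t. f (a + t))" by (simp only: add.commute)
  show "integrable N01 (\<lambda>t. exp (a * t - a\<^sup>2 / 2) *\<^sub>R f t) \<longleftrightarrow> integrable N01 (\<lambda>t. f (t + a))"
    using lborel_integrable_real_affine_iff[of 1 ?g a]
    unfolding c by (simp add: integrable_density e del: scaleR_scaleR)
  show "(\<integral>t. exp (a * t - a\<^sup>2 / 2) *\<^sub>R f t \<partial>N01) = (\<integral>t. f (t + a) \<partial>N01)"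
    using lborel_integral_real_affine[of 1 ?g a]
    unfolding c by (simp add: integral_density e del: scaleR_scaleR)
qed

text \<open>The real part of the exponent is removed by the translation \<open>N01_shift\<close>;
  what remains is the characteristic function at \<open>b = Im c\<close>.\<close>

lemma
  shows N01_integrable_exp: "integrable N01 (\<lambda>t. exp (c * complex_of_real t))"
    and N01_integral_exp: "(\<integral>t. exp (c * complex_of_real t) \<partial>N01) = exp (c\<^sup>2 / 2)"
proof -
  define a b where "a = Re c" and "b = Im c"
  have c: "c = complex_of_real a + \<i> * complex_of_real b" by (simp add: a_def b_def complex_eq_iff)
  let ?f = "\<lambda>t::real. exp (of_real (a\<^sup>2/2)) * iexp (b * t)"
  have [measurable]: "?f \<in> borel_measurable borel" by measurable
  have e: "exp (c * complex_of_real t) = exp (a * t - a\<^sup>2 / 2) *\<^sub>R ?f t" for t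
    by (simp add: c scaleR_conv_of_real exp_of_real[symmetric] exp_add[symmetric] algebra_simps)
  have s: "?f (t + a) = exp (of_real (a\<^sup>2/2) + \<i> * of_real (a * b)) * iexp (b * t)" for t
    by (simp add: exp_add[symmetric] algebra_simps)
  show "integrable N01 (\<lambda>t. exp (c * complex_of_real t))"
    unfolding e N01_shift(1)[OF \<open>?f \<in> borel_measurable borel\<close>] s
    by (intro integrable_mult_right N01.integrable_iexp) auto
  have "(\<integral>t. iexp (b * t) \<partial>N01) = exp (of_real (- (b\<^sup>2) / 2))"
    using fun_cong[OF char_std_normal_distribution, of b] by (simp add: char_def exp_of_real[symmetric])
  then show "(\<integral>t. exp (c * complex_of_real t) \<partial>N01) = exp (c\<^sup>2 / 2)"
    unfolding e N01_shift(2)[OF \<open>?f \<in> borel_measurable borel\<close>] s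
    by (subst integral_mult_right_zero)
      (auto simp: exp_add[symmetric] c power2_eq_square algebra_simps add_divide_distrib diff_divide_distrib)
qed

section \<open>Hermite polynomials as Gaussian expectations\<close>

text \<open>The quadratic term only widens the Gaussian: rescaling the variable by 1/s with
  \<open>s = sqrt (1 - r^2)\<close> absorbs it and turns the linear coefficient into c/s. Here r < 1
  keeps the integral finite.\<close>

lemma
  fixes r :: real assumes r: "0 \<le> r" "r < 1"
  shows N01_integrable_exp_quad: "integrable N01 (\<lambda>t. exp (c * complex_of_real t + of_real (r\<^sup>2 * t\<^sup>2 / 2)))" (is ?I)
    and N01_integral_exp_quad: "(\<integral>t. exp (c * complex_of_real t + of_real (r\<^sup>2 * t\<^sup>2 / 2)) \<partial>N01)
      = of_real (1 / sqrt (1 - r\<^sup>2)) * exp (c\<^sup>2 / of_real (2 * (1 - r\<^sup>2)))" (is ?E)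
proof -
  define s where "s = sqrt (1 - r\<^sup>2)"
  have "r\<^sup>2 < 1" using r by (simp add: power_less_one_iff abs_square_less_1)
  then have s: "s > 0" "s\<^sup>2 = 1 - r\<^sup>2" by (auto simp: s_def)
  let ?g = "\<lambda>t. std_normal_density t *\<^sub>R exp (c * complex_of_real t + of_real (r\<^sup>2 * t\<^sup>2 / 2))"
  have g: "?g (0 + 1 / s * t) = std_normal_density t *\<^sub>R exp (c / of_real s * of_real t)" for t
  proof -
    have "- ((t / s)\<^sup>2 / 2) + r\<^sup>2 * (t / s)\<^sup>2 / 2 = - (t\<^sup>2 / 2)"
    proof -
      have "t = s * (t / s)" using s by simp
      then have "t\<^sup>2 = (1 - r\<^sup>2) * (t / s)\<^sup>2" using s(2) by (metis power_mult_distrib)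
      then show ?thesis by (simp add: algebra_simps)
    qed
    note r = this
    have *: "complex_of_real (- ((t / s)\<^sup>2 / 2)) + (c * complex_of_real (t / s) + of_real (r\<^sup>2 * (t/s)\<^sup>2 / 2))
      = of_real (- (t\<^sup>2 / 2)) + c / of_real s * of_real t"
    proof -
      have "complex_of_real (- ((t / s)\<^sup>2 / 2)) + (c * complex_of_real (t / s) + of_real (r\<^sup>2 * (t/s)\<^sup>2 / 2))
        = of_real (- ((t / s)\<^sup>2 / 2) + r\<^sup>2 * (t / s)\<^sup>2 / 2) + c * of_real (t / s)"
        by (simp only: of_real_add ac_simps)
      then show ?thesis by (simp only: r) simp
    qed
    have "complex_of_real (exp (- ((t / s)\<^sup>2 / 2))) * exp (c * complex_of_real (t / s) + of_real (r\<^sup>2 * (t/s)\<^sup>2 / 2))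
      = of_real (exp (- (t\<^sup>2 / 2))) * exp (c / of_real s * of_real t)"
      unfolding exp_of_real[symmetric] exp_add[symmetric] * ..
    then show ?thesis
      by (simp add: normal_density_def scaleR_conv_of_real)
  qed
  have I: "integrable lborel (\<lambda>t. std_normal_density t *\<^sub>R exp (c / of_real s * complex_of_real t))"
    using N01_integrable_exp[of "c / of_real s"] by (subst (asm) integrable_density) auto
  show ?I
    using lborel_integrable_real_affine_iff[of "1 / s" ?g 0] s I unfolding g
    by (subst integrable_density) auto
  have J: "(\<integral>t. std_normal_density t *\<^sub>R exp (c / of_real s * complex_of_real t) \<partial>lborel) = exp ((c / of_real s)\<^sup>2 / 2)"
    using N01_integral_exp[of "c / of_real s"] by (subst (asm) integral_density) auto
  have "(\<integral>t. ?g t \<partial>lborel) = of_real (1 / s) * exp ((c / of_real s)\<^sup>2 / 2)"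
    using lborel_integral_real_affine[of "1 / s" ?g 0] s unfolding g J by (simp add: scaleR_conv_of_real)
  then show ?E
    unfolding s(2)[symmetric] using s(1)
    by (subst integral_density) (auto simp: power_divide mult.commute)
qed

text \<open>Mehler's kernel relative to the Gaussian measure in \<open>y\<close>; its usual symmetric form is only
  recovered in \<open>kernel1_sym\<close>.\<close>

definition kernel1 :: "real \<Rightarrow> real \<Rightarrow> real \<Rightarrow> real" where
  "kernel1 r x y = exp (y\<^sup>2 / 2 - (y - r * x)\<^sup>2 / (2 * (1 - r\<^sup>2))) / sqrt (1 - r\<^sup>2)"

text \<open>The one-dimensional core of Mehler's formula. For independent standard Gaussians Z and
  W, integrating exp(r (x + iZ)(y + iW)) over W leaves the exponent r^2 Z^2 / 2 next to a linear
  one, which is the case treated by \<open>N01_integral_exp_quad\<close>.\<close>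

lemma
  fixes r x y :: real assumes r: "0 \<le> r" "r < 1"
  defines "G \<equiv> \<lambda>z. \<integral>w. exp (of_real r * ((of_real x + \<i> * of_real z) * (of_real y + \<i> * of_real w))) \<partial>N01"
  shows N01_exp_bilinear_inner_integrable:
      "integrable N01 (\<lambda>w. exp (of_real r * ((of_real x + \<i> * of_real z) * (of_real y + \<i> * complex_of_real w))))"
    and N01_exp_bilinear_integrable: "integrable N01 G"
    and N01_exp_bilinear_integral: "(\<integral>z. G z \<partial>N01) = of_real (kernel1 r x y)"
proof -
  have e: "exp (of_real r * ((of_real x + \<i> * of_real z) * (of_real y + \<i> * complex_of_real w)))
    = exp (of_real r * (of_real x + \<i> * of_real z) * of_real y) * exp (of_real r * (of_real x + \<i> * of_real z) * \<i> * of_real w)"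
    for z w :: real by (simp add: exp_add[symmetric] algebra_simps)
  show "integrable N01 (\<lambda>w. exp (of_real r * ((of_real x + \<i> * of_real z) * (of_real y + \<i> * complex_of_real w))))"
    unfolding e by (intro integrable_mult_right N01_integrable_exp)
  have G: "G z = exp (of_real (r * x * y - r\<^sup>2 * x\<^sup>2 / 2)) * exp (\<i> * of_real (r * y - r\<^sup>2 * x) * of_real z + of_real (r\<^sup>2 * z\<^sup>2 / 2))" for z
    unfolding G_def e integral_mult_right_zero N01_integral_exp unfolding exp_add[symmetric]
    by (simp add: power2_eq_square algebra_simps add_divide_distrib diff_divide_distrib)
  show "integrable N01 G"
    unfolding G[abs_def] by (intro integrable_mult_right N01_integrable_exp_quad r)
  have "r\<^sup>2 < 1" using r by (simp add: abs_square_less_1)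
  then have quad: "r * x * y - r\<^sup>2 * x\<^sup>2 / 2 - (r * y - r\<^sup>2 * x)\<^sup>2 / (2 * (1 - r\<^sup>2)) = y\<^sup>2 / 2 - (y - r * x)\<^sup>2 / (2 * (1 - r\<^sup>2))"
    by (simp add: field_simps) (simp add: power2_eq_square power4_eq_xxxx algebra_simps)
  have *: "exp (r * x * y - r\<^sup>2 * x\<^sup>2 / 2) * (1 / sqrt (1 - r\<^sup>2) * exp (- ((r * y - r\<^sup>2 * x)\<^sup>2 / (2 * (1 - r\<^sup>2))))) = kernel1 r x y"
  proof -
    have "exp P * (1 / q * exp (- Q)) = exp (P - Q) / q" for P Q q :: real
      by (simp add: exp_diff exp_minus divide_inverse)
    then show ?thesis unfolding kernel1_def by (simp only: quad)
  qed
  have c: "(\<i> * of_real A)\<^sup>2 / of_real B = complex_of_real (- (A\<^sup>2 / B))" for A B by (simp add: power_mult_distrib)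
  show "(\<integral>z. G z \<partial>N01) = of_real (kernel1 r x y)"
    unfolding G[abs_def] integral_mult_right_zero N01_integral_exp_quad[OF r] *[symmetric]
    by (simp only: c exp_of_real) (simp only: of_real_mult)
qed

text \<open>Unnormalised Hermite polynomials \<open>\<surd>(m!) h\<^sub>m\<close>.\<close>

fun hpoly :: "nat \<Rightarrow> real \<Rightarrow> real" where
  "hpoly 0 y = 1"
| "hpoly (Suc 0) y = y"
| "hpoly (Suc (Suc m)) y = y * hpoly (Suc m) y - real (Suc m) * hpoly m y"

text \<open>At m = 0 the truncated \<open>m - 1\<close> is harmless because its coefficient
  vanishes. The same convention is used in \<open>hpoly_deriv\<close> and
  \<open>N01_stein\<close>.\<close>

lemma hpoly_Suc: "hpoly (Suc m) y = y * hpoly m y - real m * hpoly (m - 1) y"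
  by (cases m) auto

lemma hpoly_deriv: "(hpoly m has_real_derivative real m * hpoly (m - 1) y) (at y)"
proof (induction m rule: less_induct)
  case (less m)
  consider "m = 0" | "m = 1" | k where "m = Suc (Suc k)"
    by (metis One_nat_def not0_implies_Suc)
  then show ?case
  proof cases
    case 3
    have "((\<lambda>y. y * hpoly (Suc k) y - real (Suc k) * hpoly k y) has_real_derivative
       1 * hpoly (Suc k) y + (real (Suc k) * hpoly k y) * y - real (Suc k) * (real k * hpoly (k - 1) y)) (at y)"
      using less[of "Suc k"] less[of k] 3 by (intro derivative_intros DERIV_cmult) (auto intro!: derivative_eq_intros)
    moreover have "1 * hpoly (Suc k) y + (real (Suc k) * hpoly k y) * y - real (Suc k) * (real k * hpoly (k - 1) y)
      = real m * hpoly (m - 1) y" by (simp add: 3 hpoly_Suc[of k] algebra_simps)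
    ultimately show ?thesis by (simp add: 3[symmetric]) (simp add: 3)
  qed (auto simp: fun_eq_iff intro!: derivative_eq_intros)
qed

lemma deriv_gauss_iter:
  "(deriv ^^ m) (\<lambda>t. exp (- t\<^sup>2 / 2)) = (\<lambda>t. (- 1) ^ m * hpoly m t * exp (- t\<^sup>2 / 2))"
proof (induction m)
  case (Suc m)
  have "((\<lambda>t. (- 1) ^ m * hpoly m t * exp (- t\<^sup>2 / 2)) has_real_derivative
      (- 1) ^ Suc m * hpoly (Suc m) t * exp (- t\<^sup>2 / 2)) (at t)" for t
    by (rule derivative_eq_intros hpoly_deriv refl | simp)+
      (simp add: hpoly_Suc algebra_simps)
  then have "deriv (\<lambda>t. (- 1) ^ m * hpoly m t * exp (- t\<^sup>2 / 2)) = (\<lambda>t. (- 1) ^ Suc m * hpoly (Suc m) t * exp (- t\<^sup>2 / 2))"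
    by (intro ext DERIV_imp_deriv)
  then show ?case by (simp only: funpow.simps o_apply Suc)
qed simp

lemma hermite_hpoly: "hermite m y = hpoly m y / sqrt (fact m)"
  unfolding hermite_def deriv_gauss_iter by (simp add: exp_minus field_simps flip: power_mult_distrib)

text \<open>Stein's identity E[Z f(Z)] = E[f'(Z)] for a monomial f, read off from the explicit
  moments: odd ones vanish, and consecutive even ones have ratio k.\<close>

lemma N01_moment_Suc: "(\<integral>t. t ^ Suc k \<partial>N01) = real k * (\<integral>t. t ^ (k - 1) \<partial>N01)"
proof (cases "even k")
  case True
  then have "odd (Suc k)" "k = 0 \<or> odd (k - 1)" by (auto simp: even_diff_nat)
  then show ?thesis by (auto simp: integral_std_normal_distribution_moment_odd simp del: power_Suc)
next
  case False
  then obtain j where k: "k = 2 * j + 1" by (elim oddE)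
  have "(\<integral>t. t ^ Suc k \<partial>N01) = fact (2 * Suc j) / (2 ^ Suc j * fact (Suc j))"
    using std_normal_distribution_even_moments(1)[of "Suc j"] by (simp add: k)
  also have "fact (2 * Suc j) = (2 * real (Suc j)) * (real k * fact (2 * j))"
    by (simp add: k algebra_simps)
  also have "(2 * real (Suc j)) * (real k * fact (2 * j)) / (2 ^ Suc j * fact (Suc j))
     = real k * (fact (2 * j) / (2 ^ j * fact j))"
    by (simp del: of_nat_Suc add: mult.assoc)
  also have "fact (2 * j) / (2 ^ j * fact j) = (\<integral>t. t ^ (k - 1) \<partial>N01)"
    by (simp add: k std_normal_distribution_even_moments(1))
  finally show ?thesis .
qed

lemma N01_integrable_power: "integrable N01 (\<lambda>t. complex_of_real t ^ k)"
  using integrable_std_normal_distribution_moment[of k]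
  by (simp add: of_real_power[symmetric] del: of_real_power)

text \<open>Stein's identity for f(z) = z^k (y + iz)^l; differentiating the second factor produces
  \<open>of_nat l * \<i>\<close>. In the induction on l, one factor y + iz is split off and its
  second summand raises k, so k stays arbitrary.\<close>

lemma N01_stein:
  defines "b \<equiv> \<lambda>y z::real. of_real y + \<i> * of_real z"
  shows "integrable N01 (\<lambda>z. of_real z ^ k * b y z ^ l)"
    and "(\<integral>z. of_real z ^ Suc k * b y z ^ l \<partial>N01) =
      of_nat k * (\<integral>z. of_real z ^ (k - 1) * b y z ^ l \<partial>N01) + of_nat l * \<i> * (\<integral>z. of_real z ^ k * b y z ^ (l - 1) \<partial>N01)"
proof -
  have e: "of_real z ^ k * b y z ^ Suc l = of_real y * (of_real z ^ k * b y z ^ l) + \<i> * (of_real z ^ Suc k * b y z ^ l)" for z k l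
    by (simp add: b_def algebra_simps)
  have I: "integrable N01 (\<lambda>z. of_real z ^ k * b y z ^ l)" for k l
  proof (induction l arbitrary: k)
    case 0 then show ?case by (simp add: N01_integrable_power)
  next
    case (Suc l) then show ?case unfolding e by (intro Bochner_Integration.integrable_add integrable_mult_right)
  qed
  then show "integrable N01 (\<lambda>z. of_real z ^ k * b y z ^ l)" .
  define E where "E k l = (\<integral>z. of_real z ^ k * b y z ^ l \<partial>N01)" for k l
  have E: "E k (Suc l) = of_real y * E k l + \<i> * E (Suc k) l" for k l
    unfolding E_def e using I by (subst Bochner_Integration.integral_add) (auto simp del: power_Suc)
  have "E (Suc k) l = of_nat k * E (k - 1) l + of_nat l * \<i> * E k (l - 1)" for k
  proof (induction l arbitrary: k)
    case 0
    have "E k 0 = of_real (\<integral>t. t ^ k \<partial>N01)" for k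
      by (simp add: E_def flip: of_real_power)
    then show ?case by (simp only: N01_moment_Suc) simp
  next
    case (Suc l)
    have "E (Suc k) (Suc l) = of_real y * E (Suc k) l + \<i> * E (Suc (Suc k)) l" by (rule E)
    also have "\<dots> = of_nat k * (of_real y * E (k - 1) l + \<i> * E k l)
       + \<i> * E k l + of_nat l * \<i> * (of_real y * E k (l - 1) + \<i> * E (Suc k) (l - 1))"
      by (simp add: Suc[of k] Suc[of "Suc k"]) (simp add: algebra_simps)
    also have "of_nat k * (of_real y * E (k - 1) l + \<i> * E k l) = of_nat k * E (k - 1) (Suc l)"
      by (cases k) (auto simp: E)
    also have "of_nat l * \<i> * (of_real y * E k (l - 1) + \<i> * E (Suc k) (l - 1)) = of_nat l * \<i> * E k l"
      by (cases l) (auto simp: E)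
    finally show ?case by (simp add: algebra_simps)
  qed
  then show "(\<integral>z. of_real z ^ Suc k * b y z ^ l \<partial>N01) =
      of_nat k * (\<integral>z. of_real z ^ (k - 1) * b y z ^ l \<partial>N01) + of_nat l * \<i> * (\<integral>z. of_real z ^ k * b y z ^ (l - 1) \<partial>N01)"
    by (simp only: E_def)
qed

text \<open>Stein's identity applied to one factor y + iZ yields E(y + iZ)^(m+1) = y E(y + iZ)^m - m
  E(y + iZ)^(m-1), which is the recurrence of \<open>hpoly\<close>.\<close>

lemma
  shows hpoly_integral: "(\<integral>z. (of_real y + \<i> * complex_of_real z) ^ m \<partial>N01) = of_real (hpoly m y)"
    and hpoly_integrable: "integrable N01 (\<lambda>z. (of_real y + \<i> * complex_of_real z) ^ m)"
proof -
  let ?b = "\<lambda>z. of_real y + \<i> * complex_of_real z"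
  have I: "integrable N01 (\<lambda>z. ?b z ^ m)" "integrable N01 (\<lambda>z. complex_of_real z * ?b z ^ m)" for m
    using N01_stein(1)[of 0 y m] N01_stein(1)[of 1 y m] by simp_all
  show "integrable N01 (\<lambda>z. ?b z ^ m)" by (rule I)
  have S: "(\<integral>z. ?b z ^ Suc m \<partial>N01) = of_real y * (\<integral>z. ?b z ^ m \<partial>N01) - of_nat m * (\<integral>z. ?b z ^ (m - 1) \<partial>N01)" for m
  proof -
    have "(\<integral>z. ?b z ^ Suc m \<partial>N01) = (\<integral>z. of_real y * ?b z ^ m + \<i> * (complex_of_real z * ?b z ^ m) \<partial>N01)"
      by (rule Bochner_Integration.integral_cong) (auto simp: algebra_simps)
    also have "\<dots> = of_real y * (\<integral>z. ?b z ^ m \<partial>N01) + \<i> * (\<integral>z. complex_of_real z * ?b z ^ m \<partial>N01)"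
      using I by (subst Bochner_Integration.integral_add) auto
    also have "(\<integral>z. complex_of_real z * ?b z ^ m \<partial>N01) = of_nat m * \<i> * (\<integral>z. ?b z ^ (m - 1) \<partial>N01)"
      using N01_stein(2)[of 0 y m] by simp
    finally show ?thesis by (simp add: algebra_simps)
  qed
  show "(\<integral>z. ?b z ^ m \<partial>N01) = of_real (hpoly m y)"
  proof (induction m rule: less_induct)
    case (less m)
    show ?case
    proof (cases m)
      case 0 then show ?thesis using N01.prob_space by simp
    next
      case (Suc k)
      show ?thesis unfolding Suc S using less[of k] less[of "k - 1"] Suc
        by (cases k) (auto simp: hpoly_Suc)
    qed
  qed
qed

section \<open>Hermite polynomials in several variables, indexed by words\<close>

lemma vec_nth_measurable[measurable (raw)]:
  fixes f :: "'a \<Rightarrow> real ^ 'd"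
  shows "f \<in> borel_measurable M \<Longrightarrow> (\<lambda>p. f p $ j) \<in> borel_measurable M"
  by (rule measurable_compose[OF _ borel_measurable_continuous_onI]) (auto intro: continuous_intros)

lemma
  fixes f :: "'a \<Rightarrow> 'c::{real_normed_field, banach, second_countable_topology}" and g :: "'b \<Rightarrow> 'c"
  assumes "sigma_finite_measure M" "sigma_finite_measure N" and f: "integrable M f" and g: "integrable N g"
  shows integrable_pair_mult: "integrable (M \<Otimes>\<^sub>M N) (\<lambda>p. f (fst p) * g (snd p))"
    and integral_pair_mult: "(\<integral>p. f (fst p) * g (snd p) \<partial>(M \<Otimes>\<^sub>M N)) = (\<integral>x. f x \<partial>M) * (\<integral>y. g y \<partial>N)"
proof -
  interpret M: sigma_finite_measure M by fact
  interpret N: sigma_finite_measure N by fact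
  interpret pair_sigma_finite M N ..
  have [measurable]: "f \<in> borel_measurable M" "g \<in> borel_measurable N" using f g by auto
  show I: "integrable (M \<Otimes>\<^sub>M N) (\<lambda>p. f (fst p) * g (snd p))"
    by (rule Fubini_integrable) (auto simp: norm_mult f g)
  show "(\<integral>p. f (fst p) * g (snd p) \<partial>(M \<Otimes>\<^sub>M N)) = (\<integral>x. f x \<partial>M) * (\<integral>y. g y \<partial>N)"
    using integral_fst'[OF I] by simp
qed

lemma prod_list_map_count:
  fixes a :: "'d::finite \<Rightarrow> 'c::comm_monoid_mult"
  shows "prod_list (map a w) = (\<Prod>j\<in>UNIV. a j ^ count_list w j)"
proof (induction w)
  case (Cons i w)
  have "(\<Prod>j\<in>UNIV. a j ^ count_list (i # w) j) = (\<Prod>j\<in>UNIV. (if j = i then a j else 1) * a j ^ count_list w j)"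
    by (rule prod.cong) auto
  also have "\<dots> = a i * (\<Prod>j\<in>UNIV. a j ^ count_list w j)"
    by (simp add: prod.distrib prod.delta)
  finally show ?case by (simp add: Cons)
qed simp

lemma lists_length_Suc: "{w. length w = Suc m} = (\<lambda>(i, w). i # w) ` (UNIV \<times> {w. length w = m})"
  by (auto simp: length_Suc_conv image_iff)

lemma sum_lists_Suc:
  fixes F :: "'d::finite list \<Rightarrow> 'c::comm_monoid_add"
  shows "(\<Sum>w | length w = Suc m. F w) = (\<Sum>i\<in>UNIV. \<Sum>w | length w = m. F (i # w))"
  unfolding lists_length_Suc
  by (subst sum.reindex) (auto simp: inj_on_def sum.cartesian_product case_prod_beta)

lemma sum_power_lists:
  fixes c :: "'d::finite \<Rightarrow> 'c::comm_semiring_1"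
  shows "(\<Sum>j\<in>UNIV. c j) ^ m = (\<Sum>w | length w = m. prod_list (map c w))"
proof (induction m)
  case (Suc m)
  show ?case by (simp add: sum_lists_Suc Suc sum_product)
qed simp

lemma finite_lists_length: "finite {w :: 'd::finite list. length w = m}"
  using finite_lists_length_eq[of "UNIV :: 'd set" m] by simp

text \<open>Hermite polynomials are indexed by words \<open>w\<close> of coordinates, so that \<open>He w\<close> is \<open>\<plusminus>\<partial>\<^sub>w \<phi> / \<phi>\<close> and
  the multinomial theorem becomes a plain sum over words.\<close>

definition He :: "'d::finite list \<Rightarrow> real ^ 'd \<Rightarrow> real" where
  "He w x = (\<Prod>j\<in>UNIV. hpoly (count_list w j) (x $ j))"

definition cvec :: "real ^ 'd \<Rightarrow> real ^ 'd \<Rightarrow> 'd \<Rightarrow> complex" where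
  "cvec x z j = of_real (x $ j) + \<i> * of_real (z $ j)"

lemma hpoly_continuous: "continuous_on UNIV (hpoly m)"
  by (intro continuous_at_imp_continuous_on ballI DERIV_isCont[OF hpoly_deriv])

lemma hpoly_measurable[measurable]: "hpoly m \<in> borel_measurable borel"
  by (rule borel_measurable_continuous_onI[OF hpoly_continuous])

lemma He_measurable[measurable]: "He w \<in> borel_measurable borel"
  unfolding He_def[abs_def] by measurable

lemma cvec_measurable[measurable (raw)]:
  assumes [measurable]: "f \<in> borel_measurable M" "g \<in> borel_measurable M"
  shows "(\<lambda>p. cvec (f p) (g p) j) \<in> borel_measurable M"
  unfolding cvec_def by measurable

lemma prod_list_measurable[measurable (raw)]:
  fixes F :: "'i \<Rightarrow> 'a \<Rightarrow> complex"
  shows "(\<And>i. F i \<in> borel_measurable M) \<Longrightarrow> (\<lambda>p. prod_list (map (\<lambda>i. F i p) w)) \<in> borel_measurable M"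
  by (induction w) auto

lemma
  shows He_integrable: "integrable gam (\<lambda>z. prod_list (map (cvec x z) w))"
    and He_integral: "(\<integral>z. prod_list (map (cvec x z) w) \<partial>gam) = of_real (He w x)"
proof -
  have e: "prod_list (map (cvec x z) w) = (\<Prod>j\<in>UNIV. (\<lambda>t. (of_real (x $ j) + \<i> * of_real t) ^ count_list w j) (z $ j))" for z
    by (simp add: prod_list_map_count cvec_def)
  show "integrable gam (\<lambda>z. prod_list (map (cvec x z) w))"
    unfolding e by (intro gam_integrable_prod hpoly_integrable)
  show "(\<integral>z. prod_list (map (cvec x z) w) \<partial>gam) = of_real (He w x)"
    unfolding e by (subst gam_integral_prod) (auto simp: hpoly_integrable hpoly_integral He_def)
qed

lemma Hermite_eq_He:
  "Hermite (\<chi> j. count_list w j) x = He w x / (\<Prod>j\<in>UNIV. sqrt (fact (count_list w j)))"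
  by (simp add: Hermite_def He_def hermite_hpoly prod_dividef)

text \<open>Bridges the two indexings: admissibility quantifies over multi-indices, whereas
  coefficients are taken along words. Concatenated blocks of repeated coordinates realise any
  multi-index.\<close>

lemma ex_list_count:
  fixes k :: "nat ^ 'd"
  obtains w where "k = (\<chi> j. count_list w j)"
proof -
  obtain js :: "'d list" where js: "set js = UNIV" "distinct js" using finite_distinct_list[OF finite] by blast
  have cr: "count_list (replicate n i) i = n" for n and i :: 'd by (induction n) auto
  have c: "count_list (concat (map (\<lambda>j. replicate (k $ j) j) js)) i = (if i \<in> set js then k $ i else 0)"
    if "distinct js" for i js using that by (induction js) (auto simp: count_list_0_iff cr)
  have "k = (\<chi> j. count_list (concat (map (\<lambda>j. replicate (k $ j) j) js)) j)"
    using c[OF js(2)] by (simp add: vec_eq_iff js)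
  then show ?thesis by (rule that)
qed

lemma mi_length_count: "mi_length (\<chi> j. count_list w j) = length w"
  unfolding mi_length_def using sum_count_set[of w UNIV] by simp

section \<open>The kernel in several variables and integrable majorants\<close>

definition kernel :: "real \<Rightarrow> real ^ 'd \<Rightarrow> real ^ 'd \<Rightarrow> real" where
  "kernel r x y = (\<Prod>j\<in>UNIV. kernel1 r (x $ j) (y $ j))"

lemma kernel_measurable[measurable (raw)]:
  assumes [measurable]: "f \<in> borel_measurable M" "g \<in> borel_measurable M"
  shows "(\<lambda>p. kernel r (f p) (g p)) \<in> borel_measurable M"
  unfolding kernel_def kernel1_def by measurable

text \<open>The common dominating function: integrable against the Gaussian exactly because r < 1
  leaves some decay. It is used with the Mehler parameter r for the exponential series and with r =
  1/2 for single Hermite words.\<close>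

definition gmajor :: "real \<Rightarrow> real ^ 'd \<Rightarrow> real" where
  "gmajor r x = exp (r * (norm x)\<^sup>2 / 2)"

lemma gmajor_measurable[measurable]: "gmajor r \<in> borel_measurable borel"
  unfolding gmajor_def[abs_def] by measurable

lemma gmajor_nonneg: "0 \<le> gmajor r x" by (simp add: gmajor_def)

lemma gmajor_integrable:
  assumes "0 \<le> r" "r < 1" shows "integrable gam (gmajor r)"
proof -
  \<comment> \<open>The parameter is \<open>sqrt r\<close> because the quadratic-exponent lemma
    squares it.\<close>
  have I: "integrable N01 (\<lambda>t. exp (0 * complex_of_real t + of_real ((sqrt r)\<^sup>2 * t\<^sup>2 / 2)))"
    by (rule N01_integrable_exp_quad) (use assms in auto)
  have "integrable N01 (\<lambda>t. exp (r * t\<^sup>2 / 2))"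
    using integrable_norm[OF I] assms by simp
  then have "integrable gam (\<lambda>x::real^'a. \<Prod>j\<in>UNIV. (\<lambda>t. exp (r * t\<^sup>2 / 2)) (x $ j))"
    by (intro gam_integrable_prod)
  then show ?thesis
    by (simp add: gmajor_def[abs_def] exp_sum[symmetric] norm_sq_vec sum_divide_distrib sum_distrib_left)
qed

lemma norm_cvec_sq: "(norm (cvec x z j))\<^sup>2 = (x $ j)\<^sup>2 + (z $ j)\<^sup>2"
  unfolding cvec_def cmod_power2 by simp

lemma norm_cvec_sum:
  "norm (\<Sum>j\<in>UNIV. cvec x z j * cvec y v j) \<le> (norm x)\<^sup>2 / 2 + (norm z)\<^sup>2 / 2 + (norm y)\<^sup>2 / 2 + (norm v)\<^sup>2 / 2"
proof -
  have q: "norm a * norm b \<le> ((norm a)\<^sup>2 + (norm b)\<^sup>2) / 2" for a b :: complex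
    using sum_squares_bound[of "norm a" "norm b"] by simp
  have "norm (\<Sum>j\<in>UNIV. cvec x z j * cvec y v j) \<le> (\<Sum>j\<in>UNIV. norm (cvec x z j) * norm (cvec y v j))"
    by (rule sum_norm_le) (simp add: norm_mult)
  also have "\<dots> \<le> (\<Sum>j\<in>UNIV. ((norm (cvec x z j))\<^sup>2 + (norm (cvec y v j))\<^sup>2) / 2)"
    by (intro sum_mono) (rule q)
  also have "\<dots> = (norm x)\<^sup>2 / 2 + (norm z)\<^sup>2 / 2 + (norm y)\<^sup>2 / 2 + (norm v)\<^sup>2 / 2"
    by (simp add: norm_cvec_sq norm_sq_vec sum.distrib sum_divide_distrib[symmetric] add_divide_distrib)
  finally show ?thesis .
qed

lemma power_le_exp: "0 \<le> t \<Longrightarrow> t ^ m / fact m \<le> exp (t::real)"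
proof -
  assume t: "0 \<le> t"
  have "(\<Sum>k\<in>{m}. t ^ k /\<^sub>R fact k) \<le> (\<Sum>k. t ^ k /\<^sub>R fact k)"
    by (rule sum_le_suminf[OF summable_exp_generic]) (use t in auto)
  then show ?thesis by (simp add: exp_def field_simps)
qed

text \<open>With t^2 = |x|^2 + |z|^2 each factor is at most t. Then t^m \<le> m! e^t, and t \<le> 1
  + t^2/4 turns e^t into e times two copies of \<open>gmajor (1/2)\<close>.\<close>

lemma norm_prod_list_cvec:
  "norm (prod_list (map (cvec x z) w)) \<le> fact (length w) * exp 1 * (gmajor (1/2) x * gmajor (1/2) z)"
proof -
  define t where "t = sqrt ((norm x)\<^sup>2 + (norm z)\<^sup>2)"
  have t: "0 \<le> t" "t\<^sup>2 = (norm x)\<^sup>2 + (norm z)\<^sup>2" by (auto simp: t_def)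
  have c: "norm (cvec x z j) \<le> t" for j
  proof (rule power2_le_imp_le)
    have "(x $ j)\<^sup>2 \<le> (norm x)\<^sup>2" "(z $ j)\<^sup>2 \<le> (norm z)\<^sup>2"
      unfolding norm_sq_vec by (auto intro!: member_le_sum)
    then show "(norm (cvec x z j))\<^sup>2 \<le> t\<^sup>2" by (simp add: norm_cvec_sq t)
  qed (rule t)
  have "norm (prod_list (map (cvec x z) w)) \<le> t ^ length w"
    by (induction w) (auto simp: norm_mult intro!: mult_mono c t)
  also have "\<dots> \<le> fact (length w) * exp t"
    using power_le_exp[OF t(1), of "length w"] by (simp add: field_simps)
  also have "\<dots> \<le> fact (length w) * exp (1 + t\<^sup>2 / 4)"
    using zero_le_power2[of "t / 2 - 1"] by (simp add: power2_eq_square algebra_simps)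
  also have "exp (1 + t\<^sup>2 / 4) = exp 1 * (gmajor (1/2) x * gmajor (1/2) z)"
    by (simp add: gmajor_def exp_add[symmetric] t)
  finally show ?thesis by (simp only: mult.assoc)
qed

abbreviation gam2 :: "((real ^ 'd) \<times> (real ^ 'd)) measure" where "gam2 \<equiv> gam \<Otimes>\<^sub>M gam"

lemma sigma_finite_gam: "sigma_finite_measure gam"
  by (rule gam.sigma_finite_measure_axioms)

lemma pair_prob_space_gam: "pair_prob_space gam gam"
  by (simp add: pair_prob_space_def pair_sigma_finite_def gam.prob_space_axioms sigma_finite_gam)

lemma prob_space_gam2: "prob_space gam2"
  by (rule prob_space_pair) (rule gam.prob_space_axioms)+

lemma sigma_finite_gam2: "sigma_finite_measure gam2"
  using prob_space_gam2 by (rule prob_space_imp_sigma_finite)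

lemma gmajor2_integrable:
  assumes "0 \<le> r" "r < 1"
  shows "integrable gam2 (\<lambda>p. gmajor r (fst p) * gmajor r (snd p))"
  by (rule integrable_pair_mult[OF sigma_finite_gam sigma_finite_gam gmajor_integrable[OF assms] gmajor_integrable[OF assms]])

lemma norm_exp_cvec_le:
  assumes "0 \<le> r"
  shows "exp (r * norm (\<Sum>j\<in>UNIV. cvec x z j * cvec y v j)) \<le> gmajor r x * gmajor r y * (gmajor r z * gmajor r v)"
proof -
  have "r * norm (\<Sum>j\<in>UNIV. cvec x z j * cvec y v j) \<le> r * (norm x)\<^sup>2 / 2 + r * (norm y)\<^sup>2 / 2 + (r * (norm z)\<^sup>2 / 2 + r * (norm v)\<^sup>2 / 2)"
    using mult_left_mono[OF norm_cvec_sum assms, of x z y v] by (simp add: algebra_simps)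
  then show ?thesis unfolding gmajor_def exp_add[symmetric] by simp
qed


text \<open>The exponential of a sum over coordinates is a product, so both Gaussian integrals
  factorise and the one-dimensional identity applies in each coordinate. Fubini is justified by
  \<open>gmajor\<close>, with x and y held fixed.\<close>

lemma exp_cvec_integral:
  fixes x y :: "real ^ 'd"
  assumes r: "0 \<le> r" "r < 1"
  shows "(\<integral>q. exp (of_real r * (\<Sum>j\<in>UNIV. cvec x (fst q) j * cvec y (snd q) j)) \<partial>gam2) = of_real (kernel r x y)"
    (is "(\<integral>q. ?F q \<partial>_) = _")
proof -
  interpret gam2: pair_prob_space "gam :: (real ^ 'd) measure" "gam :: (real ^ 'd) measure"
    by (rule pair_prob_space_gam)
  have I: "integrable gam2 ?F"
  proof (rule Bochner_Integration.integrable_bound)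
    show "integrable gam2 (\<lambda>q. (gmajor r x * gmajor r y) * (gmajor r (fst q) * gmajor r (snd q)))"
      by (intro integrable_mult_right gmajor2_integrable r)
    show "AE q in gam2. norm (?F q) \<le> norm ((gmajor r x * gmajor r y) * (gmajor r (fst q) * gmajor r (snd q)))"
    proof (rule AE_I2)
      fix q :: "(real ^ 'd) \<times> (real ^ 'd)"
      have "norm (?F q) \<le> exp (r * norm (\<Sum>j\<in>UNIV. cvec x (fst q) j * cvec y (snd q) j))"
        unfolding norm_exp_eq_Re using mult_left_mono[OF complex_Re_le_cmod r(1)] by (simp del: Re_sum)
      also note norm_exp_cvec_le[OF r(1), of x "fst q" y "snd q"]
      finally show "norm (?F q) \<le> norm ((gmajor r x * gmajor r y) * (gmajor r (fst q) * gmajor r (snd q)))"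
        by (simp add: gmajor_nonneg)
    qed
  qed measurable
  let ?e = "\<lambda>j t s. exp (of_real r * ((of_real (x $ j) + \<i> * of_real t) * (of_real (y $ j) + \<i> * complex_of_real s)))"
  have "(\<integral>q. ?F q \<partial>gam2) = (\<integral>z. \<integral>v. ?F (z, v) \<partial>gam \<partial>gam)"
    by (rule gam2.integral_fst'[OF I, symmetric])
  also have "\<dots> = (\<integral>z. \<integral>v. (\<Prod>j\<in>UNIV. ?e j (z $ j) (v $ j)) \<partial>gam \<partial>gam)"
    by (simp add: cvec_def exp_sum[symmetric] sum_distrib_left)
  also have "\<dots> = (\<integral>z. (\<Prod>j\<in>UNIV. \<integral>s. ?e j (z $ j) s \<partial>N01) \<partial>gam)"
    by (subst gam_integral_prod) (auto intro: N01_exp_bilinear_inner_integrable r)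
  also have "\<dots> = (\<Prod>j\<in>UNIV. \<integral>t. \<integral>s. ?e j t s \<partial>N01 \<partial>N01)"
    by (subst gam_integral_prod[of "\<lambda>j t. \<integral>s. ?e j t s \<partial>N01"]) (auto intro: N01_exp_bilinear_integrable r)
  also have "\<dots> = of_real (kernel r x y)"
    by (simp add: N01_exp_bilinear_integral r kernel_def)
  finally show "(\<integral>q. ?F q \<partial>gam2) = of_real (kernel r x y)" .
qed

section \<open>Mehler's formula\<close>

definition hcoeff :: "(real ^ 'd \<Rightarrow> real) \<Rightarrow> 'd::finite list \<Rightarrow> real" where
  "hcoeff f w = (\<integral>x. f x * He w x \<partial>gam)"

text \<open>The squared norm of the projection to the Hermite functions of degree \<open>m\<close>. Each multi-index
  \<open>k\<close> is counted through its \<open>m! / k!\<close> words.\<close>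

definition hlevel :: "(real ^ 'd \<Rightarrow> real) \<Rightarrow> nat \<Rightarrow> real" where
  "hlevel f m = (\<Sum>w | length w = m. (hcoeff f w)\<^sup>2) / fact m"

text \<open>The quadratic form <f, P_r f> in the Gaussian L^2 space, as a double integral against
  Mehler's kernel; series expansion and probabilistic coupling are both read off from it.\<close>

definition mehler_form :: "real \<Rightarrow> (real ^ 'd \<Rightarrow> real) \<Rightarrow> real" where
  "mehler_form r f = (\<integral>p. f (fst p) * f (snd p) * kernel r (fst p) (snd p) \<partial>gam2)"

text \<open>Integrates \<open>norm_prod_list_cvec\<close> over z. The growth is far from sharp, but
  \<open>gmajor (1/2)\<close> is integrable.\<close>

lemma He_abs_le:
  fixes x :: "real ^ 'd"
  shows "\<bar>He w x\<bar> \<le> fact (length w) * exp 1 * (\<integral>z. gmajor (1/2) (z :: real ^ 'd) \<partial>gam) * gmajor (1/2) x"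
proof -
  have "\<bar>He w x\<bar> = norm (\<integral>z. prod_list (map (cvec x z) w) \<partial>gam)" by (simp add: He_integral)
  also have "\<dots> \<le> (\<integral>z. fact (length w) * exp 1 * (gmajor (1/2) x * gmajor (1/2) (z :: real ^ 'd)) \<partial>gam)"
    by (rule Bochner_Integration.integral_norm_bound_integral[OF He_integrable])
      (auto intro!: integrable_mult_right gmajor_integrable norm_prod_list_cvec)
  finally show ?thesis by (simp add: mult_ac)
qed

lemma He_gam_integrable: "integrable (gam :: (real ^ 'd) measure) (He w)"
proof (rule Bochner_Integration.integrable_bound)
  show "integrable (gam :: (real ^ 'd) measure) (\<lambda>x. fact (length w) * exp 1 * (\<integral>z. gmajor (1/2) (z :: real ^ 'd) \<partial>gam) * gmajor (1/2) x)"
    by (intro integrable_mult_right gmajor_integrable) auto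
  show "AE x in (gam :: (real ^ 'd) measure). norm (He w x) \<le> norm (fact (length w) * exp 1 * (\<integral>z. gmajor (1/2) (z :: real ^ 'd) \<partial>gam) * gmajor (1/2) x)"
  proof (rule AE_I2)
    fix x :: "real ^ 'd"
    note He_abs_le[of w x]
    also have "y \<le> \<bar>y\<bar>" for y :: real by simp
    finally show "norm (He w x) \<le> norm (fact (length w) * exp 1 * (\<integral>z. gmajor (1/2) (z :: real ^ 'd) \<partial>gam) * gmajor (1/2) x)" by simp
  qed
qed measurable

lemma integrable_bounded_mult_He:
  fixes u :: "real ^ 'd \<Rightarrow> real"
  assumes [measurable]: "u \<in> borel_measurable borel" and B: "\<And>x. \<bar>u x\<bar> \<le> B"
  shows "integrable gam (\<lambda>x. u x * He w x)"
proof (rule Bochner_Integration.integrable_bound[OF integrable_mult_right[OF He_gam_integrable[of w], of B]])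
  have "\<bar>u x\<bar> \<le> \<bar>B\<bar>" for x using B[of x] by linarith
  then show "AE x in gam. norm (u x * He w x) \<le> norm (B * He w x)"
    by (simp add: abs_mult mult_right_mono)
qed measurable

text \<open>Writing \<open>He w(x) = E \<Prod>(x\<^sub>j + \<i> Z\<^sub>j)\<close>, Mehler's formula is the exponential series of
  \<open>r (x + \<i> Z) \<cdot> (y + \<i> W)\<close>, dominated by \<open>exp(r(\<bar>x\<bar>\<^sup>2 + \<bar>y\<bar>\<^sup>2 + \<bar>Z\<bar>\<^sup>2 + \<bar>W\<bar>\<^sup>2) / 2)\<close>.\<close>

lemma mehler_sums:
  fixes f :: "real ^ 'd \<Rightarrow> real"
  assumes r: "0 \<le> r" "r < 1" and f[measurable]: "f \<in> borel_measurable borel" and B: "\<And>x. \<bar>f x\<bar> \<le> B"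
  shows "(\<lambda>m. r ^ m * hlevel f m) sums mehler_form r f"
proof -
  let ?Q = "(gam2 :: ((real ^ 'd) \<times> (real ^ 'd)) measure) \<Otimes>\<^sub>M (gam2 :: ((real ^ 'd) \<times> (real ^ 'd)) measure)"
  interpret Q: pair_sigma_finite "gam2 :: ((real ^ 'd) \<times> (real ^ 'd)) measure" "gam2 :: ((real ^ 'd) \<times> (real ^ 'd)) measure"
    by (simp add: pair_sigma_finite_def sigma_finite_gam2)
  define ff where "ff p = complex_of_real (f (fst p) * f (snd p))" for p :: "(real ^ 'd) \<times> (real ^ 'd)"
  have [measurable]: "ff \<in> borel_measurable gam2" unfolding ff_def[abs_def] by measurable
  have "0 \<le> B" using B[of 0] by linarith
  have ffB: "norm (ff p) \<le> B * B" for p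
    unfolding ff_def by (auto simp: norm_mult abs_mult intro!: mult_mono B \<open>0 \<le> B\<close>)
  define S where "S p q = (\<Sum>j\<in>UNIV. cvec (fst p) (fst q) j * cvec (snd p) (snd q) j)" for p q :: "(real ^ 'd) \<times> (real ^ 'd)"
  have [measurable]: "(\<lambda>t. S (fst t) (snd t)) \<in> borel_measurable ?Q" unfolding S_def by measurable
  define maj where "maj r t = (\<lambda>p. gmajor r (fst p) * gmajor r (snd p)) (fst t) * (\<lambda>p. gmajor r (fst p) * gmajor r (snd p)) (snd t)"
    for r and t :: "((real ^ 'd) \<times> (real ^ 'd)) \<times> ((real ^ 'd) \<times> (real ^ 'd))"
  have [measurable]: "maj r \<in> borel_measurable ?Q" for r unfolding maj_def by measurable
  have majI: "integrable ?Q (maj r)" if "0 \<le> r" "r < 1" for r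
    unfolding maj_def[abs_def] by (rule integrable_pair_mult[OF sigma_finite_gam2 sigma_finite_gam2]) (rule gmajor2_integrable[OF that])+
  have maj0: "0 \<le> maj r t" for r t by (simp add: maj_def gmajor_nonneg)
  have Smaj: "exp (r * norm (S (fst t) (snd t))) \<le> maj r t" if "0 \<le> r" for r t
    using norm_exp_cvec_le[OF that, of "fst (fst t)" "fst (snd t)" "snd (fst t)" "snd (snd t)"]
    by (simp add: S_def maj_def mult_ac)
  define F where "F t = ff (fst t) * exp (of_real r * S (fst t) (snd t))" for t
  define P where "P m t = ff (fst t) * (S (fst t) (snd t) ^ m)" for m t
  \<comment> \<open>Every partial sum is bounded by the full exponential series of the moduli, so a
    single majorant serves all M.\<close>
  have part: "norm (\<Sum>m<M. of_real (r ^ m / fact m) * P m t) \<le> B * B * maj r t" for M t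
  proof -
    let ?s = "S (fst t) (snd t)"
    have "norm (\<Sum>m<M. of_real (r ^ m / fact m) * P m t) \<le> (\<Sum>m<M. norm (of_real (r ^ m / fact m) * P m t))"
      by (rule norm_sum)
    also have "\<dots> = norm (ff (fst t)) * (\<Sum>m<M. (r * norm ?s) ^ m /\<^sub>R fact m)"
      unfolding sum_distrib_left using r
      by (intro sum.cong refl) (simp add: P_def norm_mult norm_power norm_divide norm_inverse power_mult_distrib divide_inverse)
    also have "\<dots> \<le> (B * B) * exp (r * norm ?s)"
      unfolding exp_def using r
      by (intro mult_mono ffB sum_le_suminf summable_exp_generic) (auto intro!: sum_nonneg simp: \<open>0 \<le> B\<close>)
    also have "\<dots> \<le> B * B * maj r t" using Smaj[OF r(1), of t] \<open>0 \<le> B\<close> by (intro mult_left_mono) auto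
    finally show ?thesis .
  qed
  have lim: "(\<lambda>M. \<Sum>m<M. of_real (r ^ m / fact m) * P m t) \<longlonglongrightarrow> F t" for t
  proof -
    let ?s = "S (fst t) (snd t)"
    have "(\<lambda>m. ff (fst t) * ((of_real r * ?s) ^ m /\<^sub>R fact m)) sums (ff (fst t) * exp (of_real r * ?s))"
      by (intro sums_mult exp_converges)
    also have "(\<lambda>m. ff (fst t) * ((of_real r * ?s) ^ m /\<^sub>R fact m)) = (\<lambda>m. of_real (r ^ m / fact m) * P m t)"
      by (simp add: P_def power_mult_distrib scaleR_conv_of_real divide_inverse fun_eq_iff)
    finally show ?thesis unfolding sums_def F_def .
  qed
  have Fm[measurable]: "F \<in> borel_measurable ?Q" and Pm[measurable]: "P m \<in> borel_measurable ?Q" for m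
    unfolding F_def[abs_def] P_def[abs_def] by measurable
  have DI: "integrable ?Q F" and DL: "(\<lambda>M. \<integral>t. (\<Sum>m<M. of_real (r ^ m / fact m) * P m t) \<partial>?Q) \<longlonglongrightarrow> (\<integral>t. F t \<partial>?Q)"
  proof -
    have M: "integrable ?Q (\<lambda>t. B * B * maj r t)" by (intro integrable_mult_right majI r)
    define Sm where "Sm M t = (\<Sum>m<M. of_real (r ^ m / fact m) * P m t)" for M t
    have m: "Sm M \<in> borel_measurable ?Q" for M unfolding Sm_def[abs_def] by measurable
    have l: "AE t in ?Q. (\<lambda>M. Sm M t) \<longlonglongrightarrow> F t" unfolding Sm_def by (intro AE_I2 lim)
    have p: "AE t in ?Q. norm (Sm M t) \<le> B * B * maj r t" for M unfolding Sm_def by (intro AE_I2 part)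
    show "integrable ?Q F"
      by (rule integrable_dominated_convergence[OF Fm m M l p])
    show "(\<lambda>M. \<integral>t. (\<Sum>m<M. of_real (r ^ m / fact m) * P m t) \<partial>?Q) \<longlonglongrightarrow> (\<integral>t. F t \<partial>?Q)"
      using integral_dominated_convergence[OF Fm m M l p] unfolding Sm_def .
  qed
  have IF: "(\<integral>t. F t \<partial>?Q) = of_real (mehler_form r f)"
  proof -
    have "(\<integral>t. F t \<partial>?Q) = (\<integral>p. \<integral>q. F (p, q) \<partial>gam2 \<partial>gam2)"
      by (rule Q.integral_fst'[OF DI, symmetric])
    also have "\<dots> = (\<integral>p. ff p * of_real (kernel r (fst p) (snd p)) \<partial>gam2)"
      unfolding F_def fst_conv snd_conv S_def by (simp add: exp_cvec_integral r)
    also have "\<dots> = of_real (mehler_form r f)"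
      unfolding mehler_form_def ff_def by (simp flip: integral_complex_of_real)
    finally show ?thesis .
  qed
  have IP: "integrable ?Q (P m)" "(\<integral>t. P m t \<partial>?Q) = of_real (fact m * hlevel f m)" for m
  proof -
    \<comment> \<open>The contribution of one word: the m-th power of a sum over coordinates expands
      into words, and the product along a word splits into an (x, Z) factor and a (y, W)
      factor.\<close>
    define R where "R w t = ff (fst t) * (prod_list (map (cvec (fst (fst t)) (fst (snd t))) w) * prod_list (map (cvec (snd (fst t)) (snd (snd t))) w))"
      for w :: "'d list" and t :: "((real ^ 'd) \<times> (real ^ 'd)) \<times> ((real ^ 'd) \<times> (real ^ 'd))"
    have Rm[measurable]: "R w \<in> borel_measurable ?Q" for w unfolding R_def[abs_def] by measurable
    have PR: "P m t = (\<Sum>w | length w = m. R w t)" for t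
    proof -
      have "prod_list (map (\<lambda>j. a j * b j) w) = prod_list (map a w) * prod_list (map b w)" for a b :: "'d \<Rightarrow> complex" and w
        by (induction w) auto
      then show ?thesis
        by (simp add: P_def S_def R_def sum_power_lists sum_distrib_left)
    qed
    have RI: "integrable ?Q (R w)" for w
    proof (rule Bochner_Integration.integrable_bound)
      let ?C = "fact (length w) * exp 1"
      show "integrable ?Q (\<lambda>t. B * B * (?C * ?C) * maj (1/2) t)" by (intro integrable_mult_right majI) auto
      show "AE t in ?Q. norm (R w t) \<le> norm (B * B * (?C * ?C) * maj (1/2) t)"
      proof (rule AE_I2)
        fix t
        have "norm (R w t) \<le> (B * B) * ((?C * (gmajor (1/2) (fst (fst t)) * gmajor (1/2) (fst (snd t)))) * (?C * (gmajor (1/2) (snd (fst t)) * gmajor (1/2) (snd (snd t)))))"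
          unfolding R_def norm_mult using norm_prod_list_cvec \<open>0 \<le> B\<close>
          by (intro mult_mono ffB) (auto simp: gmajor_nonneg norm_mult[symmetric] intro!: mult_nonneg_nonneg)
        also have "\<dots> = B * B * (?C * ?C) * maj (1/2) t" by (simp add: maj_def mult_ac)
        finally show "norm (R w t) \<le> norm (B * B * (?C * ?C) * maj (1/2) t)"
          using \<open>0 \<le> B\<close> maj0 by simp
      qed
    qed measurable
    \<comment> \<open>Integrating out Z and W replaces the two factors by \<open>He w\<close> at x
      and at y; the remaining integrals over x and y separate into the square of one
      coefficient.\<close>
    have RV: "(\<integral>t. R w t \<partial>?Q) = of_real ((hcoeff f w)\<^sup>2)" for w
    proof -
      have fi: "integrable gam (\<lambda>x. complex_of_real (f x * He w x))"
        by (rule integrable_of_real[OF integrable_bounded_mult_He[OF f B]])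
      have "(\<integral>t. R w t \<partial>?Q) = (\<integral>p. \<integral>q. R w (p, q) \<partial>gam2 \<partial>gam2)"
        by (rule Q.integral_fst'[OF RI, symmetric])
      also have "\<dots> = (\<integral>p. ff p * (of_real (He w (fst p)) * of_real (He w (snd p))) \<partial>gam2)"
        unfolding R_def fst_conv snd_conv integral_mult_right_zero
        by (subst integral_pair_mult[OF sigma_finite_gam sigma_finite_gam He_integrable He_integrable]) (simp add: He_integral)
      also have "\<dots> = (\<integral>p. of_real (f (fst p) * He w (fst p)) * of_real (f (snd p) * He w (snd p)) \<partial>gam2)"
        by (simp add: ff_def mult_ac)
      also have "\<dots> = of_real (hcoeff f w) * of_real (hcoeff f w)"
        by (subst integral_pair_mult[OF sigma_finite_gam sigma_finite_gam fi fi]) (simp only: hcoeff_def integral_complex_of_real)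
      finally show ?thesis by (simp add: power2_eq_square)
    qed
    show "integrable ?Q (P m)" unfolding PR[abs_def] by (intro Bochner_Integration.integrable_sum RI)
    show "(\<integral>t. P m t \<partial>?Q) = of_real (fact m * hlevel f m)"
      unfolding PR by (subst Bochner_Integration.integral_sum) (auto simp: RI RV hlevel_def)
  qed
  have "(\<integral>t. (\<Sum>m<M. of_real (r ^ m / fact m) * P m t) \<partial>?Q) = of_real (\<Sum>m<M. r ^ m * hlevel f m)" for M
    by (subst Bochner_Integration.integral_sum) (auto simp: IP)
  then have "(\<lambda>M. complex_of_real (\<Sum>m<M. r ^ m * hlevel f m)) \<longlonglongrightarrow> of_real (mehler_form r f)"
    using DL IF by simp
  then show ?thesis unfolding sums_def by (simp only: tendsto_of_real_iff)
qed

section \<open>The Ornstein--Uhlenbeck kernel\<close>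

lemma kernel1_pos: "0 < kernel1 r x y" if "0 \<le> r" "r < 1"
  using that by (simp add: kernel1_def abs_square_less_1)

lemma kernel_nonneg: "0 \<le> kernel r x y" if "0 \<le> r" "r < 1"
  unfolding kernel_def by (intro prod_nonneg ballI less_imp_le kernel1_pos that)

text \<open>Reversibility of the Ornstein-Uhlenbeck process: \<open>kernel1\<close> is a density
  relative to the Gaussian measure, and relative to it the transition law is symmetric. This is what
  makes the second marginal of \<open>nu\<close> Gaussian.\<close>

lemma kernel1_sym: "kernel1 r x y = kernel1 r y x" if "0 \<le> r" "r < 1"
proof -
  have "r\<^sup>2 < 1" using that by (simp add: abs_square_less_1)
  then have "y\<^sup>2 / 2 - (y - r * x)\<^sup>2 / (2 * (1 - r\<^sup>2)) = x\<^sup>2 / 2 - (x - r * y)\<^sup>2 / (2 * (1 - r\<^sup>2))"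
    by (simp add: field_simps) (simp add: power2_eq_square algebra_simps)
  then show ?thesis by (simp only: kernel1_def)
qed

lemma kernel_sym: "kernel r x y = kernel r y x" if "0 \<le> r" "r < 1"
  unfolding kernel_def by (intro prod.cong refl kernel1_sym that)

text \<open>Under the substitution y = r x + s z with s = sqrt(1 - r^2), the Gaussian density at y
  times the kernel times the Jacobian s^d is the Gaussian density at z. The nonnegative integral is
  used so that the formula yields identities of measures without integrability conditions.\<close>

lemma nn_integral_kernel:
  fixes x :: "real ^ 'd" and F :: "real ^ 'd \<Rightarrow> ennreal"
  assumes r: "0 \<le> r" "r < 1" and F[measurable]: "F \<in> borel_measurable borel"
  shows "(\<integral>\<^sup>+y. ennreal (kernel r x y) * F y \<partial>gam) = (\<integral>\<^sup>+z. F (r *\<^sub>R x + sqrt (1 - r\<^sup>2) *\<^sub>R z) \<partial>gam)"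
proof -
  define s where "s = sqrt (1 - r\<^sup>2)"
  have "r\<^sup>2 < 1" using r by (simp add: abs_square_less_1)
  then have s: "s > 0" "s\<^sup>2 = 1 - r\<^sup>2" by (auto simp: s_def)
  have k1: "std_normal_density (r * a + s * t) * kernel1 r a (r * a + s * t) * s = std_normal_density t" for a t
  proof -
    have e: "(s * t)\<^sup>2 / (2 * (1 - r\<^sup>2)) = t\<^sup>2 / 2" using s by (simp add: power_mult_distrib flip: s(2))
    have "kernel1 r a (r * a + s * t) = exp ((r * a + s * t)\<^sup>2 / 2 - t\<^sup>2 / 2) / s"
      unfolding kernel1_def by (simp only: add_diff_cancel_left' e s_def[symmetric])
    have gen: "exp (- (u / 2)) * exp (u / 2 - v / 2) = exp (- (v / 2))" for u v :: real by (simp flip: exp_add)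
    show ?thesis unfolding \<open>kernel1 r a _ = _\<close>
      using s(1) by (simp only: normal_density_def times_divide_eq_left times_divide_eq_right nonzero_mult_div_cancel_right) (simp add: gen)
  qed
  have k: "phi (r *\<^sub>R x + s *\<^sub>R z) * kernel r x (r *\<^sub>R x + s *\<^sub>R z) * s ^ CARD('d) = phi z" for z :: "real ^ 'd"
  proof -
    have "phi (r *\<^sub>R x + s *\<^sub>R z) * kernel r x (r *\<^sub>R x + s *\<^sub>R z) * s ^ CARD('d)
      = (\<Prod>j\<in>UNIV. std_normal_density (r * x $ j + s * z $ j) * kernel1 r (x $ j) (r * x $ j + s * z $ j) * s)"
      by (simp add: phi_prod kernel_def prod.distrib)
    then show ?thesis by (simp add: k1 phi_prod)
  qed
  have k': "ennreal (s ^ CARD('d)) * (ennreal (phi (r *\<^sub>R x + s *\<^sub>R z) * kernel r x (r *\<^sub>R x + s *\<^sub>R z)) * C)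
    = ennreal (phi z) * C" for z C
  proof -
    have "ennreal (phi z) = ennreal (s ^ CARD('d)) * ennreal (phi (r *\<^sub>R x + s *\<^sub>R z) * kernel r x (r *\<^sub>R x + s *\<^sub>R z))"
      using s(1) k[of z] by (simp add: ennreal_mult[symmetric] kernel_nonneg phi_nonneg r mult.commute)
    then show ?thesis by (simp only: mult.assoc)
  qed
  have "(\<integral>\<^sup>+y. ennreal (kernel r x y) * F y \<partial>gam) = (\<integral>\<^sup>+y. ennreal (phi y * kernel r x y) * F y \<partial>lborel)"
    unfolding gam_def by (subst nn_integral_density) (auto simp: ennreal_mult' phi_nonneg mult_ac)
  also have "\<dots> = (\<integral>\<^sup>+z. ennreal (s ^ CARD('d)) * (ennreal (phi (r *\<^sub>R x + s *\<^sub>R z) * kernel r x (r *\<^sub>R x + s *\<^sub>R z)) * F (r *\<^sub>R x + s *\<^sub>R z)) \<partial>lborel)"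
    using s(1) by (subst lborel_affine[of s "r *\<^sub>R x"]) (auto simp: nn_integral_density nn_integral_distr)
  also have "\<dots> = (\<integral>\<^sup>+z. ennreal (phi z) * F (r *\<^sub>R x + s *\<^sub>R z) \<partial>lborel)"
    by (simp only: k')
  also have "\<dots> = (\<integral>\<^sup>+z. F (r *\<^sub>R x + s *\<^sub>R z) \<partial>gam)"
    unfolding gam_def by (subst nn_integral_density) auto
  finally show ?thesis by (simp only: s_def)
qed

text \<open>The law of \<open>(X, r X + \<surd>(1 - r\<^sup>2) Z)\<close> for independent standard Gaussian vectors \<open>X, Z\<close>.\<close>

definition nu :: "real \<Rightarrow> ((real ^ 'd) \<times> (real ^ 'd)) measure" where
  "nu r = density gam2 (\<lambda>p. ennreal (kernel r (fst p) (snd p)))"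

lemma sets_nu[measurable_cong, simp]: "sets (nu r) = sets gam2" by (simp add: nu_def)
lemma space_nu[simp]: "space (nu r) = UNIV" by (simp add: nu_def space_pair_measure)

context
  fixes r :: real assumes r: "0 \<le> r" "r < 1"
begin

lemma nn_integral_nu:
  fixes F :: "(real ^ 'd) \<times> (real ^ 'd) \<Rightarrow> ennreal"
  assumes [measurable]: "F \<in> borel_measurable gam2"
  shows "(\<integral>\<^sup>+p. F p \<partial>nu r) = (\<integral>\<^sup>+x. \<integral>\<^sup>+y. ennreal (kernel r x y) * F (x, y) \<partial>gam \<partial>gam)"
  unfolding nu_def by (subst nn_integral_density) (auto simp: gam.nn_integral_fst[symmetric])

text \<open>The two descriptions serve different ends: the density form shows the symmetry, the
  push-forward form gives total mass one and pointwise control as r -> 1.\<close>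

lemma nu_eq_distr: "nu r = distr (gam2 :: ((real ^ 'd) \<times> (real ^ 'd)) measure) gam2 (\<lambda>p. (fst p, r *\<^sub>R fst p + sqrt (1 - r\<^sup>2) *\<^sub>R snd p))"
proof (rule measure_eqI)
  fix A :: "((real ^ 'd) \<times> (real ^ 'd)) set" assume "A \<in> sets (nu r)"
  then have [measurable]: "A \<in> sets gam2" by simp
  have "emeasure (nu r) A = (\<integral>\<^sup>+p. indicator A p \<partial>nu r)"
    using \<open>A \<in> sets (nu r)\<close> by (rule nn_integral_indicator[symmetric])
  also have "\<dots> = (\<integral>\<^sup>+x. \<integral>\<^sup>+y. ennreal (kernel r x y) * indicator A (x, y) \<partial>gam \<partial>gam)"
    by (rule nn_integral_nu) simp
  also have "\<dots> = (\<integral>\<^sup>+x. \<integral>\<^sup>+z. indicator A (x, r *\<^sub>R x + sqrt (1 - r\<^sup>2) *\<^sub>R z) \<partial>gam \<partial>gam)"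
    by (subst nn_integral_kernel[OF r]) auto
  also have "\<dots> = (\<integral>\<^sup>+p. indicator A (fst p, r *\<^sub>R fst p + sqrt (1 - r\<^sup>2) *\<^sub>R snd p) \<partial>gam2)"
    by (subst gam.nn_integral_fst[symmetric]) auto
  also have "\<dots> = (\<integral>\<^sup>+p. indicator A p \<partial>distr gam2 gam2 (\<lambda>p. (fst p, r *\<^sub>R fst p + sqrt (1 - r\<^sup>2) *\<^sub>R snd p)))"
    by (subst nn_integral_distr) auto
  also have "\<dots> = emeasure (distr gam2 gam2 (\<lambda>p. (fst p, r *\<^sub>R fst p + sqrt (1 - r\<^sup>2) *\<^sub>R snd p))) A"
    by (rule nn_integral_indicator) (use \<open>A \<in> sets (nu r)\<close> in simp)
  finally show "emeasure (nu r) A = emeasure (distr gam2 gam2 (\<lambda>p. (fst p, r *\<^sub>R fst p + sqrt (1 - r\<^sup>2) *\<^sub>R snd p))) A" .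
qed simp

lemma prob_space_nu: "prob_space (nu r :: ((real ^ 'd) \<times> (real ^ 'd)) measure)"
  unfolding nu_eq_distr by (intro prob_space.prob_space_distr prob_space_gam2) measurable

lemma nn_integral_kernel_1: "(\<integral>\<^sup>+y. ennreal (kernel r x y) \<partial>gam) = 1"
  using nn_integral_kernel[OF r, of "\<lambda>_. 1" x] gam.emeasure_space_1 by simp

lemma distr_nu_fst: "distr (nu r) gam fst = (gam :: (real ^ 'd) measure)"
proof (rule measure_eqI)
  fix A :: "(real ^ 'd) set" assume "A \<in> sets (distr (nu r) gam fst)"
  then have [measurable]: "A \<in> sets borel" by simp
  have "emeasure (distr (nu r) gam fst) A = (\<integral>\<^sup>+x. indicator A x \<partial>distr (nu r) gam fst)"
    by (rule nn_integral_indicator[symmetric]) simp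
  also have "\<dots> = (\<integral>\<^sup>+p. indicator A (fst p) \<partial>nu r)"
    by (rule nn_integral_distr) measurable
  also have "\<dots> = (\<integral>\<^sup>+x. \<integral>\<^sup>+y. ennreal (kernel r x y) * indicator A x \<partial>gam \<partial>gam)"
    by (subst nn_integral_nu) auto
  also have "\<dots> = emeasure gam A"
    by (subst nn_integral_multc) (auto simp: nn_integral_kernel_1)
  finally show "emeasure (distr (nu r) gam fst) A = emeasure gam A" .
qed simp

text \<open>Invariance of the Gaussian measure under P_r: after exchanging the integrals, symmetry
  of the kernel reduces the claim to its normalisation in the other variable.\<close>

lemma distr_nu_snd: "distr (nu r) gam snd = (gam :: (real ^ 'd) measure)"
proof (rule measure_eqI)
  interpret P: pair_sigma_finite "gam :: (real ^ 'd) measure" "gam :: (real ^ 'd) measure"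
    by (simp add: pair_sigma_finite_def sigma_finite_gam)
  fix A :: "(real ^ 'd) set" assume "A \<in> sets (distr (nu r) gam snd)"
  then have [measurable]: "A \<in> sets borel" by simp
  have "emeasure (distr (nu r) gam snd) A = (\<integral>\<^sup>+x. indicator A x \<partial>distr (nu r) gam snd)"
    by (rule nn_integral_indicator[symmetric]) simp
  also have "\<dots> = (\<integral>\<^sup>+p. indicator A (snd p) \<partial>nu r)"
    by (rule nn_integral_distr) measurable
  also have "\<dots> = (\<integral>\<^sup>+x. \<integral>\<^sup>+y. ennreal (kernel r x y) * indicator A y \<partial>gam \<partial>gam)"
    by (subst nn_integral_nu) auto
  also have "\<dots> = (\<integral>\<^sup>+y. \<integral>\<^sup>+x. ennreal (kernel r x y) * indicator A y \<partial>gam \<partial>gam)"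
    by (rule P.Fubini'[symmetric]) measurable
  also have "\<dots> = emeasure gam A"
    by (subst nn_integral_multc) (auto simp: nn_integral_kernel_1 kernel_sym[OF r])
  finally show "emeasure (distr (nu r) gam snd) A = emeasure gam A" .
qed simp

end

lemma abs_square_le: "\<bar>a\<bar> \<le> c \<Longrightarrow> \<bar>a\<^sup>2\<bar> \<le> (c::real)\<^sup>2"
  by (simp add: abs_le_square_iff[symmetric])

lemma
  fixes u :: "real ^ 'd \<Rightarrow> real"
  assumes r: "0 \<le> r" "r < 1" and u[measurable]: "u \<in> borel_measurable borel"
  shows nu_integral_fst: "(\<integral>p. u (fst p) \<partial>nu r) = (\<integral>x. u x \<partial>gam)"
    and nu_integral_snd: "(\<integral>p. u (snd p) \<partial>nu r) = (\<integral>x. u x \<partial>gam)"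
  using integral_distr[of fst "nu r" gam u] integral_distr[of snd "nu r" gam u]
  by (simp_all add: distr_nu_fst[OF r] distr_nu_snd[OF r])

lemma bounded_integrable_nu:
  fixes F :: "(real ^ 'd) \<times> (real ^ 'd) \<Rightarrow> real"
  assumes r: "0 \<le> r" "r < 1" and [measurable]: "F \<in> borel_measurable gam2" and "\<And>p. \<bar>F p\<bar> \<le> B"
  shows "integrable (nu r) F"
proof -
  interpret prob_space "nu r :: ((real ^ 'd) \<times> (real ^ 'd)) measure" by (rule prob_space_nu[OF r])
  show ?thesis by (rule integrable_const_bound[where B=B]) (use assms in auto)
qed

lemma mehler_form_nu:
  fixes f :: "real ^ 'd \<Rightarrow> real"
  assumes r: "0 \<le> r" "r < 1" and [measurable]: "f \<in> borel_measurable borel"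
  shows "mehler_form r f = (\<integral>p. f (fst p) * f (snd p) \<partial>nu r)"
  unfolding mehler_form_def nu_def
  by (subst integral_density) (auto simp: kernel_nonneg r mult_ac)

text \<open>Expand the square: both marginals of \<open>nu\<close> are Gaussian, so the two diagonal
  terms agree, and the cross term is the Mehler form. The deficit <f, (1 - P_r) f> is thus half a
  mean squared increment, hence nonnegative and open to pointwise comparison.\<close>

lemma mehler_form_dirichlet:
  fixes f :: "real ^ 'd \<Rightarrow> real"
  assumes r: "0 \<le> r" "r < 1" and f[measurable]: "f \<in> borel_measurable borel" and B: "\<And>x. \<bar>f x\<bar> \<le> B"
  shows "(\<integral>p. (f (fst p) - f (snd p))\<^sup>2 \<partial>nu r) = 2 * ((\<integral>x. (f x)\<^sup>2 \<partial>gam) - mehler_form r f)"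
proof -
  have B0: "0 \<le> B" using B[of 0] by linarith
  have b2: "\<bar>(f x)\<^sup>2\<bar> \<le> B\<^sup>2" for x using abs_square_le[OF B] .
  have bm: "\<bar>f x * f y\<bar> \<le> B * B" for x y unfolding abs_mult by (intro mult_mono B B0) auto
  have I: "integrable (nu r) (\<lambda>p. (f (fst p))\<^sup>2)" "integrable (nu r) (\<lambda>p. (f (snd p))\<^sup>2)"
      "integrable (nu r) (\<lambda>p. f (fst p) * f (snd p))"
    by (rule bounded_integrable_nu[OF r _ b2] bounded_integrable_nu[OF r _ bm]; measurable)+
  have "(\<integral>p. (f (fst p) - f (snd p))\<^sup>2 \<partial>nu r) = (\<integral>p. (f (fst p))\<^sup>2 + (f (snd p))\<^sup>2 - 2 * (f (fst p) * f (snd p)) \<partial>nu r)"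
    by (simp add: power2_diff mult.assoc)
  also have "\<dots> = (\<integral>p. (f (fst p))\<^sup>2 \<partial>nu r) + (\<integral>p. (f (snd p))\<^sup>2 \<partial>nu r) - 2 * (\<integral>p. f (fst p) * f (snd p) \<partial>nu r)"
    using I by (simp add: Bochner_Integration.integral_diff Bochner_Integration.integral_add)
  also have "\<dots> = 2 * ((\<integral>x. (f x)\<^sup>2 \<partial>gam) - mehler_form r f)"
    by (simp add: mehler_form_nu[OF r] nu_integral_fst[OF r, of "\<lambda>x. (f x)\<^sup>2"] nu_integral_snd[OF r, of "\<lambda>x. (f x)\<^sup>2"])
  finally show ?thesis .
qed

section \<open>Continuity of the semigroup at r = 1\<close>

lemma nu_continuous_tendsto:
  fixes g :: "real ^ 'd \<Rightarrow> real"
  assumes r: "\<And>n. 0 \<le> r n \<and> r n < 1" "r \<longlonglongrightarrow> 1" and g: "continuous_on UNIV g" and B: "\<And>x. \<bar>g x\<bar> \<le> B"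
  shows "(\<lambda>n. \<integral>p. (g (fst p) - g (snd p))\<^sup>2 \<partial>nu (r n)) \<longlonglongrightarrow> 0"
proof -
  have [measurable]: "g \<in> borel_measurable borel" by (rule borel_measurable_continuous_onI[OF g])
  interpret prob_space "gam2 :: ((real ^ 'd) \<times> (real ^ 'd)) measure" by (rule prob_space_gam2)
  \<comment> \<open>The push-forward form places all correlations \<open>r n\<close> on one
    probability space, where r X + sqrt(1 - r^2) Z tends to X pointwise.\<close>
  let ?G = "\<lambda>n p. (g (fst p) - g (r n *\<^sub>R fst p + sqrt (1 - (r n)\<^sup>2) *\<^sub>R snd p))\<^sup>2"
  have "(\<integral>p. (g (fst p) - g (snd p))\<^sup>2 \<partial>nu (r n)) = (\<integral>p. ?G n p \<partial>gam2)" for n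
    using r(1)[of n] by (subst nu_eq_distr) (auto simp: integral_distr)
  moreover have "(\<lambda>n. \<integral>p. ?G n p \<partial>gam2) \<longlonglongrightarrow> (\<integral>p. 0 \<partial>(gam2 :: ((real ^ 'd) \<times> (real ^ 'd)) measure))"
  proof (rule integral_dominated_convergence[where w="\<lambda>_. (2 * B)\<^sup>2"])
    show "AE p in gam2. (\<lambda>n. ?G n p) \<longlonglongrightarrow> 0"
    proof (rule AE_I2)
      fix p :: "(real ^ 'd) \<times> (real ^ 'd)"
      have "(\<lambda>n. r n *\<^sub>R fst p + sqrt (1 - (r n)\<^sup>2) *\<^sub>R snd p) \<longlonglongrightarrow> 1 *\<^sub>R fst p + sqrt (1 - 1\<^sup>2) *\<^sub>R snd p"
        by (intro tendsto_intros r)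
      then have "(\<lambda>n. g (r n *\<^sub>R fst p + sqrt (1 - (r n)\<^sup>2) *\<^sub>R snd p)) \<longlonglongrightarrow> g (fst p)"
        using g by (intro isCont_tendsto_compose[where g=g]) (auto simp: continuous_on_eq_continuous_at)
      then have "(\<lambda>n. ?G n p) \<longlonglongrightarrow> (g (fst p) - g (fst p))\<^sup>2" by (intro tendsto_intros)
      then show "(\<lambda>n. ?G n p) \<longlonglongrightarrow> 0" by simp
    qed
    show "AE p in gam2. norm (?G n p) \<le> (2 * B)\<^sup>2" for n
    proof (rule AE_I2)
      fix p :: "(real ^ 'd) \<times> (real ^ 'd)"
      have "\<bar>g x - g y\<bar> \<le> 2 * B" for x y using B[of x] B[of y] by linarith
      from abs_square_le[OF this] show "norm (?G n p) \<le> (2 * B)\<^sup>2" by (simp only: real_norm_def)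
    qed
  qed (auto intro: integrable_const)
  ultimately show ?thesis by simp
qed

text \<open>A measurable function is an almost everywhere limit of continuous ones. Clipping these
  to [-B, B] leaves the limit unchanged and supplies the constant majorant for L^2
  convergence.\<close>

lemma gam_continuous_approx:
  fixes u :: "real ^ 'd \<Rightarrow> real"
  assumes u[measurable]: "u \<in> borel_measurable borel" and B: "\<And>x. \<bar>u x\<bar> \<le> B" and e: "0 < e"
  obtains g where "continuous_on UNIV g" "\<And>x. \<bar>g x\<bar> \<le> B" "(\<integral>x. (u x - g x)\<^sup>2 \<partial>gam) < e"
proof -
  have "u measurable_on UNIV"
    by (rule lebesgue_measurable_imp_measurable_on_real) (simp_all add: measurable_completion)
  then obtain N h where N: "negligible N" and h: "\<And>n. continuous_on UNIV (h n)"
    and lim: "\<And>x. x \<notin> N \<Longrightarrow> (\<lambda>n. h n x) \<longlonglongrightarrow> u x"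
    unfolding measurable_on_def by auto
  define g where "g n x = max (- B) (min B (h n x))" for n x
  have B0: "0 \<le> B" using B[of 0] by linarith
  have gc: "continuous_on UNIV (g n)" for n unfolding g_def[abs_def] by (intro continuous_intros h)
  have gB: "\<bar>g n x\<bar> \<le> B" for n x using B0 by (auto simp: g_def)
  have [measurable]: "g n \<in> borel_measurable borel" for n by (rule borel_measurable_continuous_onI[OF gc])
  have "(\<lambda>n. \<integral>x. (u x - g n x)\<^sup>2 \<partial>gam) \<longlonglongrightarrow> (\<integral>x. 0 \<partial>(gam :: (real ^ 'd) measure))"
  proof (rule integral_dominated_convergence[where w="\<lambda>_. (2 * B)\<^sup>2"])
    have "AE x in lebesgue. x \<notin> N" using N by (simp add: negligible_iff_null_sets AE_not_in)
    then have "AE x in lborel. x \<notin> N" by (simp add: AE_completion_iff)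
    then have "AE x in gam. x \<notin> N" unfolding gam_def by (subst AE_density) auto
    then show "AE x in gam. (\<lambda>n. (u x - g n x)\<^sup>2) \<longlonglongrightarrow> 0"
    proof eventually_elim
      case (elim x)
      have "(\<lambda>n. (u x - g n x)\<^sup>2) \<longlonglongrightarrow> (u x - max (- B) (min B (u x)))\<^sup>2"
        unfolding g_def by (intro tendsto_intros lim elim)
      also have "max (- B) (min B (u x)) = u x" using B[of x] by auto
      finally show ?case by simp
    qed
    show "AE x in gam. norm ((u x - g n x)\<^sup>2) \<le> (2 * B)\<^sup>2" for n
    proof (rule AE_I2)
      fix x
      have "\<bar>u x - g n x\<bar> \<le> \<bar>2 * B\<bar>" using B[of x] gB[of n x] by linarith
      then show "norm ((u x - g n x)\<^sup>2) \<le> (2 * B)\<^sup>2" by (simp add: abs_le_square_iff)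
    qed
  qed auto
  then have "\<forall>\<^sub>F n in sequentially. (\<integral>x. (u x - g n x)\<^sup>2 \<partial>gam) < e"
    using e by (intro order_tendstoD) auto
  then obtain n where "(\<integral>x. (u x - g n x)\<^sup>2 \<partial>gam) < e" by (auto simp: eventually_sequentially)
  with gc gB show ?thesis by (intro that)
qed

text \<open>Approximation by a continuous g. Since both marginals of \<open>nu (r n)\<close> are
  Gaussian, the errors u - g in the two variables have a size independent of n, which makes the
  approximation uniform along the sequence.\<close>

lemma mehler_form_tendsto:
  fixes u :: "real ^ 'd \<Rightarrow> real"
  assumes r: "\<And>n. 0 \<le> r n \<and> r n < 1" "r \<longlonglongrightarrow> 1" and u[measurable]: "u \<in> borel_measurable borel" and B: "\<And>x. \<bar>u x\<bar> \<le> B"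
  shows "(\<lambda>n. mehler_form (r n) u) \<longlonglongrightarrow> (\<integral>x. (u x)\<^sup>2 \<partial>gam)"
proof -
  have D: "mehler_form (r n) u = (\<integral>x. (u x)\<^sup>2 \<partial>gam) - (\<integral>p. (u (fst p) - u (snd p))\<^sup>2 \<partial>nu (r n)) / 2" for n
    using mehler_form_dirichlet[OF _ _ u B, of "r n"] r(1)[of n] by (simp add: field_simps)
  have "(\<lambda>n. \<integral>p. (u (fst p) - u (snd p))\<^sup>2 \<partial>nu (r n)) \<longlonglongrightarrow> 0"
  proof (rule LIMSEQ_I)
    fix e :: real assume e: "0 < e"
    \<comment> \<open>The fractions are chosen so that 3 (e/12 + e/6 + e/12) = e, where 3 is the
      Cauchy-Schwarz factor for three increments.\<close>
    obtain g where g: "continuous_on UNIV g" "\<And>x. \<bar>g x\<bar> \<le> B" "(\<integral>x. (u x - g x)\<^sup>2 \<partial>gam) < e / 12"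
      using gam_continuous_approx[OF u B, of "e / 12"] e by auto
    have [measurable]: "g \<in> borel_measurable borel" by (rule borel_measurable_continuous_onI[OF g(1)])
    have "\<forall>\<^sub>F n in sequentially. (\<integral>p. (g (fst p) - g (snd p))\<^sup>2 \<partial>nu (r n)) < e / 6"
      using nu_continuous_tendsto[OF r g(1,2)] e by (intro order_tendstoD) auto
    then obtain M where M: "\<And>n. n \<ge> M \<Longrightarrow> (\<integral>p. (g (fst p) - g (snd p))\<^sup>2 \<partial>nu (r n)) < e / 6"
      by (auto simp: eventually_sequentially)
    have "norm ((\<integral>p. (u (fst p) - u (snd p))\<^sup>2 \<partial>nu (r n)) - 0) < e" if n: "n \<ge> M" for n
    proof -
      have rn: "0 \<le> r n" "r n < 1" using r by auto
      have b: "\<bar>(u x - g y)\<^sup>2\<bar> \<le> (2 * B)\<^sup>2" "\<bar>(g x - g y)\<^sup>2\<bar> \<le> (2 * B)\<^sup>2" "\<bar>(u x - u y)\<^sup>2\<bar> \<le> (2 * B)\<^sup>2" for x y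
      proof -
        have "\<bar>u x - g y\<bar> \<le> \<bar>2 * B\<bar>" "\<bar>g x - g y\<bar> \<le> \<bar>2 * B\<bar>" "\<bar>u x - u y\<bar> \<le> \<bar>2 * B\<bar>"
          using B[of x] B[of y] g(2)[of x] g(2)[of y] by linarith+
        then show "\<bar>(u x - g y)\<^sup>2\<bar> \<le> (2 * B)\<^sup>2" "\<bar>(g x - g y)\<^sup>2\<bar> \<le> (2 * B)\<^sup>2" "\<bar>(u x - u y)\<^sup>2\<bar> \<le> (2 * B)\<^sup>2"
          by (simp_all add: abs_le_square_iff)
      qed
      let ?a = "\<lambda>p. (u (fst p) - g (fst p))\<^sup>2" and ?b = "\<lambda>p. (g (fst p) - g (snd p))\<^sup>2" and ?c = "\<lambda>p. (u (snd p) - g (snd p))\<^sup>2"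
      have I: "integrable (nu (r n)) ?a" "integrable (nu (r n)) ?b" "integrable (nu (r n)) ?c"
        by (rule bounded_integrable_nu[OF rn _ b(1)] bounded_integrable_nu[OF rn _ b(2)]; measurable)+
      have "(\<integral>p. (u (fst p) - u (snd p))\<^sup>2 \<partial>nu (r n)) \<le> (\<integral>p. 3 * (?a p + ?b p + ?c p) \<partial>nu (r n))"
      proof (rule integral_mono)
        show "integrable (nu (r n)) (\<lambda>p. (u (fst p) - u (snd p))\<^sup>2)"
          by (rule bounded_integrable_nu[OF rn _ b(3)]) measurable
        have "(x - y)\<^sup>2 \<le> 3 * ((x - a)\<^sup>2 + (a - b)\<^sup>2 + (y - b)\<^sup>2)" for x y a b :: real
        proof -
          \<comment> \<open>The Cauchy-Schwarz deficit as the sum of the squared pairwise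
            differences of the increments x - a, a - b, b - y.\<close>
          have "3 * ((x - a)\<^sup>2 + (a - b)\<^sup>2 + (y - b)\<^sup>2) - (x - y)\<^sup>2
            = ((x - a) - (a - b))\<^sup>2 + ((x - a) - (b - y))\<^sup>2 + ((a - b) - (b - y))\<^sup>2"
            by (simp add: power2_eq_square algebra_simps)
          then show ?thesis by (smt (verit) zero_le_power2)
        qed
        then show "(u (fst p) - u (snd p))\<^sup>2 \<le> 3 * (?a p + ?b p + ?c p)" for p .
      qed (use I in auto)
      also have "\<dots> = 3 * ((\<integral>p. ?a p \<partial>nu (r n)) + (\<integral>p. ?b p \<partial>nu (r n)) + (\<integral>p. ?c p \<partial>nu (r n)))"
        using I by (simp add: Bochner_Integration.integral_add)
      also have "\<dots> < 3 * (e / 12 + e / 6 + e / 12)"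
        using M[OF n] g(3) nu_integral_fst[OF rn, of "\<lambda>x. (u x - g x)\<^sup>2"] nu_integral_snd[OF rn, of "\<lambda>x. (u x - g x)\<^sup>2"]
        by simp
      finally have "(\<integral>p. (u (fst p) - u (snd p))\<^sup>2 \<partial>nu (r n)) < e" by simp
      moreover have "0 \<le> (\<integral>p. (u (fst p) - u (snd p))\<^sup>2 \<partial>nu (r n))" by (rule integral_nonneg_AE) simp
      ultimately show ?thesis by simp
    qed
    then show "\<exists>M. \<forall>n\<ge>M. norm ((\<integral>p. (u (fst p) - u (snd p))\<^sup>2 \<partial>nu (r n)) - 0) < e" by blast
  qed
  then have "(\<lambda>n. (\<integral>x. (u x)\<^sup>2 \<partial>gam) - (\<integral>p. (u (fst p) - u (snd p))\<^sup>2 \<partial>nu (r n)) / 2) \<longlonglongrightarrow> (\<integral>x. (u x)\<^sup>2 \<partial>gam) - 0 / 2"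
    by (intro tendsto_intros) auto
  then show ?thesis by (simp add: D)
qed

section \<open>Test functions and integration by parts\<close>

text \<open>exp(-1/t) times powers of 1/t, extended by zero. The powers are included because
  differentiation then stays inside the linear span of the family.\<close>

definition flat :: "nat \<Rightarrow> real \<Rightarrow> real" where
  "flat j t = (if t > 0 then exp (- inverse t) * inverse t ^ j else 0)"

lemma flat_tendsto_0: "((\<lambda>t. exp (- inverse t) * inverse t ^ j) \<longlongrightarrow> (0::real)) (at_right 0)"
proof -
  have "((\<lambda>x. x ^ j / exp x) \<longlongrightarrow> (0::real)) at_top" by (rule tendsto_power_div_exp_0)
  from filterlim_compose[OF this filterlim_inverse_at_top_right]
  show ?thesis by (simp add: exp_minus divide_inverse mult.commute)
qed

lemma flat_deriv: "(flat j has_real_derivative flat (j + 2) t - real j * flat (j + 1) t) (at t)"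
proof (cases t "0 :: real" rule: linorder_cases)
  case less
  have "((\<lambda>_. 0) has_real_derivative 0) (at t)" by simp
  then have "(flat j has_real_derivative 0) (at t)"
    by (rule has_field_derivative_transform_within_open[of _ _ _ "{..<0}"]) (use less in \<open>auto simp: flat_def\<close>)
  then show ?thesis using less by (simp add: flat_def)
next
  case greater
  have "((\<lambda>t. exp (- inverse t) * inverse t ^ j) has_real_derivative
      exp (- inverse t) * inverse t ^ (j + 2) - real j * (exp (- inverse t) * inverse t ^ (j + 1))) (at t)"
  proof -
    have P: "((\<lambda>v. exp (- v) * v ^ j) has_real_derivative exp (- v) * (real j * v ^ (j - 1)) - exp (- v) * v ^ j) (at v)" for v
      by (auto intro!: derivative_eq_intros)
    have I: "(inverse has_real_derivative - (inverse t * inverse t)) (at t)"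
      using DERIV_inverse[of t UNIV] greater by (simp add: power2_eq_square)
    have "exp (- v) * v ^ (j + 2) - real j * (exp (- v) * v ^ (j + 1)) = (exp (- v) * (real j * v ^ (j - 1)) - exp (- v) * v ^ j) * (- (v * v))" for v :: real
      by (cases j) (simp_all add: algebra_simps)
    then show ?thesis using DERIV_chain2[OF P I] by (simp only:)
  qed
  then have "(flat j has_real_derivative exp (- inverse t) * inverse t ^ (j + 2) - real j * (exp (- inverse t) * inverse t ^ (j + 1))) (at t)"
    by (rule has_field_derivative_transform_within_open[of _ _ _ "{0<..}"]) (use greater in \<open>auto simp: flat_def\<close>)
  then show ?thesis using greater by (simp add: flat_def)
next
  case equal
  \<comment> \<open>To the right of 0 the difference quotient is again a member of the family, with
    exponent j + 1.\<close>
  have "((\<lambda>h. flat j h / h) \<longlongrightarrow> 0) (at_right 0)"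
    using flat_tendsto_0[of "j + 1"]
    by (rule Lim_transform_eventually) (auto simp: flat_def eventually_at_right_less divide_inverse eventually_at_filter)
  moreover have "((\<lambda>h. flat j h / h) \<longlongrightarrow> 0) (at_left 0)"
    by (rule tendsto_eventually) (auto simp: flat_def eventually_at_filter)
  ultimately have "((\<lambda>h. flat j h / h) \<longlongrightarrow> 0) (at 0)" by (simp add: filterlim_at_split)
  then have "(flat j has_real_derivative 0) (at 0)" by (simp add: DERIV_def flat_def)
  then show ?thesis using equal by (simp add: flat_def)
qed

text \<open>A class of functions closed under partial derivatives and containing Gaussians and bumps, which
  makes \<^const>\<open>Ck\<close> for all orders trivial.\<close>

inductive_set smooth_fns :: "(real ^ 'd \<Rightarrow> real) set" where
  const: "(\<lambda>_. c) \<in> smooth_fns"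
| coord: "(\<lambda>x. x $ i) \<in> smooth_fns"
| add: "f \<in> smooth_fns \<Longrightarrow> g \<in> smooth_fns \<Longrightarrow> (\<lambda>x. f x + g x) \<in> smooth_fns"
| mult: "f \<in> smooth_fns \<Longrightarrow> g \<in> smooth_fns \<Longrightarrow> (\<lambda>x. f x * g x) \<in> smooth_fns"
| exp: "f \<in> smooth_fns \<Longrightarrow> (\<lambda>x. exp (f x)) \<in> smooth_fns"
| flat: "f \<in> smooth_fns \<Longrightarrow> (\<lambda>x. flat j (f x)) \<in> smooth_fns"

lemma partial_eq:
  "(f has_derivative f') (at x) \<Longrightarrow> partial i f x = f' (axis i 1)"
  unfolding partial_def by (drule frechet_derivative_at) simp

lemma smooth_fns_partial:
  fixes f :: "real ^ 'd \<Rightarrow> real"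
  assumes "f \<in> smooth_fns"
  shows "(\<forall>x. f differentiable (at x)) \<and> (\<forall>i. partial i f \<in> smooth_fns)"
  using assms
proof induction
  case (const c)
  have "((\<lambda>_::real ^ 'd. c) has_derivative (\<lambda>_. 0)) (at x)" for x by simp
  from partial_eq[OF this] have "partial i (\<lambda>_::real ^ 'd. c) = (\<lambda>_. 0)" for i by (simp add: fun_eq_iff)
  then show ?case by (auto intro: smooth_fns.const)
next
  case (coord j)
  have d: "((\<lambda>x::real ^ 'd. x $ j) has_derivative (\<lambda>h. h $ j)) (at x)" for x
    by (rule bounded_linear_imp_has_derivative) (rule bounded_linear_vec_nth)
  from partial_eq[OF this] have "partial i (\<lambda>x::real ^ 'd. x $ j) = (\<lambda>_. axis i 1 $ j)" for i by (simp add: fun_eq_iff)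
  with d show ?case by (auto intro: smooth_fns.const simp: differentiable_def)
next
  case (add f g)
  from add.IH obtain f' g' where d: "\<And>x. (f has_derivative f' x) (at x)" "\<And>x. (g has_derivative g' x) (at x)"
    unfolding differentiable_def by metis
  have D: "((\<lambda>x. f x + g x) has_derivative (\<lambda>h. f' x h + g' x h)) (at x)" for x
    by (intro derivative_intros d)
  have "partial i (\<lambda>x. f x + g x) = (\<lambda>x. partial i f x + partial i g x)" for i
    using partial_eq[OF D] partial_eq[OF d(1)] partial_eq[OF d(2)] by auto
  with D add.IH show ?case by (auto simp: differentiable_def intro: smooth_fns.add)
next
  case (mult f g)
  from mult.IH obtain f' g' where d: "\<And>x. (f has_derivative f' x) (at x)" "\<And>x. (g has_derivative g' x) (at x)"
    unfolding differentiable_def by metis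
  have D: "((\<lambda>x. f x * g x) has_derivative (\<lambda>h. f x * g' x h + f' x h * g x)) (at x)" for x
    by (intro derivative_intros d)
  have "partial i (\<lambda>x. f x * g x) = (\<lambda>x. f x * partial i g x + partial i f x * g x)" for i
    using partial_eq[OF D] partial_eq[OF d(1)] partial_eq[OF d(2)] by auto
  moreover have "(\<lambda>x. f x * partial i g x + partial i f x * g x) \<in> smooth_fns" for i
    using mult by (intro smooth_fns.add smooth_fns.mult) auto
  ultimately show ?case using D by (auto simp: differentiable_def)
next
  case (exp f)
  from exp.IH obtain f' where d: "\<And>x. (f has_derivative f' x) (at x)"
    unfolding differentiable_def by metis
  have D: "((\<lambda>x. exp (f x)) has_derivative (\<lambda>h. exp (f x) * f' x h)) (at x)" for x
    by (auto intro!: derivative_eq_intros d)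
  have "partial i (\<lambda>x. exp (f x)) = (\<lambda>x. exp (f x) * partial i f x)" for i
    using partial_eq[OF D] partial_eq[OF d] by auto
  with D exp show ?case by (auto simp: differentiable_def intro: smooth_fns.exp smooth_fns.mult)
next
  case (flat f j)
  from flat.IH obtain f' where d: "\<And>x. (f has_derivative f' x) (at x)"
    unfolding differentiable_def by metis
  have D: "((\<lambda>x. flat j (f x)) has_derivative (\<lambda>h. (flat (j + 2) (f x) + (- real j) * flat (j + 1) (f x)) * f' x h)) (at x)" for x
    using has_derivative_compose[OF d has_derivative_at_withinI[OF flat_deriv[of j "f x", unfolded has_field_derivative_def]]] by simp
  have "partial i (\<lambda>x. flat j (f x)) = (\<lambda>x. (flat (j + 2) (f x) + (- real j) * flat (j + 1) (f x)) * partial i f x)" for i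
    using partial_eq[OF D] partial_eq[OF d] by auto
  moreover have "(\<lambda>x. (flat (j + 2) (f x) + (- real j) * flat (j + 1) (f x)) * partial i f x) \<in> smooth_fns" for i
    using flat by (intro smooth_fns.intros) auto
  ultimately show ?case using D by (auto simp: differentiable_def)
qed

lemma smooth_fns_differentiable: "f \<in> smooth_fns \<Longrightarrow> f differentiable (at x)"
  and smooth_fns_partial_in: "f \<in> smooth_fns \<Longrightarrow> partial i f \<in> smooth_fns"
  using smooth_fns_partial by auto

lemma smooth_fns_continuous: "f \<in> smooth_fns \<Longrightarrow> continuous_on UNIV f"
  by (intro continuous_at_imp_continuous_on ballI differentiable_imp_continuous_within smooth_fns_differentiable)

lemma smooth_fns_Ck: "f \<in> smooth_fns \<Longrightarrow> Ck k f"
  by (induction k arbitrary: f) (auto simp: smooth_fns_continuous smooth_fns_differentiable smooth_fns_partial_in)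

lemma smooth_fns_test:
  assumes "f \<in> smooth_fns" "bounded {x. f x \<noteq> 0}"
  shows "f \<in> test_functions"
  using assms by (simp add: test_functions_def smooth_fns_Ck compact_closure)

lemma smooth_fns_sum: "finite A \<Longrightarrow> (\<And>a. a \<in> A \<Longrightarrow> f a \<in> smooth_fns) \<Longrightarrow> (\<lambda>x. \<Sum>a\<in>A. f a x) \<in> smooth_fns"
  by (induction A rule: finite_induct) (auto intro: smooth_fns.const smooth_fns.add)

lemma smooth_fns_prod: "finite A \<Longrightarrow> (\<And>a. a \<in> A \<Longrightarrow> f a \<in> smooth_fns) \<Longrightarrow> (\<lambda>x. \<Prod>a\<in>A. f a x) \<in> smooth_fns"
  by (induction A rule: finite_induct) (auto intro: smooth_fns.const smooth_fns.mult)

lemma smooth_fns_hpoly: "(\<lambda>x. hpoly m (x $ j)) \<in> smooth_fns"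
proof (induction m rule: less_induct)
  case (less m)
  consider "m = 0" | "m = 1" | k where "m = Suc (Suc k)"
    by (metis One_nat_def not0_implies_Suc)
  then show ?case
  proof cases
    case 3
    have "(\<lambda>x. x $ j * hpoly (Suc k) (x $ j) + (- real (Suc k)) * hpoly k (x $ j)) \<in> smooth_fns"
      using 3 by (intro smooth_fns.intros less) auto
    then show ?thesis by (simp only: 3 hpoly.simps diff_conv_add_uminus minus_mult_left)
  qed (auto intro: smooth_fns.intros)
qed

lemma smooth_fns_He: "He w \<in> smooth_fns"
  unfolding He_def[abs_def] by (intro smooth_fns_prod smooth_fns_hpoly) auto

lemma smooth_fns_norm_sq: "(\<lambda>x. (norm x)\<^sup>2) \<in> smooth_fns"
  unfolding norm_sq_vec power2_eq_square[of "_ $ _"] by (intro smooth_fns_sum smooth_fns.intros) auto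

lemma smooth_fns_phi: "phi \<in> smooth_fns"
proof -
  have "(\<lambda>x. (2 * pi) powr (- (real CARD('a) / 2)) * exp ((- 1 / 2) * (norm x)\<^sup>2)) \<in> (smooth_fns :: (real ^ 'a \<Rightarrow> real) set)"
    by (intro smooth_fns.mult smooth_fns.const smooth_fns.exp smooth_fns_norm_sq)
  then show ?thesis by (simp add: phi_def[abs_def])
qed

section \<open>Differentiation along coordinate lines, Rodrigues' formula and cutoffs\<close>

lemma partial_has_real_derivative:
  fixes f :: "real ^ 'd \<Rightarrow> real"
  assumes "f differentiable (at x)"
  shows "((\<lambda>t. f (x + t *\<^sub>R axis i 1)) has_real_derivative partial i f x) (at 0)"
proof -
  obtain f' where f': "(f has_derivative f') (at x)" using assms by (auto simp: differentiable_def)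
  have "((\<lambda>t. x + t *\<^sub>R axis i 1) has_derivative (\<lambda>t. t *\<^sub>R axis i 1)) (at 0)"
    by (auto intro!: derivative_eq_intros)
  from has_derivative_compose[OF this, of f f'] f'
  have "((\<lambda>t. f (x + t *\<^sub>R axis i 1)) has_derivative (\<lambda>t. f' (t *\<^sub>R axis i 1))) (at 0)" by simp
  moreover have "f' (t *\<^sub>R axis i 1) = partial i f x * t" for t
    using partial_eq[OF f'] linear_scale[OF has_derivative_linear[OF f']] by (simp add: mult.commute)
  ultimately show ?thesis by (simp add: has_field_derivative_def)
qed

lemma partial_unique:
  fixes f :: "real ^ 'd \<Rightarrow> real"
  assumes "f differentiable (at x)" "((\<lambda>t. f (x + t *\<^sub>R axis i 1)) has_real_derivative D) (at 0)"
  shows "partial i f x = D"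
  using DERIV_unique[OF partial_has_real_derivative[OF assms(1)] assms(2)] .

lemma He_phi_prod: "He w x * phi x = (\<Prod>j\<in>UNIV. hpoly (count_list w j) (x $ j) * std_normal_density (x $ j))"
  by (simp add: He_def phi_prod prod.distrib)

lemma hpoly_std_deriv:
  "((\<lambda>t. hpoly m t * std_normal_density t) has_real_derivative - (hpoly (Suc m) t * std_normal_density t)) (at t)"
proof -
  have "(std_normal_density has_real_derivative - (t * std_normal_density t)) (at t)"
    unfolding normal_density_def by (auto intro!: derivative_eq_intros simp: field_simps)
  from DERIV_mult[OF hpoly_deriv this] show ?thesis
    by (rule DERIV_cong) (simp add: hpoly_Suc algebra_simps)
qed

text \<open>Rodrigues' formula in word form: by \<open>hpoly_std_deriv\<close> only the factor of
  coordinate i changes, and its degree rises by one. A derivative thus prepends a letter, so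
  integration by parts becomes a shift of the index of a Hermite coefficient.\<close>

lemma partial_He_phi:
  fixes x :: "real ^ 'd"
  shows "partial i (\<lambda>x. He w x * phi x) x = - (He (i # w) x * phi x)"
proof (rule partial_unique)
  show "(\<lambda>x. He w x * phi x) differentiable (at x)"
    by (intro smooth_fns_differentiable smooth_fns.mult smooth_fns_He smooth_fns_phi)
  let ?h = "\<lambda>w j x. hpoly (count_list w j) (x $ j) * std_normal_density (x $ j)"
  have s: "He w x * phi x = ?h w i x * (\<Prod>j\<in>UNIV - {i}. ?h w j x)" for w and x :: "real ^ 'd"
    unfolding He_phi_prod by (rule prod.remove) auto
  have c: "He w (x + t *\<^sub>R axis i 1) * phi (x + t *\<^sub>R axis i 1) = (\<lambda>t. hpoly (count_list w i) t * std_normal_density t) (x $ i + t) * (\<Prod>j\<in>UNIV - {i}. ?h w j x)" for t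
    unfolding s by (auto simp: axis_def intro!: prod.cong)
  have d: "((\<lambda>t. hpoly (count_list w i) t * std_normal_density t) has_real_derivative - (hpoly (Suc (count_list w i)) (x $ i) * std_normal_density (x $ i))) (at (x $ i + 0))"
    using hpoly_std_deriv[of "count_list w i" "x $ i"] by simp
  have "((\<lambda>t. (\<lambda>t. hpoly (count_list w i) t * std_normal_density t) (x $ i + t) * (\<Prod>j\<in>UNIV - {i}. ?h w j x)) has_real_derivative
      - (hpoly (Suc (count_list w i)) (x $ i) * std_normal_density (x $ i)) * (\<Prod>j\<in>UNIV - {i}. ?h w j x)) (at 0)"
    using d by (intro DERIV_cmult_right) (simp add: DERIV_shift[of _ _ 0 "x $ i", simplified] add.commute)
  moreover have "- (hpoly (Suc (count_list w i)) (x $ i) * std_normal_density (x $ i)) * (\<Prod>j\<in>UNIV - {i}. ?h w j x) = - (He (i # w) x * phi x)"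
    unfolding s by (auto intro!: prod.cong)
  ultimately show "((\<lambda>t. He w (x + t *\<^sub>R axis i 1) * phi (x + t *\<^sub>R axis i 1)) has_real_derivative - (He (i # w) x * phi x)) (at 0)"
    unfolding c by simp
qed

text \<open>A smooth bump in the ball of radius R; the factor \<open>exp 1\<close> normalises its
  value at the origin, and its limit as R grows, to 1.\<close>

definition cutoff :: "real \<Rightarrow> real ^ 'd \<Rightarrow> real" where
  "cutoff R x = exp 1 * flat 0 (1 + (- 1 / R\<^sup>2) * (norm x)\<^sup>2)"

lemma smooth_fns_cutoff: "cutoff R \<in> smooth_fns"
  unfolding cutoff_def[abs_def] by (intro smooth_fns.intros smooth_fns_norm_sq)

lemma cutoff_nonzero: "0 < R \<Longrightarrow> cutoff R x \<noteq> 0 \<Longrightarrow> norm x < R"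
  by (auto simp: cutoff_def flat_def split: if_splits) (simp add: field_simps power_less_imp_less_base)

lemma cutoff_bounds: "0 < R \<Longrightarrow> \<bar>cutoff R x\<bar> \<le> 1"
proof -
  assume R: "0 < R"
  have "exp 1 * exp (- inverse t) \<le> 1" if "0 < t" "t \<le> 1" for t :: real
    using that by (simp add: exp_add[symmetric] one_le_inverse)
  then show ?thesis using R by (auto simp: cutoff_def flat_def)
qed

lemma cutoff_tendsto: "(\<lambda>n. cutoff (real (Suc n)) x) \<longlonglongrightarrow> 1"
proof -
  have l: "(\<lambda>n. 1 + (- 1 / (real (Suc n))\<^sup>2) * (norm x)\<^sup>2) \<longlonglongrightarrow> 1" by real_asymp
  have "isCont (flat 0) 1" by (rule DERIV_isCont[OF flat_deriv])
  from isCont_tendsto_compose[OF this l]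
  have "(\<lambda>n. exp 1 * flat 0 (1 + (- 1 / (real (Suc n))\<^sup>2) * (norm x)\<^sup>2)) \<longlonglongrightarrow> exp 1 * flat 0 1"
    by (intro tendsto_intros)
  then show ?thesis by (simp add: cutoff_def flat_def exp_add[symmetric])
qed

text \<open>The constant is the product of e, the bound 2 for \<open>flat 2\<close>, which follows
  from v^2/2! \<le> e^v, and the bound 2/R for the inner derivative inside the ball. Outside the
  ball \<open>flat 2\<close> vanishes.\<close>

lemma partial_cutoff:
  fixes x :: "real ^ 'd"
  assumes R: "0 < R"
  shows "\<bar>partial i (cutoff R) x\<bar> \<le> 4 * exp 1 / R"
proof -
  have "((\<lambda>t. (norm (x + t *\<^sub>R axis i 1))\<^sup>2) has_real_derivative 2 * x $ i) (at 0)"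
  proof -
    have "(norm (x + t *\<^sub>R axis i 1))\<^sup>2 = (norm x)\<^sup>2 + 2 * t * x $ i + t\<^sup>2" for t
      unfolding power2_norm_eq_inner
      by (simp add: inner_add_left inner_add_right inner_axis inner_commute[of "axis i 1"] inner_axis_axis power2_eq_square algebra_simps)
    then show ?thesis by (auto intro!: derivative_eq_intros)
  qed
  from DERIV_add[OF DERIV_const DERIV_cmult[OF this]]
  have d: "((\<lambda>t. 1 + (- 1 / R\<^sup>2) * (norm (x + t *\<^sub>R axis i 1))\<^sup>2) has_real_derivative - 2 * x $ i / R\<^sup>2) (at 0)"
    by (rule DERIV_cong) simp
  let ?T = "1 + (- 1 / R\<^sup>2) * (norm x)\<^sup>2"
  have "((\<lambda>t. flat 0 (1 + (- 1 / R\<^sup>2) * (norm (x + t *\<^sub>R axis i 1))\<^sup>2)) has_real_derivative flat 2 ?T * (- 2 * x $ i / R\<^sup>2)) (at 0)"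
    using DERIV_chain2[OF _ d, of "flat 0" "flat 2 ?T"] flat_deriv[of 0 ?T] by (simp add: numeral_2_eq_2)
  then have "((\<lambda>t. cutoff R (x + t *\<^sub>R axis i 1)) has_real_derivative exp 1 * (flat 2 ?T * (- 2 * x $ i / R\<^sup>2))) (at 0)"
    unfolding cutoff_def by (rule DERIV_cmult)
  from partial_unique[OF smooth_fns_differentiable[OF smooth_fns_cutoff] this]
  have p: "partial i (cutoff R) x = exp 1 * (flat 2 ?T * (- 2 * x $ i / R\<^sup>2))" .
  show ?thesis
  proof (cases "norm x < R")
    case False
    then have "R\<^sup>2 \<le> (norm x)\<^sup>2" using R by (simp add: power_mono)
    then have "?T \<le> 0" using R by (simp add: field_simps)
    then have "flat 2 ?T = 0" by (simp only: flat_def) auto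
    then show ?thesis using R unfolding p by simp
  next
    case True
    have "\<bar>flat 2 t\<bar> \<le> 2" for t
    proof (cases "0 < t")
      case True
      have "inverse t ^ 2 / fact 2 \<le> exp (inverse t)" by (rule power_le_exp) (use True in simp)
      then show ?thesis using True by (simp add: flat_def exp_minus field_simps abs_mult)
    qed (simp add: flat_def)
    moreover have "\<bar>- 2 * x $ i / R\<^sup>2\<bar> \<le> 2 / R"
      using True component_le_norm_cart[of x i] R by (simp add: abs_mult power2_eq_square field_simps)
    ultimately have "\<bar>flat 2 ?T * (- 2 * x $ i / R\<^sup>2)\<bar> \<le> 2 * (2 / R)"
      unfolding abs_mult by (intro mult_mono) auto
    from mult_left_mono[OF this, of "exp 1"] show ?thesis
      unfolding p abs_mult[of "exp 1"] by (simp only: abs_exp_cancel) (simp add: mult.commute)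
  qed
qed

lemma partial_mult:
  fixes f g :: "real ^ 'd \<Rightarrow> real"
  assumes "f differentiable (at x)" "g differentiable (at x)"
  shows "partial i (\<lambda>x. f x * g x) x = partial i f x * g x + f x * partial i g x"
proof -
  obtain f' g' where d: "(f has_derivative f') (at x)" "(g has_derivative g') (at x)"
    using assms by (auto simp: differentiable_def)
  show ?thesis using partial_eq[OF has_derivative_mult[OF d]] partial_eq[OF d(1)] partial_eq[OF d(2)] by simp
qed

text \<open>Test with F times a cutoff of radius n + 1: the term containing the derivative of the
  cutoff is O(1/n). This admits F = \<open>He w * phi\<close>, which is not compactly
  supported.\<close>

lemma weak_gradient_smooth:
  fixes u :: "real ^ 'd \<Rightarrow> real" and g :: "real ^ 'd \<Rightarrow> real ^ 'd"
  assumes w: "has_weak_gradient u g" and F: "F \<in> smooth_fns"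
    and um: "u \<in> borel_measurable lebesgue" and gm: "g \<in> borel_measurable lebesgue"
    and I: "integrable lebesgue (\<lambda>x. u x * F x)" "integrable lebesgue (\<lambda>x. u x * partial i F x)"
      "integrable lebesgue (\<lambda>x. g x $ i * F x)"
  shows "(\<integral>x. u x * partial i F x \<partial>lebesgue) = - (\<integral>x. g x $ i * F x \<partial>lebesgue)"
proof -
  let ?c = "\<lambda>n. cutoff (real (Suc n))"
  have Fm: "f \<in> smooth_fns \<Longrightarrow> f \<in> borel_measurable lebesgue" for f :: "real ^ 'd \<Rightarrow> real"
    by (rule measurable_completion) (simp add: borel_measurable_continuous_onI smooth_fns_continuous)
  note [measurable] = um gm Fm[OF F] Fm[OF smooth_fns_cutoff] Fm[OF smooth_fns_partial_in[OF F]] Fm[OF smooth_fns_partial_in[OF smooth_fns_cutoff]]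
  have gim[measurable]: "(\<lambda>x. g x $ i) \<in> borel_measurable lebesgue" by measurable
  have t: "(\<lambda>x. F x * ?c n x) \<in> test_functions" for n
  proof (rule smooth_fns_test)
    show "(\<lambda>x. F x * ?c n x) \<in> smooth_fns" by (intro smooth_fns.mult F smooth_fns_cutoff)
    show "bounded {x. F x * ?c n x \<noteq> 0}"
      by (rule boundedI[of _ "real (Suc n)"]) (auto intro!: less_imp_le[OF cutoff_nonzero] simp del: of_nat_Suc)
  qed
  have eq: "(\<integral>x. u x * partial i F x * ?c n x + u x * F x * partial i (?c n) x \<partial>lebesgue) = - (\<integral>x. g x $ i * F x * ?c n x \<partial>lebesgue)" for n
    using w t[of n] unfolding has_weak_gradient_def
    by (auto simp: partial_mult[OF smooth_fns_differentiable[OF F] smooth_fns_differentiable[OF smooth_fns_cutoff]] algebra_simps)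
  have L1: "(\<lambda>n. \<integral>x. u x * partial i F x * ?c n x + u x * F x * partial i (?c n) x \<partial>lebesgue) \<longlonglongrightarrow> (\<integral>x. u x * partial i F x \<partial>lebesgue)"
  proof (rule integral_dominated_convergence[where w="\<lambda>x. norm (u x * partial i F x) + (4 * exp 1) * norm (u x * F x)"])
    show "AE x in lebesgue. (\<lambda>n. u x * partial i F x * ?c n x + u x * F x * partial i (?c n) x) \<longlonglongrightarrow> u x * partial i F x"
    proof (rule AE_I2)
      fix x :: "real ^ 'd"
      have "(\<lambda>n. partial i (?c n) x) \<longlonglongrightarrow> 0"
      proof (rule Lim_null_comparison)
        show "\<forall>\<^sub>F n in sequentially. norm (partial i (?c n) x) \<le> 4 * exp 1 / real (Suc n)"
          using partial_cutoff[of "real (Suc _)" i x] by (auto intro!: always_eventually)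
        show "(\<lambda>n. 4 * exp 1 / real (Suc n)) \<longlonglongrightarrow> 0" by real_asymp
      qed
      then have "(\<lambda>n. u x * partial i F x * ?c n x + u x * F x * partial i (?c n) x) \<longlonglongrightarrow> u x * partial i F x * 1 + u x * F x * 0"
        by (intro tendsto_intros cutoff_tendsto)
      then show "(\<lambda>n. u x * partial i F x * ?c n x + u x * F x * partial i (?c n) x) \<longlonglongrightarrow> u x * partial i F x" by simp
    qed
    show "AE x in lebesgue. norm (u x * partial i F x * ?c n x + u x * F x * partial i (?c n) x) \<le> norm (u x * partial i F x) + (4 * exp 1) * norm (u x * F x)" for n
    proof (rule AE_I2)
      fix x :: "real ^ 'd"
      have "\<bar>partial i (?c n) x\<bar> \<le> 4 * exp 1 / real (Suc n)" by (rule partial_cutoff) simp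
      also have "\<dots> \<le> 4 * exp 1 / 1" by (rule divide_left_mono) auto
      finally have 1: "\<bar>partial i (?c n) x\<bar> \<le> 4 * exp 1" by simp
      have "norm (u x * partial i F x * ?c n x + u x * F x * partial i (?c n) x)
        \<le> norm (u x * partial i F x) * \<bar>?c n x\<bar> + norm (u x * F x) * \<bar>partial i (?c n) x\<bar>"
        by (rule order_trans[OF norm_triangle_ineq]) (simp add: abs_mult)
      also have "\<dots> \<le> norm (u x * partial i F x) * 1 + norm (u x * F x) * (4 * exp 1)"
        by (intro add_mono mult_left_mono 1 cutoff_bounds) auto
      finally show "norm (u x * partial i F x * ?c n x + u x * F x * partial i (?c n) x) \<le> norm (u x * partial i F x) + (4 * exp 1) * norm (u x * F x)"
        by (simp add: mult.commute)
    qed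
  qed (use I in \<open>auto intro!: Bochner_Integration.integrable_add integrable_mult_right integrable_norm\<close>)
  have L2: "(\<lambda>n. \<integral>x. g x $ i * F x * ?c n x \<partial>lebesgue) \<longlonglongrightarrow> (\<integral>x. g x $ i * F x \<partial>lebesgue)"
  proof (rule integral_dominated_convergence[where w="\<lambda>x. norm (g x $ i * F x)"])
    show "AE x in lebesgue. (\<lambda>n. g x $ i * F x * ?c n x) \<longlonglongrightarrow> g x $ i * F x"
    proof (rule AE_I2)
      fix x :: "real ^ 'd"
      have "(\<lambda>n. g x $ i * F x * ?c n x) \<longlonglongrightarrow> g x $ i * F x * 1" by (intro tendsto_intros cutoff_tendsto)
      then show "(\<lambda>n. g x $ i * F x * ?c n x) \<longlonglongrightarrow> g x $ i * F x" by simp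
    qed
    show "AE x in lebesgue. norm (g x $ i * F x * ?c n x) \<le> norm (g x $ i * F x)" for n
      unfolding norm_mult[of "g _ $ i * F _"] by (intro AE_I2 mult_left_le) (simp_all add: cutoff_bounds)
  qed (use I in auto)
  show ?thesis
    using LIMSEQ_unique[OF L1 tendsto_minus[OF L2, folded eq]] .
qed

section \<open>The spectral gap\<close>

text \<open>Squaring \<open>He_abs_le\<close> would give \<open>gmajor 1\<close>, which is not
  integrable; instead, \<open>hpoly\<close> is a polynomial and Gaussian moments are finite.\<close>

lemma He_sq_integrable: "integrable gam (\<lambda>x :: real ^ 'd. (He w x)\<^sup>2)"
proof -
  have p: "\<exists>p. hpoly m = poly p" for m
  proof (induction m rule: less_induct)
    case (less m)
    consider "m = 0" | "m = 1" | k where "m = Suc (Suc k)"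
      by (metis One_nat_def not0_implies_Suc)
    then show ?case
    proof cases
      case 1
      then show ?thesis by (intro exI[of _ "[:1:]"]) auto
    next
      case 2
      then show ?thesis by (intro exI[of _ "[:0, 1:]"]) auto
    next
      case (3 k)
      obtain p p' where "hpoly (Suc k) = poly p" "hpoly k = poly p'" using less 3 by (meson less_Suc_eq)
      then show ?thesis using 3 by (intro exI[of _ "[:0, 1:] * p - smult (real (Suc k)) p'"]) auto
    qed
  qed
  have i: "integrable N01 (poly p)" for p :: "real poly"
    unfolding poly_altdef[abs_def] by (auto intro!: Bochner_Integration.integrable_sum integrable_mult_right integrable_std_normal_distribution_moment)
  have "integrable N01 (\<lambda>t. (hpoly m t)\<^sup>2)" for m
  proof -
    obtain p where "hpoly m = poly p" using p by blast
    then have "(\<lambda>t. (hpoly m t)\<^sup>2) = poly (p\<^sup>2)" by auto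
    then show ?thesis by (simp only: i)
  qed
  from gam_integrable_prod[of "\<lambda>j t. (hpoly (count_list w j) t)\<^sup>2", OF this]
  show ?thesis by (simp add: He_def prod_power_distrib)
qed

lemma integrable_mult_sq:
  fixes f g :: "'a \<Rightarrow> real"
  assumes [measurable]: "f \<in> borel_measurable M" "g \<in> borel_measurable M"
    and I: "integrable M (\<lambda>x. (f x)\<^sup>2)" "integrable M (\<lambda>x. (g x)\<^sup>2)"
  shows "integrable M (\<lambda>x. f x * g x)"
proof (rule Bochner_Integration.integrable_bound[OF Bochner_Integration.integrable_add[OF I]])
  have "\<bar>a * b\<bar> \<le> \<bar>a\<^sup>2 + b\<^sup>2\<bar>" for a b :: real
  proof -
    have "2 * (\<bar>a\<bar> * \<bar>b\<bar>) \<le> a\<^sup>2 + b\<^sup>2" using sum_squares_bound[of "\<bar>a\<bar>" "\<bar>b\<bar>"] by simp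
    moreover have "0 \<le> \<bar>a\<bar> * \<bar>b\<bar>" by simp
    ultimately show ?thesis unfolding abs_mult by linarith
  qed
  then show "AE x in M. norm (f x * g x) \<le> norm ((f x)\<^sup>2 + (g x)\<^sup>2)" by simp
qed measurable

lemma hlevel_nonneg: "0 \<le> hlevel f m"
  unfolding hlevel_def by (intro divide_nonneg_nonneg sum_nonneg) auto

lemma mehler_form_le:
  fixes f :: "real ^ 'd \<Rightarrow> real"
  assumes r: "0 \<le> r" "r < 1" and f: "f \<in> borel_measurable borel" "\<And>x. \<bar>f x\<bar> \<le> B"
  shows "mehler_form r f \<le> (\<integral>x. (f x)\<^sup>2 \<partial>gam)"
proof -
  have "0 \<le> (\<integral>p. (f (fst p) - f (snd p))\<^sup>2 \<partial>nu r)" by (rule integral_nonneg_AE) simp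
  then show ?thesis using mehler_form_dirichlet[OF r f] by simp
qed

definition to_one :: "nat \<Rightarrow> real" where "to_one n = 1 - 1 / real (Suc n)"

lemma to_one: "0 \<le> to_one n \<and> to_one n < 1" "to_one \<longlonglongrightarrow> 1"
proof -
  show "0 \<le> to_one n \<and> to_one n < 1" by (simp add: to_one_def)
  show "to_one \<longlonglongrightarrow> 1" unfolding to_one_def[abs_def] by real_asymp
qed

text \<open>Bessel's inequality without orthogonality: truncate \<open>g\<close>, apply Mehler's formula and let
  \<open>r \<rightarrow> 1\<close>.\<close>

lemma hlevel_bessel:
  fixes g :: "real ^ 'd \<Rightarrow> real"
  assumes g[measurable]: "g \<in> borel_measurable borel" and I: "integrable gam (\<lambda>x. (g x)\<^sup>2)"
  shows "(\<Sum>m<M. hlevel g m) \<le> (\<integral>x. (g x)\<^sup>2 \<partial>gam)"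
proof -
  \<comment> \<open>\<open>mehler_sums\<close> is stated for bounded functions. The truncation is
    removed while M and r < 1 are fixed, and only then r tends to 1.\<close>
  define tr where "tr k x = max (- real k) (min (real k) (g x))" for k x
  have trm[measurable]: "tr k \<in> borel_measurable borel" for k unfolding tr_def[abs_def] by measurable
  have trB: "\<bar>tr k x\<bar> \<le> real k" for k x by (auto simp: tr_def)
  have trg: "\<bar>tr k x\<bar> \<le> \<bar>g x\<bar>" for k x by (auto simp: tr_def)
  have trlim: "(\<lambda>k. tr k x) \<longlonglongrightarrow> g x" for x
  proof (rule tendsto_eventually)
    obtain K where K: "\<bar>g x\<bar> \<le> real K" using real_arch_simple by blast
    have "tr k x = g x" if "k \<ge> K" for k
    proof -
      have "\<bar>g x\<bar> \<le> real k" using K that by linarith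
      then show ?thesis by (auto simp: tr_def)
    qed
    then show "\<forall>\<^sub>F k in sequentially. tr k x = g x" by (auto simp: eventually_sequentially)
  qed
  have hl: "(\<lambda>k. hcoeff (tr k) w) \<longlonglongrightarrow> hcoeff g w" for w
    unfolding hcoeff_def
  proof (rule integral_dominated_convergence[where w="\<lambda>x. norm (g x * He w x)"])
    show "integrable gam (\<lambda>x. norm (g x * He w x))"
      by (intro integrable_norm integrable_mult_sq I He_sq_integrable) measurable
    show "AE x in gam. (\<lambda>k. tr k x * He w x) \<longlonglongrightarrow> g x * He w x"
      by (intro AE_I2 tendsto_intros trlim)
    show "AE x in gam. norm (tr k x * He w x) \<le> norm (g x * He w x)" for k
      by (simp add: abs_mult mult_right_mono trg)
  qed measurable
  have hll: "(\<lambda>k. hlevel (tr k) m) \<longlonglongrightarrow> hlevel g m" for m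
    unfolding hlevel_def by (intro tendsto_intros hl) simp
  have 1: "(\<Sum>m<M. r ^ m * hlevel g m) \<le> (\<integral>x. (g x)\<^sup>2 \<partial>gam)" if r: "0 \<le> r" "r < 1" for r
  proof (rule LIMSEQ_le_const2)
    show "(\<lambda>k. \<Sum>m<M. r ^ m * hlevel (tr k) m) \<longlonglongrightarrow> (\<Sum>m<M. r ^ m * hlevel g m)"
      by (intro tendsto_intros hll)
    have "(\<Sum>m<M. r ^ m * hlevel (tr k) m) \<le> (\<integral>x. (g x)\<^sup>2 \<partial>gam)" for k
    proof -
      note s = mehler_sums[OF r trm trB, of k]
      have "(\<Sum>m<M. r ^ m * hlevel (tr k) m) \<le> mehler_form r (tr k)"
        unfolding sums_unique[OF s] using r
        by (intro sum_le_suminf sums_summable[OF s]) (auto intro!: mult_nonneg_nonneg hlevel_nonneg)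
      also have "\<dots> \<le> (\<integral>x. (tr k x)\<^sup>2 \<partial>gam)" by (rule mehler_form_le[OF r trm trB])
      also have "\<dots> \<le> (\<integral>x. (g x)\<^sup>2 \<partial>gam)"
      proof (rule integral_mono)
        show "integrable gam (\<lambda>x. (tr k x)\<^sup>2)"
          by (rule gam.integrable_const_bound[where B="(real k)\<^sup>2"]) (use abs_square_le[OF trB] in auto)
        show "(tr k x)\<^sup>2 \<le> (g x)\<^sup>2" for x using trg[of k x] by (simp add: abs_le_square_iff)
      qed (rule I)
      finally show ?thesis .
    qed
    then show "\<exists>N. \<forall>k\<ge>N. (\<Sum>m<M. r ^ m * hlevel (tr k) m) \<le> (\<integral>x. (g x)\<^sup>2 \<partial>gam)" by blast
  qed
  show ?thesis
  proof (rule LIMSEQ_le_const2)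
    have "(\<lambda>n. \<Sum>m<M. to_one n ^ m * hlevel g m) \<longlonglongrightarrow> (\<Sum>m<M. 1 ^ m * hlevel g m)"
      by (intro tendsto_intros to_one)
    then show "(\<lambda>n. \<Sum>m<M. to_one n ^ m * hlevel g m) \<longlonglongrightarrow> (\<Sum>m<M. hlevel g m)" by simp
    show "\<exists>N. \<forall>n\<ge>N. (\<Sum>m<M. to_one n ^ m * hlevel g m) \<le> (\<integral>x. (g x)\<^sup>2 \<partial>gam)"
      using 1 to_one by blast
  qed
qed

text \<open>A mean value bound for t^m on [0, 1]. The factor m is the eigenvalue of the
  Ornstein-Uhlenbeck generator on degree m, which \<open>hlevel_grad\<close> turns into gradient
  energy.\<close>

lemma power_diff_le:
  fixes r s :: real
  assumes "0 \<le> r" "r \<le> s" "s \<le> 1"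
  shows "s ^ m - r ^ m \<le> (s - r) * real m"
proof (induction m)
  case (Suc m)
  have "s ^ Suc m - r ^ Suc m = (s - r) * s ^ m + r * (s ^ m - r ^ m)" by (simp add: algebra_simps)
  also have "\<dots> \<le> (s - r) * 1 + 1 * ((s - r) * real m)"
    using assms by (intro add_mono mult_left_mono order_trans[OF mult_right_mono[of r 1] mult_left_mono[OF Suc]] power_le_one)
      (auto intro: power_mono)
  finally show ?case by (simp add: algebra_simps)
qed simp

text \<open>All that the spectral argument uses of \<open>g = \<nabla>u\<close>.\<close>

definition grad_coeffs :: "(real ^ 'd \<Rightarrow> real) \<Rightarrow> (real ^ 'd \<Rightarrow> real ^ 'd) \<Rightarrow> bool" where
  "grad_coeffs u g \<longleftrightarrow> (\<forall>i w. hcoeff u (i # w) = hcoeff (\<lambda>x. g x $ i) w)"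

text \<open>A word of length m + 1 is a letter followed by a word of length m; the letter selects
  the component of the gradient, and the quotient (m+1)!/m! supplies the eigenvalue.\<close>

lemma hlevel_grad:
  assumes "grad_coeffs u g"
  shows "real (Suc m) * hlevel u (Suc m) = (\<Sum>i\<in>UNIV. hlevel (\<lambda>x. g x $ i) m)"
  using assms unfolding grad_coeffs_def hlevel_def sum_lists_Suc
  by (simp add: sum_divide_distrib[symmetric] del: of_nat_Suc)

text \<open>Mehler's series is available only below 1, so r is compared with some s in [r, 1) term
  by term, and s -> 1 is taken by \<open>mehler_form_tendsto\<close>.\<close>

lemma mehler_form_deficit:
  fixes u :: "real ^ 'd \<Rightarrow> real"
  assumes u[measurable]: "u \<in> borel_measurable borel" and B: "\<And>x. \<bar>u x\<bar> \<le> B"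
    and g[measurable]: "g \<in> borel_measurable borel" and I: "integrable gam (\<lambda>x. (norm (g x))\<^sup>2)"
    and gc: "grad_coeffs u g" and r: "0 \<le> r" "r < 1"
  shows "(\<integral>x. (u x)\<^sup>2 \<partial>gam) - mehler_form r u \<le> (1 - r) * (\<integral>x. (norm (g x))\<^sup>2 \<partial>gam)"
proof -
  let ?E = "\<integral>x. (norm (g x))\<^sup>2 \<partial>gam"
  have Ii: "integrable gam (\<lambda>x. (g x $ i)\<^sup>2)" for i
    by (rule Bochner_Integration.integrable_bound[OF I])
      (auto simp: abs_le_square_iff[symmetric] component_le_norm_cart)
  \<comment> \<open>Bessel's inequality for each component of the gradient bounds the sum of m times
    the levels of u; the level m = 0 has weight zero, whence the index shift.\<close>
  have lev: "(\<Sum>m<M. real m * hlevel u m) \<le> ?E" for M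
  proof (cases M)
    case 0 then show ?thesis by simp
  next
    case (Suc M')
    have "(\<Sum>m<M. real m * hlevel u m) = (\<Sum>m<M'. real (Suc m) * hlevel u (Suc m))"
      unfolding Suc sum.lessThan_Suc_shift by simp
    also have "\<dots> = (\<Sum>i\<in>UNIV. \<Sum>m<M'. hlevel (\<lambda>x. g x $ i) m)"
      unfolding hlevel_grad[OF gc] by (rule sum.swap)
    also have "\<dots> \<le> (\<Sum>i\<in>UNIV. \<integral>x. (g x $ i)\<^sup>2 \<partial>gam)"
      by (intro sum_mono hlevel_bessel Ii) measurable
    also have "\<dots> = ?E" unfolding norm_sq_vec by (subst Bochner_Integration.integral_sum) (auto intro: Ii)
    finally show ?thesis .
  qed
  have E0: "0 \<le> ?E" by (rule integral_nonneg_AE) simp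
  have diff: "mehler_form s u - mehler_form r u \<le> (s - r) * ?E" if s: "r \<le> s" "s < 1" for s
  proof -
    have "(\<lambda>m. s ^ m * hlevel u m - r ^ m * hlevel u m) sums (mehler_form s u - mehler_form r u)"
      using r s by (intro sums_diff mehler_sums[OF _ _ u B]) auto
    then have "(\<lambda>M. \<Sum>m<M. s ^ m * hlevel u m - r ^ m * hlevel u m) \<longlonglongrightarrow> mehler_form s u - mehler_form r u"
      by (simp only: sums_def)
    moreover have "(\<Sum>m<M. s ^ m * hlevel u m - r ^ m * hlevel u m) \<le> (s - r) * ?E" for M
    proof -
      have "(\<Sum>m<M. s ^ m * hlevel u m - r ^ m * hlevel u m) \<le> (\<Sum>m<M. (s - r) * (real m * hlevel u m))"
      proof (rule sum_mono)
        fix m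
        show "s ^ m * hlevel u m - r ^ m * hlevel u m \<le> (s - r) * (real m * hlevel u m)"
          using mult_right_mono[OF power_diff_le[of r s m] hlevel_nonneg[of u m]] r s by (simp add: algebra_simps)
      qed
      also have "\<dots> \<le> (s - r) * ?E" unfolding sum_distrib_left[symmetric] using s by (intro mult_left_mono lev) auto
      finally show ?thesis .
    qed
    ultimately show ?thesis by (intro LIMSEQ_le_const2) auto
  qed
  show ?thesis
  proof (rule LIMSEQ_le)
    show "(\<lambda>n. mehler_form (to_one n) u - mehler_form r u) \<longlonglongrightarrow> (\<integral>x. (u x)\<^sup>2 \<partial>gam) - mehler_form r u"
      by (intro tendsto_intros mehler_form_tendsto[OF to_one u B])
    show "(\<lambda>n. (to_one n - r) * ?E) \<longlonglongrightarrow> (1 - r) * ?E" by (intro tendsto_intros to_one)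
    have "\<forall>\<^sub>F n in sequentially. r < to_one n" by (rule order_tendstoD(1)[OF to_one(2) r(2)])
    then obtain N where "\<forall>n\<ge>N. r < to_one n" by (auto simp: eventually_sequentially)
    then show "\<exists>N. \<forall>n\<ge>N. mehler_form (to_one n) u - mehler_form r u \<le> (to_one n - r) * ?E"
      using diff to_one by (meson less_imp_le)
  qed
qed

text \<open>Only degrees m \<ge> n contribute, and for r \<le> s they satisfy (r/s)^m \<le> (r/s)^n.
  The cross-multiplied form s^n r^m \<le> r^n s^m also covers r = 0; then s -> 1.\<close>

lemma mehler_form_gap:
  fixes f :: "real ^ 'd \<Rightarrow> real"
  assumes f[measurable]: "f \<in> borel_measurable borel" and B: "\<And>x. \<bar>f x\<bar> \<le> B"
    and z: "\<And>w. length w < n \<Longrightarrow> hcoeff f w = 0" and r: "0 \<le> r" "r < 1"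
  shows "mehler_form r f \<le> r ^ n * (\<integral>x. (f x)\<^sup>2 \<partial>gam)"
proof -
  let ?E = "\<integral>x. (f x)\<^sup>2 \<partial>gam"
  have z': "hlevel f m = 0" if "m < n" for m unfolding hlevel_def using z that by simp
  have step: "s ^ n * mehler_form r f \<le> r ^ n * mehler_form s f" if s: "r \<le> s" "s < 1" for s
  proof (rule sums_le)
    show "(\<lambda>m. s ^ n * (r ^ m * hlevel f m)) sums (s ^ n * mehler_form r f)"
      by (intro sums_mult mehler_sums[OF r f B])
    show "(\<lambda>m. r ^ n * (s ^ m * hlevel f m)) sums (r ^ n * mehler_form s f)"
      using r s by (intro sums_mult mehler_sums[OF _ _ f B]) auto
    fix m
    show "s ^ n * (r ^ m * hlevel f m) \<le> r ^ n * (s ^ m * hlevel f m)"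
    proof (cases "m < n")
      case True then show ?thesis by (simp add: z')
    next
      case False
      then obtain k where m: "m = n + k" by (metis le_iff_add not_le)
      have "r ^ k * (s ^ n * r ^ n) \<le> s ^ k * (s ^ n * r ^ n)"
        using r s by (intro mult_right_mono power_mono) auto
      then have "s ^ n * r ^ m \<le> r ^ n * s ^ m" by (simp add: m power_add mult_ac)
      from mult_right_mono[OF this hlevel_nonneg[of f m]] show ?thesis by (simp add: mult_ac)
    qed
  qed
  have "1 ^ n * mehler_form r f \<le> r ^ n * ?E"
  proof (rule LIMSEQ_le_const2)
    show "(\<lambda>k. to_one k ^ n * mehler_form r f) \<longlonglongrightarrow> 1 ^ n * mehler_form r f"
      by (intro tendsto_intros to_one)
    have "\<forall>\<^sub>F k in sequentially. r < to_one k" by (rule order_tendstoD(1)[OF to_one(2) r(2)])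
    then obtain N where N: "\<forall>k\<ge>N. r < to_one k" by (auto simp: eventually_sequentially)
    have "to_one k ^ n * mehler_form r f \<le> r ^ n * ?E" if "k \<ge> N" for k
    proof -
      have "to_one k ^ n * mehler_form r f \<le> r ^ n * mehler_form (to_one k) f"
        using N that to_one(1) by (intro step) (auto intro: less_imp_le)
      also have "\<dots> \<le> r ^ n * ?E" using r to_one(1) by (intro mult_left_mono mehler_form_le[OF _ _ f B]) auto
      finally show ?thesis .
    qed
    then show "\<exists>N. \<forall>k\<ge>N. to_one k ^ n * mehler_form r f \<le> r ^ n * ?E" by blast
  qed
  then show ?thesis by simp
qed

text \<open>No chain rule is needed to pass from \<open>u\<close> to \<open>u\<^sup>2\<close>: since
  \<open>\<bar>u(x)\<^sup>2 - u(y)\<^sup>2\<bar> \<le> 2 \<surd>L \<bar>u(x) - u(y)\<bar>\<close>, the two nonlocal Dirichlet forms compare.\<close>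

lemma spectral_gap_square:
  fixes u :: "real ^ 'd \<Rightarrow> real"
  assumes u[measurable]: "u \<in> borel_measurable borel" and L: "\<And>x. 0 \<le> u x" "\<And>x. (u x)\<^sup>2 \<le> L"
    and g: "g \<in> borel_measurable borel" "integrable gam (\<lambda>x. (norm (g x))\<^sup>2)" "grad_coeffs u g"
    and z: "\<And>w. length w < n \<Longrightarrow> hcoeff (\<lambda>x. (u x)\<^sup>2 - 1) w = 0"
  shows "real n * (\<integral>x. ((u x)\<^sup>2 - 1)\<^sup>2 \<partial>gam) \<le> 4 * L * (\<integral>x. (norm (g x))\<^sup>2 \<partial>gam)"
proof -
  let ?f = "\<lambda>x. (u x)\<^sup>2 - 1"
  let ?V = "\<integral>x. (?f x)\<^sup>2 \<partial>gam" and ?E = "\<integral>x. (norm (g x))\<^sup>2 \<partial>gam"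
  have L0: "0 \<le> L" using L(2)[of 0] zero_le_power2[of "u 0"] by linarith
  have uB: "\<bar>u x\<bar> \<le> sqrt L" for x using L[of x] by (simp add: real_le_rsqrt)
  have fB: "\<bar>?f x\<bar> \<le> L + 1" for x using L(2)[of x] zero_le_power2[of "u x"] L0 by linarith
  have fm: "?f \<in> borel_measurable borel" by measurable
  have main: "(1 - r ^ n) * ?V \<le> 4 * L * ((1 - r) * ?E)" if r: "0 \<le> r" "r < 1" for r
  proof -
    have "2 * (?V - mehler_form r ?f) = (\<integral>p. (?f (fst p) - ?f (snd p))\<^sup>2 \<partial>nu r)"
      by (rule mehler_form_dirichlet[OF r fm fB, symmetric])
    also have "\<dots> \<le> (\<integral>p. 4 * L * (u (fst p) - u (snd p))\<^sup>2 \<partial>nu r)"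
    proof (rule integral_mono)
      have "\<bar>?f x - ?f y\<bar> \<le> L" for x y
        using L(2)[of x] L(2)[of y] zero_le_power2[of "u x"] zero_le_power2[of "u y"] by linarith
      from abs_square_le[OF this] show "integrable (nu r) (\<lambda>p. (?f (fst p) - ?f (snd p))\<^sup>2)"
        by (intro bounded_integrable_nu[OF r, of _ "L\<^sup>2"]) measurable
      have "\<bar>u x - u y\<bar> \<le> 2 * sqrt L" for x y using uB[of x] uB[of y] by linarith
      from abs_square_le[OF this] show "integrable (nu r) (\<lambda>p. 4 * L * (u (fst p) - u (snd p))\<^sup>2)"
        by (intro integrable_mult_right bounded_integrable_nu[OF r, of _ "(2 * sqrt L)\<^sup>2"]) measurable
      fix p :: "(real ^ 'd) \<times> (real ^ 'd)"
      have "\<bar>u (fst p) + u (snd p)\<bar> \<le> 2 * sqrt L" using uB[of "fst p"] uB[of "snd p"] by linarith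
      from abs_square_le[OF this] have "(u (fst p) + u (snd p))\<^sup>2 \<le> 4 * L" using L0 by (simp add: power_mult_distrib)
      from mult_right_mono[OF this zero_le_power2[of "u (fst p) - u (snd p)"]]
      show "(?f (fst p) - ?f (snd p))\<^sup>2 \<le> 4 * L * (u (fst p) - u (snd p))\<^sup>2"
        by (simp add: power_mult_distrib[symmetric]) (simp add: power2_eq_square algebra_simps)
    qed
    also have "\<dots> = 4 * L * (2 * ((\<integral>x. (u x)\<^sup>2 \<partial>gam) - mehler_form r u))"
      by (simp add: mehler_form_dirichlet[OF r u uB])
    also have "\<dots> \<le> 4 * L * (2 * ((1 - r) * ?E))"
      using L0 by (intro mult_left_mono mehler_form_deficit[OF u uB g r]) auto
    finally have "?V - mehler_form r ?f \<le> 4 * L * ((1 - r) * ?E)" by simp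
    moreover have "mehler_form r ?f \<le> r ^ n * ?V" by (rule mehler_form_gap[OF fm fB z r])
    ultimately show ?thesis by (simp add: algebra_simps)
  qed
  \<comment> \<open>Dividing by 1 - r turns 1 - r^n into a geometric sum, whose limit at r = 1 is
    n.\<close>
  have main': "(\<Sum>k<n. r ^ k) * ?V \<le> 4 * L * ?E" if r: "0 \<le> r" "r < 1" for r
  proof -
    have "1 - r ^ n = (1 - r) * (\<Sum>k<n. r ^ k)" using one_diff_power_eq[of r n] by simp
    then have "(1 - r) * ((\<Sum>k<n. r ^ k) * ?V) \<le> (1 - r) * (4 * L * ?E)" using main[OF r] by (simp add: mult_ac)
    then show ?thesis using r by (simp only: mult_le_cancel_left_pos diff_gt_0_iff_gt)
  qed
  have "(\<lambda>m. (\<Sum>k<n. to_one m ^ k) * ?V) \<longlonglongrightarrow> (\<Sum>k<n. 1 ^ k) * ?V"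
    by (intro tendsto_intros to_one)
  moreover have "(\<Sum>k<n. to_one m ^ k) * ?V \<le> 4 * L * ?E" for m using main'[of "to_one m"] to_one(1)[of m] by blast
  ultimately have "(\<Sum>k<n. 1 ^ k) * ?V \<le> 4 * L * ?E" by (intro LIMSEQ_le_const2) auto
  then show ?thesis by simp
qed

section \<open>The entropy inequality\<close>

lemma AE_lebesgue_lborel: "(AE x in lebesgue. P x) \<longleftrightarrow> (AE x in lborel. P x)"
  by (rule AE_completion_iff)

lemma gauss_eq: "gauss = density lebesgue (\<lambda>x. ennreal (phi x))"
  by (simp add: gauss_def phi_def)

lemma phi_measurable_lebesgue[measurable]: "phi \<in> borel_measurable lebesgue"
  by (rule measurable_completion) measurable

lemma sets_gauss[measurable_cong, simp]: "sets gauss = sets lebesgue" by (simp add: gauss_eq)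

lemma AE_gauss: "(AE x in gauss. P x) \<longleftrightarrow> (AE x in lebesgue. P x)"
  unfolding gauss_eq by (subst AE_density) (auto simp: phi_pos)

lemma AE_gam: "(AE x in gam. P x) \<longleftrightarrow> (AE x in lborel. P x)"
  unfolding gam_def by (subst AE_density) (auto simp: phi_pos)

lemma gauss_integral:
  fixes f f' :: "real ^ 'd \<Rightarrow> real"
  assumes f: "f \<in> borel_measurable lebesgue" and f': "f' \<in> borel_measurable borel" and e: "AE x in lborel. f x = f' x"
  shows "(\<integral>x. f x \<partial>gauss) = (\<integral>x. f' x \<partial>gam)"
proof -
  have f'l[measurable]: "f' \<in> borel_measurable lebesgue" by (rule measurable_completion) (use f' in simp)
  have "(\<integral>x. f x \<partial>gauss) = (\<integral>x. f' x \<partial>gauss)"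
    using f f'l e by (intro integral_cong_AE) (auto simp: AE_gauss AE_lebesgue_lborel cong: measurable_cong_sets)
  also have "\<dots> = (\<integral>x. phi x *\<^sub>R f' x \<partial>lebesgue)"
    unfolding gauss_eq by (subst integral_density) (auto simp: phi_nonneg)
  also have "\<dots> = (\<integral>x. phi x *\<^sub>R f' x \<partial>lborel)"
    by (intro integral_completion borel_measurable_scaleR) (use f' in simp_all)
  finally show ?thesis using f' by (simp add: integral_gam)
qed

lemma gauss_nn_integral:
  fixes f f' :: "real ^ 'd \<Rightarrow> ennreal"
  assumes f': "f' \<in> borel_measurable borel" and e: "AE x in lborel. f x = f' x"
  shows "(\<integral>\<^sup>+x. f x \<partial>gauss) = (\<integral>\<^sup>+x. f' x \<partial>gam)"
proof -
  have f'l[measurable]: "f' \<in> borel_measurable lebesgue" by (rule measurable_completion) (use f' in simp)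
  have "(\<integral>\<^sup>+x. f x \<partial>gauss) = (\<integral>\<^sup>+x. f' x \<partial>gauss)"
    using e by (intro nn_integral_cong_AE) (auto simp: AE_gauss AE_lebesgue_lborel)
  also have "\<dots> = (\<integral>\<^sup>+x. phi x * f' x \<partial>lebesgue)"
    unfolding gauss_eq by (subst nn_integral_density) auto
  also have "\<dots> = (\<integral>\<^sup>+x. phi x * f' x \<partial>lborel)"
    using f' by (intro nn_integral_completion) 
  finally show ?thesis using f' unfolding gam_def by (simp add: nn_integral_density)
qed

lemma loc_integrable_measurable:
  fixes f :: "real ^ 'd \<Rightarrow> 'b::euclidean_space"
  assumes "loc_integrable f" shows "f \<in> borel_measurable lebesgue"
proof (rule borel_measurable_LIMSEQ_metric)
  show "(\<lambda>x. indicator (cball 0 (real n)) x *\<^sub>R f x) \<in> borel_measurable lebesgue" for n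
    using assms compact_cball unfolding loc_integrable_def set_integrable_def by (blast intro: borel_measurable_integrable)
  fix x :: "real ^ 'd"
  obtain N where N: "norm x \<le> real N" using real_arch_simple by blast
  then have "indicator (cball 0 (real n)) x *\<^sub>R f x = f x" if "n \<ge> N" for n
    using that by (simp add: indicator_def order_trans)
  then show "(\<lambda>n. indicator (cball 0 (real n)) x *\<^sub>R f x) \<longlonglongrightarrow> f x"
    by (intro tendsto_eventually) (auto simp: eventually_sequentially)
qed

lemma lebesgue_borel_vec:
  fixes g :: "real ^ 'd \<Rightarrow> real ^ 'd"
  assumes [measurable]: "g \<in> borel_measurable lebesgue"
  obtains g' where "g' \<in> borel_measurable borel" "AE x in lborel. g x = g' x"
proof -
  have "\<exists>h. h \<in> borel_measurable lborel \<and> (AE x in lborel. g x $ i = h x)" for i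
    using completion_ex_borel_measurable_real[of "\<lambda>x. g x $ i" lborel] by auto
  then obtain h where h: "\<And>i. h i \<in> borel_measurable lborel" "\<And>i. AE x in lborel. g x $ i = h i x" by metis
  show ?thesis
  proof (rule that)
    show "(\<lambda>x. \<chi> i. h i x) \<in> borel_measurable borel"
      using h(1) by (subst borel_measurable_euclidean_space) (auto simp: Basis_vec_real inner_axis)
    have "AE x in lborel. \<forall>i\<in>UNIV. g x $ i = h i x" by (rule AE_finite_allI) (auto simp: h)
    then show "AE x in lborel. g x = (\<chi> i. h i x)" by eventually_elim (simp add: vec_eq_iff)
  qed
qed

lemma measure_gam_UNIV[simp]: "measure (gam :: (real ^ 'd) measure) UNIV = 1"
  using gam.prob_space by simp

text \<open>Bessel's inequality for the constant 1: its level 0 already equals its squared norm 1,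
  so every higher level vanishes, and with it each coefficient in that level.\<close>

lemma integral_He:
  fixes v :: "'d::finite list"
  assumes "v \<noteq> []"
  shows "(\<integral>x. He v x \<partial>gam) = 0"
proof -
  let ?one = "\<lambda>_ :: real ^ 'd. 1 :: real"
  let ?m = "length v"
  have "(\<Sum>k<Suc ?m. hlevel ?one k) \<le> (\<integral>x. (?one x)\<^sup>2 \<partial>gam)"
    by (rule hlevel_bessel) auto
  then have "(\<Sum>k<Suc ?m. hlevel ?one k) \<le> 1" by simp
  moreover have "hlevel ?one 0 = 1" by (simp add: hlevel_def hcoeff_def He_def)
  moreover have "(\<Sum>k<Suc ?m. hlevel ?one k) = hlevel ?one 0 + (\<Sum>k<?m. hlevel ?one (Suc k))"
    by (rule sum.lessThan_Suc_shift)
  ultimately have "(\<Sum>k<?m. hlevel ?one (Suc k)) \<le> 0" by linarith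
  moreover have "hlevel ?one (Suc (?m - 1)) \<le> (\<Sum>k<?m. hlevel ?one (Suc k))"
    using assms by (intro member_le_sum) (auto simp: hlevel_nonneg)
  ultimately have "hlevel ?one ?m = 0" using assms hlevel_nonneg[of ?one ?m] by simp
  then have "(\<Sum>w | length w = ?m. (hcoeff ?one w)\<^sup>2) = 0" by (simp add: hlevel_def)
  then have "(hcoeff ?one v)\<^sup>2 = 0"
    by (subst (asm) sum_nonneg_eq_0_iff) (auto simp: finite_lists_length)
  then show ?thesis by (simp add: hcoeff_def)
qed

section \<open>Elementary properties of \<open>h1\<close>\<close>

lemma h1_pos: "0 \<le> s \<Longrightarrow> 0 < h1 s"
proof -
  assume s: "0 \<le> s"
  show ?thesis
  proof (cases "s = 0 \<or> s = 1")
    case False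
    with s have s': "0 < s" "s \<noteq> 1" by auto
    have "ln (1 / s) \<le> 1 / s - 1" using s' by (intro ln_le_minus_one) auto
    moreover have "ln (1 / s) \<noteq> 1 / s - 1" using ln_eq_minus_one[of "1 / s"] s' by auto
    ultimately have "ln (1 / s) < 1 / s - 1" by simp
    then have "s * ln (1 / s) < s * (1 / s - 1)" using s' by (intro mult_strict_left_mono) auto
    then have "0 < s * ln s - (s - 1)" using s' by (simp add: ln_div algebra_simps)
    then show ?thesis using s' by (simp add: h1_def)
  qed (auto simp: h1_def)
qed

text \<open>From ln s \<le> s - 1 multiplied by s. The bound makes the essential supremum in
  \<open>H1\<close> a finite number.\<close>

lemma h1_le_1: "0 \<le> s \<Longrightarrow> h1 s \<le> 1"
proof -
  assume s: "0 \<le> s"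
  show ?thesis
  proof (cases "s = 0 \<or> s = 1")
    case False
    with s have s': "0 < s" "s \<noteq> 1" by auto
    have "s * ln s \<le> s * (s - 1)" using s' by (intro mult_left_mono ln_le_minus_one) auto
    then have "s * ln s - (s - 1) \<le> \<bar>s - 1\<bar>\<^sup>2" by (simp add: power2_eq_square algebra_simps)
    then show ?thesis using s' by (simp add: h1_def)
  qed (auto simp: h1_def)
qed

text \<open>The exceptional values fit: at s = 0 both sides are 1 by \<open>0 * ln 0 = 0\<close>, at
  s = 1 both are 0. The entropy can therefore be rewritten at every point.\<close>

lemma h1_mult: "h1 s * (s - 1)\<^sup>2 = s * ln s - (s - 1)"
  by (auto simp: h1_def)

lemma h1_measurable[measurable]: "h1 \<in> borel_measurable borel"
  unfolding h1_def[abs_def] by measurable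


text \<open>Testing the weak gradient with \<open>He v * phi\<close>: the sign in Rodrigues' formula
  cancels the sign of the integration by parts. Boundedness of u' and square integrability of g'
  make all the products integrable.\<close>

lemma grad_coeffs_weak:
  fixes u u' :: "real ^ 'd \<Rightarrow> real" and g g' :: "real ^ 'd \<Rightarrow> real ^ 'd"
  assumes w: "has_weak_gradient u g"
    and u'[measurable]: "u' \<in> borel_measurable borel" and g'[measurable]: "g' \<in> borel_measurable borel"
    and u: "AE x in lborel. u x = u' x" and g: "AE x in lborel. g x = g' x"
    and B: "\<And>x. \<bar>u' x\<bar> \<le> B" and I: "integrable gam (\<lambda>x. (norm (g' x))\<^sup>2)"
  shows "grad_coeffs u' g'"
  unfolding grad_coeffs_def
proof (intro allI)
  fix i and v :: "'d list"
  let ?F = "\<lambda>x. He v x * phi x"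
  have um: "u \<in> borel_measurable lebesgue" and gm: "g \<in> borel_measurable lebesgue"
    using w loc_integrable_measurable unfolding has_weak_gradient_def by blast+
  have leb: "f \<in> borel_measurable borel \<Longrightarrow> f \<in> borel_measurable lebesgue" for f :: "real ^ 'd \<Rightarrow> real"
    by (rule measurable_completion) simp
  have conv: "integrable lebesgue (\<lambda>x. f x * H x) \<longleftrightarrow> integrable lborel (\<lambda>x. f' x * H x)"
    "(\<integral>x. f x * H x \<partial>lebesgue) = (\<integral>x. f' x * H x \<partial>lborel)"
    if f: "f \<in> borel_measurable lebesgue" "f' \<in> borel_measurable borel" "AE x in lborel. f x = f' x"
      and H: "H \<in> borel_measurable borel" for f f' H :: "real ^ 'd \<Rightarrow> real"
  proof -
    have m: "(\<lambda>x. f x * H x) \<in> borel_measurable lebesgue" "(\<lambda>x. f' x * H x) \<in> borel_measurable lebesgue"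
      "(\<lambda>x. f' x * H x) \<in> borel_measurable lborel"
      using f leb[OF H] leb[OF f(2)] H by auto
    have e: "AE x in lebesgue. f x * H x = f' x * H x" using f(3) by (simp add: AE_lebesgue_lborel) (auto elim: eventually_mono)
    show "integrable lebesgue (\<lambda>x. f x * H x) \<longleftrightarrow> integrable lborel (\<lambda>x. f' x * H x)"
      using integrable_cong_AE[OF m(1,2) e] integrable_completion[OF m(3)] by simp
    show "(\<integral>x. f x * H x \<partial>lebesgue) = (\<integral>x. f' x * H x \<partial>lborel)"
      using integral_cong_AE[OF m(1,2) e] integral_completion[OF m(3)] by simp
  qed
  have Fm[measurable]: "?F \<in> borel_measurable borel" and F'm[measurable]: "(\<lambda>x. - (He (i # v) x * phi x)) \<in> borel_measurable borel"
    by measurable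
  have gi: "(\<lambda>x. g x $ i) \<in> borel_measurable lebesgue" "(\<lambda>x. g' x $ i) \<in> borel_measurable borel"
    using gm by measurable
  have gie: "AE x in lborel. g x $ i = g' x $ i" using g by eventually_elim simp
  have uHe: "integrable gam (\<lambda>x. u' x * He w x)" for w
    by (rule integrable_bounded_mult_He[OF u' B])
  have gHe: "integrable gam (\<lambda>x. g' x $ i * He v x)"
  proof (rule integrable_mult_sq)
    show "integrable gam (\<lambda>x. (g' x $ i)\<^sup>2)"
      by (rule Bochner_Integration.integrable_bound[OF I])
        (auto simp: abs_le_square_iff[symmetric] component_le_norm_cart)
  qed (auto intro: He_sq_integrable)
  have I1: "integrable lborel (\<lambda>x. u' x * ?F x)"
    using uHe[of v] by (subst (asm) integrable_gam) (auto simp: mult_ac)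
  have I2: "integrable lborel (\<lambda>x. u' x * - (He (i # v) x * phi x))"
    using uHe[of "i # v"] by (subst (asm) integrable_gam) (auto simp: mult_ac)
  have I3: "integrable lborel (\<lambda>x. g' x $ i * ?F x)"
    using gHe by (subst (asm) integrable_gam) (auto simp: mult_ac)
  have "(\<integral>x. u x * partial i ?F x \<partial>lebesgue) = - (\<integral>x. g x $ i * ?F x \<partial>lebesgue)"
    by (rule weak_gradient_smooth[OF w _ um gm])
      (simp_all only: partial_He_phi conv(1)[OF um u' u Fm] conv(1)[OF um u' u F'm] conv(1)[OF gi gie Fm] I1 I2 I3
        smooth_fns.mult smooth_fns_He smooth_fns_phi)
  then have "(\<integral>x. u' x * - (He (i # v) x * phi x) \<partial>lborel) = - (\<integral>x. g' x $ i * ?F x \<partial>lborel)"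
    by (simp only: partial_He_phi conv(2)[OF um u' u F'm] conv(2)[OF gi gie Fm])
  then have "(\<integral>x. phi x *\<^sub>R (u' x * He (i # v) x) \<partial>lborel) = (\<integral>x. phi x *\<^sub>R (g' x $ i * He v x) \<partial>lborel)"
    by (simp add: mult_ac)
  then show "hcoeff u' (i # v) = hcoeff (\<lambda>x. g' x $ i) v"
    unfolding hcoeff_def using gi by (simp add: integral_gam)
qed

lemma entropy_bound:
  fixes w :: "real ^ 'd \<Rightarrow> real"
  assumes n: "n \<ge> 1" and a: "admissible n w"
  shows "ereal (entropy_gauss w) \<le> H1 w / ereal (real n) * enn2ereal (fisher w)"
proof -
  from a have wm[measurable]: "w \<in> borel_measurable lebesgue" and fin: "Linf_norm w < \<infinity>" and w0: "AE x in lborel. 0 \<le> w x"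
    and int1: "(\<integral>x. w x \<partial>gauss) = 1"
    and mom: "\<And>k. 0 < mi_length k \<Longrightarrow> mi_length k < n \<Longrightarrow> (\<integral>x. w x * Hermite k x \<partial>gauss) = 0"
    by (auto simp: admissible_def Linf_def AE_lebesgue_lborel)
  have Lae: "AE x in lborel. ereal \<bar>w x\<bar> \<le> Linf_norm w"
    unfolding Linf_norm_def AE_lebesgue_lborel[symmetric] by (rule esssup_AE)
  \<comment> \<open>The value minus infinity would make a false statement hold almost everywhere,
    which is impossible for the probability measure \<open>gam\<close>.\<close>
  obtain L where L: "Linf_norm w = ereal L"
  proof (cases "Linf_norm w")
    case MInf
    with Lae have "AE x in (lborel :: (real ^ 'd) measure). False" by auto
    then have "AE x in (gam :: (real ^ 'd) measure). False" by (simp only: AE_gam)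
    then show ?thesis by simp
  qed (use fin that in auto)
  obtain v where v[measurable]: "v \<in> borel_measurable borel" and wv: "AE x in lborel. w x = v x"
    using completion_ex_borel_measurable_real[OF wm] by auto
  \<comment> \<open>A Borel representative clipped to [0, L], so that the bounds hold at every
    point, as the Mehler lemmas require.\<close>
  define w' where "w' x = max 0 (min L (v x))" for x
  have w'm[measurable]: "w' \<in> borel_measurable borel" unfolding w'_def[abs_def] by measurable
  have L0: "0 \<le> L"
  proof -
    have "AE x in (gam :: (real ^ 'd) measure). 0 \<le> L"
      unfolding AE_gam using Lae by eventually_elim (auto simp: L intro: order_trans[OF abs_ge_zero])
    then show ?thesis by simp
  qed
  have ww': "AE x in lborel. w x = w' x"
    using wv w0 Lae by eventually_elim (auto simp: w'_def L)
  have w'b: "0 \<le> w' x" "w' x \<le> L" for x using L0 by (auto simp: w'_def)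
  define u where "u x = sqrt (w' x)" for x
  have um[measurable]: "u \<in> borel_measurable borel" unfolding u_def[abs_def] by measurable
  have u2: "(u x)\<^sup>2 = w' x" for x using w'b by (simp add: u_def)
  have int1': "(\<integral>x. w' x \<partial>gam) = 1" using gauss_integral[OF wm w'm ww'] int1 by simp
  have w'I: "integrable gam w'" by (rule gam.integrable_const_bound[where B=L]) (use w'b in auto)
  have L1: "1 \<le> L"
  proof -
    have "(\<integral>x. w' x \<partial>gam) \<le> (\<integral>x. L \<partial>(gam :: (real ^ 'd) measure))"
      by (rule integral_mono[OF w'I]) (auto simp: w'b)
    then show ?thesis using int1' by simp
  qed
  let ?S = "esssup lebesgue (\<lambda>x. ereal (h1 (w x)))"
  have Sae: "AE x in lborel. ereal (h1 (w' x)) \<le> ?S"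
    using esssup_AE[of "\<lambda>x. ereal (h1 (w x))" lebesgue] ww' unfolding AE_lebesgue_lborel
    by eventually_elim simp
  have "?S \<le> 1"
  proof (rule esssup_I)
    show "AE x in lebesgue. ereal (h1 (w x)) \<le> 1"
      unfolding AE_lebesgue_lborel using ww' by eventually_elim (use h1_le_1 w'b in auto)
  qed measurable
  \<comment> \<open>Strict positivity of this factor, together with L \<ge> 1 from the mean, settles
    infinite Fisher information: the right-hand side is then a positive number times
    infinity.\<close>
  moreover have "0 < ?S"
  proof (rule ccontr)
    assume "\<not> 0 < ?S"
    then have S': "?S \<le> 0" by simp
    from Sae have "AE x in lborel. ereal (h1 (w' x)) \<le> 0" by eventually_elim (rule order_trans[OF _ S'])
    then have "AE x in (gam :: (real ^ 'd) measure). False"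
      unfolding AE_gam by eventually_elim (use h1_pos w'b in \<open>auto simp: not_le[symmetric]\<close>)
    then show False by simp
  qed
  ultimately obtain S where S: "?S = ereal S" and S0: "0 < S" by (cases ?S) auto
  have H1: "H1 w = ereal (L * S)" by (simp add: H1_def L S)
  have LS: "0 < L * S" using L1 S0 by simp
  show ?thesis
  proof (cases "fisher w = \<infinity>")
    case True
    then show ?thesis using L1 S0 n by (simp add: H1)
  next
    case False
    let ?g0 = "weak_gradient (\<lambda>x. sqrt (w x))"
    from False have ex: "\<exists>g. has_weak_gradient (\<lambda>x. sqrt (w x)) g" unfolding fisher_def by (auto split: if_splits)
    then have wg: "has_weak_gradient (\<lambda>x. sqrt (w x)) ?g0" unfolding weak_gradient_def by (rule someI_ex)
    obtain g where g[measurable]: "g \<in> borel_measurable borel" and ge: "AE x in lborel. ?g0 x = g x"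
      using wg lebesgue_borel_vec loc_integrable_measurable unfolding has_weak_gradient_def by blast
    have "fisher w = 4 * (\<integral>\<^sup>+x. ennreal ((norm (?g0 x))\<^sup>2) \<partial>gauss)"
      using ex by (simp add: fisher_def)
    also have "(\<integral>\<^sup>+x. ennreal ((norm (?g0 x))\<^sup>2) \<partial>gauss) = (\<integral>\<^sup>+x. ennreal ((norm (g x))\<^sup>2) \<partial>gam)"
      by (rule gauss_nn_integral) (use ge in \<open>auto elim: eventually_mono\<close>)
    finally have fi: "fisher w = 4 * (\<integral>\<^sup>+x. ennreal ((norm (g x))\<^sup>2) \<partial>gam)" .
    with False have nf: "(\<integral>\<^sup>+x. ennreal ((norm (g x))\<^sup>2) \<partial>gam) < \<infinity>"
      by (auto simp: ennreal_mult_eq_top_iff less_top)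
    have gI: "integrable gam (\<lambda>x. (norm (g x))\<^sup>2)"
      using nf by (intro integrableI_nonneg) auto
    let ?E = "\<integral>x. (norm (g x))\<^sup>2 \<partial>gam"
    have E0: "0 \<le> ?E" by (rule integral_nonneg_AE) simp
    have fE: "fisher w = ennreal (4 * ?E)"
      using fi nn_integral_eq_integral[OF gI] E0 by (simp add: ennreal_mult)
    have uB: "\<bar>u x\<bar> \<le> sqrt L" for x unfolding u_def using w'b by simp
    have gc: "grad_coeffs u g"
      by (rule grad_coeffs_weak[OF wg um g _ ge uB gI]) (use ww' in \<open>auto simp: u_def elim: eventually_mono\<close>)
    \<comment> \<open>Subtracting 1 cancels the coefficient of the empty word because the mean is
      one; on nonempty words it changes nothing, since \<open>He\<close> has mean zero
      there.\<close>
    have hc0: "hcoeff (\<lambda>x. (u x)\<^sup>2 - 1) l = 0" if l: "length l < n" for l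
    proof -
      have wI: "integrable gam (\<lambda>x. w' x * He l x)"
        by (rule integrable_bounded_mult_He[where B=L]) (use w'b in auto)
      have "hcoeff (\<lambda>x. (u x)\<^sup>2 - 1) l = (\<integral>x. w' x * He l x \<partial>gam) - (\<integral>x. He l x \<partial>gam)"
        unfolding hcoeff_def u2 left_diff_distrib using wI He_gam_integrable[of l] by simp
      also have "\<dots> = 0"
      proof (cases "l = []")
        case True
        then show ?thesis by (simp add: He_def int1')
      next
        case False
        let ?k = "\<chi> j. count_list l j" and ?c = "\<Prod>j\<in>UNIV. sqrt (fact (count_list l j)) :: real"
        have c0: "?c \<noteq> 0" by simp
        have Hm: "Hermite ?k \<in> borel_measurable borel" unfolding Hermite_eq_He by measurable
        have Hl: "Hermite ?k \<in> borel_measurable lebesgue" by (rule measurable_completion) (use Hm in simp)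
        have "0 = (\<integral>x. w x * Hermite ?k x \<partial>gauss)"
          using mom[of ?k] False l by (simp add: mi_length_count)
        also have "\<dots> = (\<integral>x. w' x * Hermite ?k x \<partial>gam)"
          by (rule gauss_integral) (use Hm Hl ww' in \<open>auto elim: eventually_mono\<close>)
        also have "\<dots> = (\<integral>x. w' x * He l x \<partial>gam) / ?c"
          unfolding Hermite_eq_He by simp
        finally have "(\<integral>x. w' x * He l x \<partial>gam) = 0" using c0 by simp
        then show ?thesis by (simp add: integral_He[OF False])
      qed
      finally show ?thesis .
    qed
    let ?V = "\<integral>x. ((u x)\<^sup>2 - 1)\<^sup>2 \<partial>gam"
    have gap: "real n * ?V \<le> 4 * L * ?E"
      by (rule spectral_gap_square[OF um _ _ g gI gc hc0]) (auto simp: u2 w'b u_def)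
    have VI: "integrable gam (\<lambda>x. (w' x - 1)\<^sup>2)"
    proof (rule gam.integrable_const_bound[where B="(L + 1)\<^sup>2"])
      have "\<bar>w' x - 1\<bar> \<le> L + 1" for x using w'b[of x] L0 by linarith
      from abs_square_le[OF this] show "AE x in gam. norm ((w' x - 1)\<^sup>2) \<le> (L + 1)\<^sup>2" by simp
    qed measurable
    have "entropy_gauss w = (\<integral>x. w' x * ln (w' x) \<partial>gam)"
      unfolding entropy_gauss_def by (rule gauss_integral) (use ww' in \<open>auto elim: eventually_mono\<close>)
    \<comment> \<open>The linear part w' - 1 is kept apart because its integral vanishes.\<close>
    also have "\<dots> = (\<integral>x. h1 (w' x) * (w' x - 1)\<^sup>2 + (w' x - 1) \<partial>gam)"
      by (simp add: h1_mult)
    also have "\<dots> = (\<integral>x. h1 (w' x) * (w' x - 1)\<^sup>2 \<partial>gam) + (\<integral>x. w' x - 1 \<partial>gam)"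
    proof (rule Bochner_Integration.integral_add)
      show "integrable gam (\<lambda>x. h1 (w' x) * (w' x - 1)\<^sup>2)"
        by (rule Bochner_Integration.integrable_bound[OF VI])
          (use w'b h1_pos h1_le_1 in \<open>auto simp: abs_mult less_imp_le intro!: mult_left_le_one_le\<close>)
    qed (use w'I in auto)
    also have "(\<integral>x. w' x - 1 \<partial>gam) = 0" using w'I int1' by simp
    also have "(\<integral>x. h1 (w' x) * (w' x - 1)\<^sup>2 \<partial>gam) + 0 \<le> (\<integral>x. S * (w' x - 1)\<^sup>2 \<partial>gam) + 0"
    proof (intro add_right_mono integral_mono_AE)
      show "integrable gam (\<lambda>x. h1 (w' x) * (w' x - 1)\<^sup>2)"
        by (rule Bochner_Integration.integrable_bound[OF VI])
          (use w'b h1_pos h1_le_1 in \<open>auto simp: abs_mult less_imp_le intro!: mult_left_le_one_le\<close>)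
      show "AE x in gam. h1 (w' x) * (w' x - 1)\<^sup>2 \<le> S * (w' x - 1)\<^sup>2"
        unfolding AE_gam using Sae by eventually_elim (auto simp: S intro!: mult_right_mono)
    qed (use VI in auto)
    also have "\<dots> = S * ?V" by (simp add: u2)
    also have "\<dots> \<le> S * (4 * L * ?E / real n)"
      using gap S0 n by (intro mult_left_mono) (auto simp: field_simps)
    also have "\<dots> = L * S / real n * (4 * ?E)" by simp
    finally show ?thesis using E0 n by (simp add: H1 fE)
  qed
qed

section \<open>Weak gradients of smooth functions and their uniqueness\<close>

lemma partial_zero_outside:
  fixes P :: "real ^ 'd \<Rightarrow> real"
  assumes d: "\<And>x. P differentiable (at x)" and z: "\<And>x. R < norm x \<Longrightarrow> P x = 0" and x: "R < norm x"
  shows "partial i P x = 0"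
proof (rule partial_unique[OF d])
  have "open {y :: real ^ 'd. R < norm y}" by (intro open_Collect_less continuous_intros)
  then have o: "open ((\<lambda>t. x + t *\<^sub>R axis i 1) -` {y :: real ^ 'd. R < norm y})"
    by (intro open_vimage continuous_intros)
  show "((\<lambda>t. P (x + t *\<^sub>R axis i 1)) has_real_derivative 0) (at 0)"
    by (rule has_field_derivative_transform_within_open[OF DERIV_const[of 0] o]) (use x z in auto)
qed

lemma partial_line_derivative:
  fixes P :: "real ^ 'd \<Rightarrow> real"
  assumes d: "\<And>x. P differentiable (at x)"
  shows "((\<lambda>t. P (x + t *\<^sub>R axis i 1)) has_real_derivative partial i P (x + t *\<^sub>R axis i 1)) (at t)"
proof -
  have "((\<lambda>s. P ((x + t *\<^sub>R axis i 1) + s *\<^sub>R axis i 1)) has_real_derivative partial i P (x + t *\<^sub>R axis i 1)) (at 0)"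
    by (rule partial_has_real_derivative[OF d])
  then have "((\<lambda>s. (\<lambda>t. P (x + t *\<^sub>R axis i 1)) (t + s)) has_real_derivative partial i P (x + t *\<^sub>R axis i 1)) (at 0)"
    by (simp add: scaleR_left_distrib add.assoc)
  then show ?thesis
    using DERIV_shift[of "\<lambda>t. P (x + t *\<^sub>R axis i 1)" "partial i P (x + t *\<^sub>R axis i 1)" 0 t]
    by (simp add: add.commute)
qed

lemma integrable_compact_support:
  fixes f :: "real ^ 'd \<Rightarrow> real"
  assumes c: "continuous_on UNIV f" and z: "\<And>x. R < norm x \<Longrightarrow> f x = 0"
  shows "integrable lborel f"
proof -
  have "integrable lborel (\<lambda>x. indicator (cball 0 R) x *\<^sub>R f x)"
    by (intro borel_integrable_compact continuous_on_subset[OF c]) auto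
  moreover have "(\<lambda>x. indicator (cball 0 R) x *\<^sub>R f x) = f" using z by (auto simp: indicator_def fun_eq_iff not_le)
  ultimately show ?thesis by simp
qed

text \<open>Difference quotients have integral zero by translation invariance, and they converge to
  the partial derivative under a Lipschitz bound on a ball.\<close>

lemma integral_partial_zero:
  fixes P :: "real ^ 'd \<Rightarrow> real"
  assumes d: "\<And>x. P differentiable (at x)" and c: "continuous_on UNIV (partial i P)"
    and z: "\<And>x. R < norm x \<Longrightarrow> P x = 0"
  shows "(\<integral>x. partial i P x \<partial>lborel) = 0"
proof -
  have Pc: "continuous_on UNIV P"
    by (intro continuous_at_imp_continuous_on ballI differentiable_imp_continuous_within d)
  have [measurable]: "P \<in> borel_measurable borel" "partial i P \<in> borel_measurable borel"
    by (intro borel_measurable_continuous_onI Pc c)+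
  have "bounded (partial i P ` cball 0 R)"
    by (intro compact_imp_bounded compact_continuous_image continuous_on_subset[OF c]) auto
  then obtain C where C: "\<And>x. x \<in> cball 0 R \<Longrightarrow> \<bar>partial i P x\<bar> \<le> C" unfolding bounded_iff by (metis imageI real_norm_def)
  have CB: "\<bar>partial i P x\<bar> \<le> \<bar>C\<bar>" for x
    using C[of x] partial_zero_outside[where R=R, OF d, of x i] z by (cases "norm x \<le> R") (auto intro: order_trans)
  have lip: "\<bar>P (x + t *\<^sub>R axis i 1) - P x\<bar> \<le> \<bar>C\<bar> * \<bar>t\<bar>" for x t
  proof -
    have "norm (P (x + t *\<^sub>R axis i 1) - P (x + 0 *\<^sub>R axis i 1)) \<le> \<bar>C\<bar> * norm (t - 0)"
      by (rule field_differentiable_bound[where S=UNIV and f="\<lambda>t. P (x + t *\<^sub>R axis i 1)" and f'="\<lambda>t. partial i P (x + t *\<^sub>R axis i 1)"])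
        (auto simp: CB partial_line_derivative[OF d])
    then show ?thesis by simp
  qed
  have PI: "integrable lborel P" by (rule integrable_compact_support[OF Pc z])
  define t where "t n = 1 / real (Suc n)" for n
  have t: "0 < t n" "t n \<le> 1" "t \<longlonglongrightarrow> 0" for n
  proof -
    show "0 < t n" "t n \<le> 1" by (auto simp: t_def)
    show "t \<longlonglongrightarrow> 0" unfolding t_def[abs_def] by real_asymp
  qed
  define Q where "Q n x = (P (x + t n *\<^sub>R axis i 1) - P x) / t n" for n x
  have "(\<lambda>n. \<integral>x. Q n x \<partial>lborel) \<longlonglongrightarrow> (\<integral>x. partial i P x \<partial>lborel)"
  \<comment> \<open>The radius is R + 1 because the step \<open>t n\<close> is at most 1: farther
    out, both the point and its translate lie outside the support.\<close>
  proof (rule integral_dominated_convergence[where w="\<lambda>x. indicator (cball 0 (R + 1)) x *\<^sub>R \<bar>C\<bar>"])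
    show "integrable lborel (\<lambda>x :: real ^ 'd. indicator (cball 0 (R + 1)) x *\<^sub>R \<bar>C\<bar>)"
      by (intro borel_integrable_compact) auto
    show "AE x in lborel. (\<lambda>n. Q n x) \<longlonglongrightarrow> partial i P x"
    proof (rule AE_I2)
      fix x
      have "((\<lambda>h. (P (x + h *\<^sub>R axis i 1) - P x) / h) \<longlongrightarrow> partial i P x) (at 0)"
        using partial_has_real_derivative[OF d[of x], of i] by (simp add: DERIV_def)
      moreover have "filterlim t (at 0) sequentially"
        using t(1,3) by (auto simp: filterlim_at intro!: always_eventually less_imp_neq[THEN not_sym])
      ultimately show "(\<lambda>n. Q n x) \<longlonglongrightarrow> partial i P x"
        unfolding Q_def by (rule filterlim_compose)
    qed
    show "AE x in lborel. norm (Q n x) \<le> indicator (cball 0 (R + 1)) x *\<^sub>R \<bar>C\<bar>" for n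
    proof (rule AE_I2)
      fix x :: "real ^ 'd"
      show "norm (Q n x) \<le> indicator (cball 0 (R + 1)) x *\<^sub>R \<bar>C\<bar>"
      proof (cases "norm x \<le> R + 1")
        case True
        then show ?thesis using lip[of x "t n"] t(1)[of n] by (simp add: Q_def divide_le_eq)
      next
        case False
        have "norm x \<le> norm (x + t n *\<^sub>R axis i 1) + norm (t n *\<^sub>R axis i (1 :: real) :: real ^ 'd)"
          using norm_triangle_ineq4[of "x + t n *\<^sub>R axis i 1" "t n *\<^sub>R axis i 1"] by simp
        also have "norm (t n *\<^sub>R axis i (1 :: real) :: real ^ 'd) \<le> 1" using t(1,2)[of n] by (simp add: norm_axis_1)
        finally have "R < norm (x + t n *\<^sub>R axis i 1)" "R < norm x" using False by auto
        then show ?thesis using z by (simp add: Q_def)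
      qed
    qed
  qed (auto simp: Q_def)
  moreover have "(\<integral>x. Q n x \<partial>lborel) = 0" for n
  proof -
    have s: "integrable lborel (\<lambda>x. P (x + t n *\<^sub>R axis i 1))" "(\<integral>x. P (x + t n *\<^sub>R axis i 1) \<partial>lborel) = (\<integral>x. P x \<partial>lborel)"
      using PI integrable_distr[of "(+) (t n *\<^sub>R axis i 1)" lborel borel P]
        integral_distr[of "(+) (t n *\<^sub>R axis i 1)" lborel borel P]
      by (simp_all add: lborel_distr_plus add.commute)
    then show ?thesis using PI by (simp add: Q_def)
  qed
  ultimately show ?thesis by (simp add: LIMSEQ_const_iff)
qed

lemma test_functionD:
  assumes "\<phi> \<in> test_functions"
  shows "\<phi> differentiable (at x)" "continuous_on UNIV (partial i \<phi>)" "continuous_on UNIV \<phi>" "\<exists>R. \<forall>x. R < norm x \<longrightarrow> \<phi> x = 0"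
proof -
  have "Ck 1 \<phi>" "Ck 0 \<phi>" using assms by (auto simp: test_functions_def)
  then show "\<phi> differentiable (at x)" "continuous_on UNIV (partial i \<phi>)" "continuous_on UNIV \<phi>" by auto
  have "bounded {x. \<phi> x \<noteq> 0}"
    using assms bounded_subset[OF compact_imp_bounded closure_subset] by (auto simp: test_functions_def)
  then show "\<exists>R. \<forall>x. R < norm x \<longrightarrow> \<phi> x = 0" unfolding bounded_iff by (auto simp: not_le[symmetric])
qed

lemma continuous_loc_integrable:
  fixes f :: "real ^ 'd \<Rightarrow> 'b::euclidean_space"
  assumes "continuous_on UNIV f" shows "loc_integrable f"
  unfolding loc_integrable_def set_integrable_def
proof (intro allI impI)
  fix K :: "(real ^ 'd) set" assume K: "compact K"
  have "integrable lborel (\<lambda>x. indicator K x *\<^sub>R f x)"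
    by (intro borel_integrable_compact K continuous_on_subset[OF assms]) auto
  then show "integrable lebesgue (\<lambda>x. indicator K x *\<^sub>R f x)"
    by (subst integrable_completion) auto
qed

text \<open>The product rule for h(x_i) times a test function, whose partial derivatives integrate
  to zero. Functions of one coordinate cover both the cosines in \<open>hcoeff_cos\<close> and the
  nearly extremal densities.\<close>

lemma has_weak_gradient_coord:
  fixes h h' :: "real \<Rightarrow> real" and i :: "'d::finite"
  assumes h: "\<And>t. (h has_real_derivative h' t) (at t)" and c: "continuous_on UNIV h'"
  shows "has_weak_gradient (\<lambda>x. h (x $ i)) (\<lambda>x. h' (x $ i) *\<^sub>R axis i 1 :: real ^ 'd)"
proof -
  have hcont: "continuous_on UNIV h" by (intro continuous_at_imp_continuous_on ballI DERIV_isCont[OF h])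
  have Uc: "continuous_on UNIV (\<lambda>x :: real ^ 'd. h (x $ i))" "continuous_on UNIV (\<lambda>x :: real ^ 'd. h' (x $ i))"
    by (auto intro!: continuous_on_compose2[OF hcont] continuous_on_compose2[OF c] continuous_intros)
  have Ud: "((\<lambda>x :: real ^ 'd. h (x $ i)) has_derivative (\<lambda>v. h' (x $ i) * v $ i)) (at x)" for x
    using has_derivative_compose[OF bounded_linear_imp_has_derivative[OF bounded_linear_vec_nth] h[unfolded has_field_derivative_def], of i x UNIV]
    by simp
  then have Udd: "(\<lambda>x :: real ^ 'd. h (x $ i)) differentiable (at x)" for x unfolding differentiable_def by blast
  have Up: "partial j (\<lambda>x :: real ^ 'd. h (x $ i)) x = h' (x $ i) * axis j 1 $ i" for j x by (rule partial_eq[OF Ud])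
  have a: "axis j (1 :: real) $ i = axis i 1 $ j" for j by (simp add: axis_def)
  show ?thesis
    unfolding has_weak_gradient_def
  proof (intro conjI ballI allI)
    show "loc_integrable (\<lambda>x :: real ^ 'd. h (x $ i))" by (rule continuous_loc_integrable[OF Uc(1)])
    show "loc_integrable (\<lambda>x. h' (x $ i) *\<^sub>R axis i 1 :: real ^ 'd)"
      by (rule continuous_loc_integrable) (intro continuous_intros Uc(2))
    fix \<phi> :: "real ^ 'd \<Rightarrow> real" and j assume t: "\<phi> \<in> test_functions"
    note T = test_functionD[OF t]
    obtain R where R: "\<And>x. R < norm x \<Longrightarrow> \<phi> x = 0" using T(4) by blast
    let ?A = "\<lambda>x :: real ^ 'd. h (x $ i) * partial j \<phi> x" and ?B = "\<lambda>x. (h' (x $ i) *\<^sub>R axis i 1 :: real ^ 'd) $ j * \<phi> x"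
    have p: "partial j (\<lambda>x. h (x $ i) * \<phi> x) = (\<lambda>x. ?B x + ?A x)"
      by (simp add: fun_eq_iff partial_mult[OF Udd T(1)] Up a)
    have cA: "continuous_on UNIV ?A" by (intro continuous_intros Uc T)
    have cB: "continuous_on UNIV ?B" by (intro continuous_intros Uc T)
    have I: "integrable lborel ?A" "integrable lborel ?B"
      by (rule integrable_compact_support[where R=R, OF cA], simp add: partial_zero_outside[where R=R, OF T(1)] R) (rule integrable_compact_support[where R=R, OF cB], simp add: R)
    have "(\<integral>x. ?B x + ?A x \<partial>lborel) = 0"
      unfolding p[symmetric]
    proof (rule integral_partial_zero)
      show "(\<lambda>x. h (x $ i) * \<phi> x) differentiable (at x)" for x by (intro differentiable_mult Udd T)
      show "continuous_on UNIV (partial j (\<lambda>x. h (x $ i) * \<phi> x))" unfolding p by (intro continuous_on_add cA cB)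
    qed (use R in auto)
    then have "(\<integral>x. ?A x \<partial>lborel) = - (\<integral>x. ?B x \<partial>lborel)" using I by simp
    moreover have "?A \<in> borel_measurable lborel" "?B \<in> borel_measurable lborel"
      using I by auto
    ultimately show "(\<integral>x. ?A x \<partial>lebesgue) = - (\<integral>x. ?B x \<partial>lebesgue)" by (simp add: integral_completion)
  qed
qed

section \<open>Uniqueness of weak gradients\<close>

lemma flat_0_bounds: "0 \<le> flat 0 t" "flat 0 t \<le> 1"
  by (auto simp: flat_def)

lemma flat_0_scaled_tendsto: "(\<lambda>k. flat 0 (real (Suc k) * t)) \<longlonglongrightarrow> (if 0 < t then 1 else 0)"
proof (cases "0 < t")
  case True
  have "(\<lambda>k. exp (- inverse (real (Suc k) * t))) \<longlonglongrightarrow> 1" using True by real_asymp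
  then show ?thesis using True by (simp add: flat_def)
next
  case False
  then have "real (Suc k) * t \<le> 0" for k by (intro mult_nonneg_nonpos) auto
  then have "flat 0 (real (Suc k) * t) = 0" for k unfolding flat_def using not_le by auto
  then show ?thesis using False by simp
qed

text \<open>Test functions between 0 and the indicator of an open box, converging to it pointwise:
  as the scale k + 1 grows, \<open>flat 0\<close> of a positive argument tends to 1, while at
  nonpositive arguments it stays 0.\<close>

definition box_bump :: "real ^ 'd \<Rightarrow> real ^ 'd \<Rightarrow> nat \<Rightarrow> real ^ 'd \<Rightarrow> real" where
  "box_bump a b k x = (\<Prod>j\<in>UNIV. flat 0 (real (Suc k) * (x $ j + - (a $ j))) * flat 0 (real (Suc k) * (b $ j + (- 1) * x $ j)))"

lemma box_bump_smooth: "box_bump a b k \<in> smooth_fns"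
  unfolding box_bump_def[abs_def] by (intro smooth_fns_prod smooth_fns.intros) auto

lemma box_bump_bounds: "0 \<le> box_bump a b k x" "box_bump a b k x \<le> 1"
  unfolding box_bump_def by (auto intro!: prod_nonneg prod_le_1 mult_nonneg_nonneg mult_le_one flat_0_bounds)

lemma box_bump_zero: "x \<notin> box a b \<Longrightarrow> box_bump a b k x = 0"
proof -
  assume "x \<notin> box a b"
  then obtain j where j: "x $ j \<le> a $ j \<or> b $ j \<le> x $ j" by (auto simp: mem_box_cart not_less)
  have neg: "flat 0 (real (Suc k) * t) = 0" if "t \<le> 0" for t
    using mult_nonneg_nonpos[OF _ that, of "real (Suc k)"] by (simp add: flat_def not_less del: of_nat_Suc)
  show ?thesis
    unfolding box_bump_def using j neg[of "x $ j + - (a $ j)"] neg[of "b $ j + (- 1) * x $ j"]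
    by (intro prod_zero bexI[of _ j]) auto
qed

lemma box_bump_tendsto: "(\<lambda>k. box_bump a b k x) \<longlonglongrightarrow> indicator (box a b) x"
proof -
  have "(\<lambda>k. box_bump a b k x) \<longlonglongrightarrow> (\<Prod>j\<in>UNIV. (if 0 < x $ j + - (a $ j) then 1 else 0) * (if 0 < b $ j + (- 1) * x $ j then 1 else 0))"
    unfolding box_bump_def by (intro tendsto_intros flat_0_scaled_tendsto)
  moreover have "(\<Prod>j\<in>UNIV. (if 0 < x $ j + - (a $ j) then 1 else 0) * (if 0 < b $ j + (- 1) * x $ j then 1 else 0 :: real))
     = indicator (box a b) x"
  proof (cases "x \<in> box a b")
    case True then show ?thesis by (auto simp: mem_box_cart intro!: prod.neutral)
  next
    case False
    then obtain j where "x $ j \<le> a $ j \<or> b $ j \<le> x $ j" by (auto simp: mem_box_cart not_less)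
    then show ?thesis using False by (intro trans[OF prod_zero]) (auto intro!: bexI[of _ j] exI[of _ j])
  qed
  ultimately show ?thesis by simp
qed

lemma borel_measurable_indicator_lebesgue_box: "(indicator (box a b) :: real ^ 'd \<Rightarrow> real) \<in> borel_measurable lebesgue"
  by (rule measurable_completion) simp

lemma weak_zero_box:
  fixes h :: "real ^ 'd \<Rightarrow> real"
  assumes li: "loc_integrable h" and z: "\<And>\<phi>. \<phi> \<in> test_functions \<Longrightarrow> (\<integral>x. h x * \<phi> x \<partial>lebesgue) = 0"
  shows "(\<integral>x. h x * indicator (box a b) x \<partial>lebesgue) = 0"
proof -
  have hm: "h \<in> borel_measurable lebesgue" by (rule loc_integrable_measurable[OF li])
  have bm: "box_bump a b k \<in> borel_measurable lebesgue" for k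
    by (rule measurable_completion) (simp add: borel_measurable_continuous_onI smooth_fns_continuous box_bump_smooth)
  have "(\<lambda>k. \<integral>x. h x * box_bump a b k x \<partial>lebesgue) \<longlonglongrightarrow> (\<integral>x. h x * indicator (box a b) x \<partial>lebesgue)"
  proof (rule integral_dominated_convergence[where w="\<lambda>x. norm (indicator (cbox a b) x *\<^sub>R h x)"])
    show "integrable lebesgue (\<lambda>x. norm (indicator (cbox a b) x *\<^sub>R h x))"
      using li unfolding loc_integrable_def set_integrable_def by (intro integrable_norm) simp
    show "AE x in lebesgue. (\<lambda>k. h x * box_bump a b k x) \<longlonglongrightarrow> h x * indicator (box a b) x"
      by (intro AE_I2 tendsto_intros box_bump_tendsto)
    show "AE x in lebesgue. norm (h x * box_bump a b k x) \<le> norm (indicator (cbox a b) x *\<^sub>R h x)" for k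
    proof (rule AE_I2)
      fix x
      show "norm (h x * box_bump a b k x) \<le> norm (indicator (cbox a b) x *\<^sub>R h x)"
      proof (cases "x \<in> box a b")
        case True
        then have "x \<in> cbox a b" using box_subset_cbox by blast
        then show ?thesis using box_bump_bounds[of a b k x] by (simp add: abs_mult mult_left_le)
      qed (simp add: box_bump_zero)
    qed
  qed (intro borel_measurable_times hm bm borel_measurable_indicator_lebesgue_box)+
  moreover have "(\<integral>x. h x * box_bump a b k x \<partial>lebesgue) = 0" for k
  proof (rule z, rule smooth_fns_test[OF box_bump_smooth])
    show "bounded {x. box_bump a b k x \<noteq> 0}"
      by (rule bounded_subset[OF bounded_box[of a b]]) (use box_bump_zero in blast)
  qed
  ultimately show ?thesis by (simp add: LIMSEQ_const_iff)
qed

text \<open>The positive and the negative part of p are densities of measures that agree on boxes,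
  an intersection-stable generator. Hence the measures agree, so do the densities almost everywhere,
  and equal positive and negative parts force p = 0.\<close>

lemma integrable_zero_boxes:
  fixes p :: "real ^ 'd \<Rightarrow> real"
  assumes I: "integrable lborel p" and z: "\<And>a b. (\<integral>x. p x * indicator (box a b) x \<partial>lborel) = 0"
  shows "AE x in lborel. p x = 0"
proof -
  have [measurable]: "p \<in> borel_measurable borel" using I by auto
  let ?M = "density lborel (\<lambda>x. ennreal (max 0 (p x)))" and ?N = "density lborel (\<lambda>x. ennreal (max 0 (- p x)))"
  let ?E = "range (\<lambda>(a, b). box a b :: (real ^ 'd) set)"
  have mi: "integrable lborel (\<lambda>x. max 0 (f x) * indicator (box a b) x)" if f: "integrable lborel f" for f :: "real ^ 'd \<Rightarrow> real" and a b
    by (rule integrable_real_mult_indicator) (use f in auto)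
  have em: "emeasure (density lborel (\<lambda>x. ennreal (max 0 (f x)))) (box a b) = ennreal (\<integral>x. max 0 (f x) * indicator (box a b) x \<partial>lborel)"
    if f: "integrable lborel f" for f :: "real ^ 'd \<Rightarrow> real" and a b
  proof -
    have [measurable]: "f \<in> borel_measurable borel" using f by auto
    have "emeasure (density lborel (\<lambda>x. ennreal (max 0 (f x)))) (box a b) = (\<integral>\<^sup>+x. ennreal (max 0 (f x) * indicator (box a b) x) \<partial>lborel)"
      by (subst emeasure_density) (auto intro!: nn_integral_cong simp: indicator_def)
    also have "\<dots> = ennreal (\<integral>x. max 0 (f x) * indicator (box a b) x \<partial>lborel)"
      by (rule nn_integral_eq_integral[OF mi[OF f]]) auto
    finally show ?thesis .
  qed
  have I': "integrable lborel (\<lambda>x. - p x)" using I by simp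
  have "?M = ?N"
  proof (rule measure_eqI_generator_eq)
    show "Int_stable ?E" by (auto simp: Int_stable_def box_Int_box)
    show "?E \<subseteq> Pow UNIV" by simp
    show "sets ?M = sigma_sets UNIV ?E" "sets ?N = sigma_sets UNIV ?E"
      by (simp_all add: borel_eq_box image_def split_beta)
    fix X :: "(real ^ 'd) set" assume "X \<in> ?E"
    then obtain a b where X: "X = box a b" by auto
    have "(\<integral>x. max 0 (p x) * indicator (box a b) x \<partial>lborel) - (\<integral>x. max 0 (- p x) * indicator (box a b) x \<partial>lborel)
      = (\<integral>x. max 0 (p x) * indicator (box a b) x - max 0 (- p x) * indicator (box a b) x \<partial>lborel)"
      by (rule Bochner_Integration.integral_diff[symmetric, OF mi[OF I] mi[OF I']])
    also have "\<dots> = (\<integral>x. p x * indicator (box a b) x \<partial>lborel)"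
      by (intro Bochner_Integration.integral_cong) (auto simp: max_def)
    finally show "emeasure ?M X = emeasure ?N X" unfolding X em[OF I] em[OF I'] using z by simp
  next
    let ?A = "\<lambda>n. box (- (\<chi> j. real n)) (\<chi> j. real n) :: (real ^ 'd) set"
    show "range ?A \<subseteq> ?E" by auto
    show "(\<Union>n. ?A n) = UNIV"
    proof -
      have "\<exists>n. x \<in> ?A n" for x :: "real ^ 'd"
      proof -
        obtain n where "norm x < real n" using reals_Archimedean2 by blast
        then have "\<bar>x $ j\<bar> < real n" for j using component_le_norm_cart[of x j] by (rule order.strict_trans1[rotated])
        then show ?thesis by (intro exI[of _ n]) (auto simp: mem_box_cart abs_less_iff minus_less_iff)
      qed
      then show ?thesis by blast
    qed
    show "emeasure ?M (?A n) \<noteq> \<infinity>" for n unfolding em[OF I] by simp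
  qed
  then have "AE x in lborel. ennreal (max 0 (p x)) = ennreal (max 0 (- p x))"
    by (intro sigma_finite_measure.density_unique[OF sigma_finite_lborel]) auto
  then show ?thesis by eventually_elim (auto simp: max_def split: if_splits)
qed

text \<open>h is only locally integrable, so it is first restricted to the boxes (-n, n)^d; an
  intersection of boxes is a box, hence the integrals of the restriction over boxes vanish
  too.\<close>

lemma weak_zero:
  fixes h :: "real ^ 'd \<Rightarrow> real"
  assumes li: "loc_integrable h" and z: "\<And>\<phi>. \<phi> \<in> test_functions \<Longrightarrow> (\<integral>x. h x * \<phi> x \<partial>lebesgue) = 0"
  shows "AE x in lborel. h x = 0"
proof -
  have hm: "h \<in> borel_measurable lebesgue" by (rule loc_integrable_measurable[OF li])
  obtain h' where h'[measurable]: "h' \<in> borel_measurable borel" and hh: "AE x in lborel. h x = h' x"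
    using completion_ex_borel_measurable_real[OF hm] by auto
  have conv: "(\<integral>x. h x * indicator (box a b) x \<partial>lebesgue) = (\<integral>x. h' x * indicator (box a b) x \<partial>lborel)" for a b
  proof -
    have h'l: "h' \<in> borel_measurable lebesgue" by (rule measurable_completion) simp
    have "(\<integral>x. h x * indicator (box a b) x \<partial>lebesgue) = (\<integral>x. h' x * indicator (box a b) x \<partial>lebesgue)"
      using hh by (intro integral_cong_AE borel_measurable_times hm h'l borel_measurable_indicator_lebesgue_box)
        (auto simp: AE_lebesgue_lborel elim: eventually_mono)
    also have "\<dots> = (\<integral>x. h' x * indicator (box a b) x \<partial>lborel)" by (rule integral_completion) measurable
    finally show ?thesis .
  qed
  have N: "AE x in lborel. h' x * indicator (box (- (\<chi> j. real n)) (\<chi> j. real n)) x = 0" (is "AE x in lborel. h' x * indicator (?A n) x = 0") for n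
  proof (rule integrable_zero_boxes)
    have "integrable lebesgue (\<lambda>x. indicator (cbox (- (\<chi> j. real n)) (\<chi> j. real n)) x *\<^sub>R h x)"
      using li unfolding loc_integrable_def set_integrable_def by simp
    then have "integrable lebesgue (\<lambda>x. indicator (?A n) x *\<^sub>R (indicator (cbox (- (\<chi> j. real n)) (\<chi> j. real n)) x *\<^sub>R h x))"
      by (rule integrable_mult_indicator[rotated]) simp
    moreover have "indicator (?A n) x *\<^sub>R (indicator (cbox (- (\<chi> j. real n)) (\<chi> j. real n)) x *\<^sub>R h x) = h x * indicator (?A n) x" for x
      using box_subset_cbox by (auto simp: indicator_def)
    ultimately have "integrable lebesgue (\<lambda>x. h x * indicator (?A n) x)" by (simp only:)
    moreover have "integrable lebesgue (\<lambda>x. h x * indicator (?A n) x) \<longleftrightarrow> integrable lebesgue (\<lambda>x. h' x * indicator (?A n) x)"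
    proof -
      have h'l: "h' \<in> borel_measurable lebesgue" by (rule measurable_completion) simp
      show ?thesis
        using hh by (intro integrable_cong_AE borel_measurable_times hm h'l borel_measurable_indicator_lebesgue_box)
          (auto simp: AE_lebesgue_lborel elim: eventually_mono)
    qed
    ultimately show "integrable lborel (\<lambda>x. h' x * indicator (?A n) x)" by (simp add: integrable_completion)
    fix a b :: "real ^ 'd"
    obtain c d where cd: "?A n \<inter> box a b = box c d" by (simp add: box_Int_box)
    have "(\<integral>x. h' x * indicator (?A n) x * indicator (box a b) x \<partial>lborel) = (\<integral>x. h' x * indicator (box c d) x \<partial>lborel)"
      unfolding cd[symmetric] by (simp add: indicator_inter_arith mult.assoc)
    also have "\<dots> = 0" using conv[of c d] weak_zero_box[OF li z] by simp
    finally show "(\<integral>x. h' x * indicator (?A n) x * indicator (box a b) x \<partial>lborel) = 0" .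
  qed
  have "AE x in lborel. \<forall>n. h' x * indicator (?A n) x = 0" using N by (subst AE_all_countable) auto
  then show ?thesis using hh
  proof eventually_elim
    case (elim x)
    obtain n where "norm x < real n" using reals_Archimedean2 by blast
    then have "\<bar>x $ j\<bar> < real n" for j using component_le_norm_cart[of x j] by (rule order.strict_trans1[rotated])
    then have "x \<in> ?A n" by (auto simp: mem_box_cart abs_less_iff minus_less_iff)
    then show ?case using elim(1)[rule_format, of n] elim(2) by simp
  qed
qed

text \<open>\<open>fisher\<close> refers to a chosen weak gradient. Computing it for an explicit
  density requires identifying the choice with the classical gradient.\<close>

lemma weak_gradient_unique:
  fixes g1 g2 :: "real ^ 'd \<Rightarrow> real ^ 'd"
  assumes g1: "has_weak_gradient u g1" and g2: "has_weak_gradient u g2"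
  shows "AE x in lborel. g1 x = g2 x"
proof -
  have li: "loc_integrable g1" "loc_integrable g2" using g1 g2 by (auto simp: has_weak_gradient_def)
  have comp: "loc_integrable (\<lambda>x. g x $ i)" if "loc_integrable g" for g :: "real ^ 'd \<Rightarrow> real ^ 'd" and i
    unfolding loc_integrable_def set_integrable_def
  proof (intro allI impI)
    fix K :: "(real ^ 'd) set" assume "compact K"
    then have "integrable lebesgue (\<lambda>x. indicator K x *\<^sub>R g x)" using that by (simp add: loc_integrable_def set_integrable_def)
    from integrable_bounded_linear[OF bounded_linear_vec_nth[of i] this]
    show "integrable lebesgue (\<lambda>x. indicator K x *\<^sub>R g x $ i)" by simp
  qed
  have test: "integrable lebesgue (\<lambda>x. f x * \<phi> x)" if f: "loc_integrable f" and t: "\<phi> \<in> test_functions" for f \<phi> :: "real ^ 'd \<Rightarrow> real"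
  proof -
    note T = test_functionD[OF t]
    obtain R where R: "\<And>x. R < norm x \<Longrightarrow> \<phi> x = 0" using T(4) by blast
    have "bounded (\<phi> ` cball 0 R)"
      by (intro compact_imp_bounded compact_continuous_image continuous_on_subset[OF T(3)]) auto
    then obtain C where C: "\<And>x. x \<in> cball 0 R \<Longrightarrow> \<bar>\<phi> x\<bar> \<le> C" unfolding bounded_iff by (metis imageI real_norm_def)
    have I: "integrable lebesgue (\<lambda>x. C *\<^sub>R (indicator (cball 0 R) x *\<^sub>R f x))"
      using f by (intro integrable_scaleR_right) (simp add: loc_integrable_def set_integrable_def)
    have [measurable]: "\<phi> \<in> borel_measurable lebesgue"
      by (rule measurable_completion) (simp add: borel_measurable_continuous_onI T(3))
    have [measurable]: "f \<in> borel_measurable lebesgue" by (rule loc_integrable_measurable[OF f])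
    show ?thesis
    proof (rule Bochner_Integration.integrable_bound[OF I])
      show "AE x in lebesgue. norm (f x * \<phi> x) \<le> norm (C *\<^sub>R (indicator (cball 0 R) x *\<^sub>R f x))"
      proof (rule AE_I2)
        fix x
        show "norm (f x * \<phi> x) \<le> norm (C *\<^sub>R (indicator (cball 0 R) x *\<^sub>R f x))"
        proof (cases "norm x \<le> R")
          case True
          then have "\<bar>\<phi> x\<bar> \<le> \<bar>C\<bar>" using C[of x] by auto
          then show ?thesis using True by (simp add: abs_mult mult.commute mult_right_mono)
        qed (use R in simp)
      qed
    qed measurable
  qed
  have "AE x in lborel. g1 x $ i - g2 x $ i = 0" for i
  proof (rule weak_zero)
    show "loc_integrable (\<lambda>x. g1 x $ i - g2 x $ i)"
      unfolding loc_integrable_def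
    proof (intro allI impI)
      fix K :: "(real ^ 'd) set" assume "compact K"
      then have "set_integrable lebesgue K (\<lambda>x. g1 x $ i)" "set_integrable lebesgue K (\<lambda>x. g2 x $ i)"
        using comp[OF li(1), of i] comp[OF li(2), of i] by (simp_all add: loc_integrable_def)
      then show "set_integrable lebesgue K (\<lambda>x. g1 x $ i - g2 x $ i)" by (rule set_integral_diff(1))
    qed
    fix \<phi> :: "real ^ 'd \<Rightarrow> real" assume t: "\<phi> \<in> test_functions"
    have "(\<integral>x. g1 x $ i * \<phi> x \<partial>lebesgue) = (\<integral>x. g2 x $ i * \<phi> x \<partial>lebesgue)"
    proof -
      have "- (\<integral>x. g1 x $ i * \<phi> x \<partial>lebesgue) = (\<integral>x. u x * partial i \<phi> x \<partial>lebesgue)"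
        using g1 t by (simp add: has_weak_gradient_def)
      also have "\<dots> = - (\<integral>x. g2 x $ i * \<phi> x \<partial>lebesgue)"
        using g2 t by (simp add: has_weak_gradient_def)
      finally show ?thesis by simp
    qed
    then show "(\<integral>x. (g1 x $ i - g2 x $ i) * \<phi> x \<partial>lebesgue) = 0"
      using test[OF comp[OF li(1)] t, of i] test[OF comp[OF li(2)] t, of i] by (simp add: left_diff_distrib)
  qed
  then have "AE x in lborel. \<forall>i\<in>UNIV. g1 x $ i - g2 x $ i = 0" by (intro AE_finite_allI) auto
  then show ?thesis by eventually_elim (simp add: vec_eq_iff)
qed

lemma fisher_coord:
  fixes w :: "real ^ 'd \<Rightarrow> real" and h h' :: "real \<Rightarrow> real" and i :: "'d"
  assumes w: "\<And>x. sqrt (w x) = h (x $ i)"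
    and h: "\<And>t. (h has_real_derivative h' t) (at t)" and c: "continuous_on UNIV h'"
  shows "fisher w = 4 * (\<integral>\<^sup>+x. ennreal ((h' (x $ i))\<^sup>2) \<partial>gam)"
proof -
  let ?u = "\<lambda>x. sqrt (w x)"
  have hg: "has_weak_gradient ?u (\<lambda>x. h' (x $ i) *\<^sub>R axis i 1)" unfolding w by (rule has_weak_gradient_coord[OF h c])
  then have ex: "\<exists>g. has_weak_gradient ?u g" by blast
  have [measurable]: "h' \<in> borel_measurable borel" by (rule borel_measurable_continuous_onI[OF c])
  have "AE x in lborel. weak_gradient ?u x = h' (x $ i) *\<^sub>R axis i 1"
    unfolding weak_gradient_def by (rule weak_gradient_unique[OF someI_ex[OF ex] hg])
  then have "(\<integral>\<^sup>+ x. ennreal ((norm (weak_gradient ?u x))\<^sup>2) \<partial>gauss) = (\<integral>\<^sup>+x. ennreal ((h' (x $ i))\<^sup>2) \<partial>gam)"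
    by (intro gauss_nn_integral) (auto elim!: eventually_mono simp: norm_axis_1)
  then show ?thesis using ex by (simp add: fisher_def)
qed

section \<open>Optimality\<close>

text \<open>The weights of the \<open>n\<close>-th finite difference.\<close>

definition diff_weight :: "nat \<Rightarrow> nat \<Rightarrow> real" where
  "diff_weight n j = (- 1) ^ (n - j) * real (n choose j)"

text \<open>The weights are the coefficients in (e^X - 1)^n = sum of \<open>diff_weight n j\<close>
  e^(jX), and this power series starts with X^n. Comparing coefficients up to degree n gives both
  claims.\<close>

lemma
  shows diff_weight_moment_zero: "m < n \<Longrightarrow> (\<Sum>j\<le>n. diff_weight n j * real j ^ m) = 0"
    and diff_weight_moment_same: "(\<Sum>j\<le>n. diff_weight n j * real j ^ n) = fact n"
proof -
  let ?E = "fps_exp (1 :: real) - 1"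
  have "?E ^ n = (\<Sum>j\<le>n. of_nat (n choose j) * fps_exp 1 ^ j * (- 1) ^ (n - j))"
    using binomial_ring[of "fps_exp (1 :: real)" "- 1" n] by simp
  also have "\<dots> = (\<Sum>j\<le>n. fps_const (diff_weight n j) * fps_exp (real j))"
  proof (rule sum.cong)
    fix j assume "j \<in> {..n}"
    have "fps_const ((- 1) ^ k :: real) = (- 1) ^ k" for k by (simp flip: fps_const_power)
    then show "of_nat (n choose j) * fps_exp 1 ^ j * (- 1) ^ (n - j) = fps_const (diff_weight n j) * fps_exp (real j)"
      by (simp add: diff_weight_def fps_exp_power_mult fps_of_nat mult_ac flip: fps_const_mult)
  qed simp
  finally have c: "fps_nth (?E ^ n) m = (\<Sum>j\<le>n. diff_weight n j * real j ^ m) / fact m" for m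
    by (simp add: fps_sum_nth sum_divide_distrib)
  have z: "fps_nth ?E 0 = 0" "fps_nth ?E 1 = 1" by auto
  show "(\<Sum>j\<le>n. diff_weight n j * real j ^ m) = 0" if "m < n" for m
    using c[of m] startsby_zero_power_prefix[OF z(1)] that by auto
  show "(\<Sum>j\<le>n. diff_weight n j * real j ^ n) = fact n"
    using c[of n] startsby_zero_power_nth_same[OF z(1), of n] z(2) by (simp add: field_simps)
qed

section \<open>Hermite coefficients of trigonometric sums\<close>

lemma
  shows N01_integrable_cos: "integrable N01 (\<lambda>t. cos (a * t + c))"
    and N01_integral_cos: "(\<integral>t. cos (a * t + c) \<partial>N01) = cos c * exp (- a\<^sup>2 / 2)"
proof -
  have e: "cos (a * t + c) = Re (exp (\<i> * of_real c) * exp ((\<i> * of_real a) * complex_of_real t))" for t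
    by (simp add: exp_add[symmetric] Re_exp add.commute)
  have I: "integrable N01 (\<lambda>t. exp (\<i> * of_real c) * exp ((\<i> * of_real a) * complex_of_real t))"
    by (intro integrable_mult_right N01_integrable_exp)
  show "integrable N01 (\<lambda>t. cos (a * t + c))"
    unfolding e by (rule integrable_Re[OF I])
  have "(\<integral>t. cos (a * t + c) \<partial>N01) = Re (exp (\<i> * of_real c) * exp ((\<i> * of_real a)\<^sup>2 / 2))"
    unfolding e integral_Re[OF I] integral_mult_right_zero N01_integral_exp ..
  also have "(\<i> * of_real a)\<^sup>2 / 2 = complex_of_real (- a\<^sup>2 / 2)" by (simp add: power_mult_distrib)
  finally show "(\<integral>t. cos (a * t + c) \<partial>N01) = cos c * exp (- a\<^sup>2 / 2)"
    by (simp add: Re_exp exp_of_real del: of_real_minus of_real_divide of_real_power)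
qed

lemma
  fixes F :: "real \<Rightarrow> real" and i :: "'d::finite"
  assumes F: "integrable N01 F"
  shows gam_integrable_coord: "integrable (gam :: (real ^ 'd) measure) (\<lambda>x. F (x $ i))"
    and gam_integral_coord: "(\<integral>x. F (x $ i) \<partial>(gam :: (real ^ 'd) measure)) = (\<integral>t. F t \<partial>N01)"
proof -
  let ?G = "\<lambda>j. if j = i then F else (\<lambda>_. 1)"
  have G: "integrable N01 (?G j)" for j using F by auto
  have e: "(\<Prod>j\<in>UNIV. ?G j (x $ j)) = F (x $ i)" for x :: "real ^ 'd"
    using prod.delta[of UNIV i "\<lambda>j. F (x $ j)"] by (simp add: if_distribR)
  have "(\<integral>t. ?G j t \<partial>N01) = (if j = i then \<integral>t. F t \<partial>N01 else 1)" for j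
    using N01.prob_space by simp
  then have v: "(\<Prod>j\<in>UNIV. \<integral>t. ?G j t \<partial>N01) = (\<integral>t. F t \<partial>N01)"
    using prod.delta[of UNIV i "\<lambda>j. \<integral>t. F t \<partial>N01"] by simp
  show "integrable (gam :: (real ^ 'd) measure) (\<lambda>x. F (x $ i))"
    using gam_integrable_prod[of ?G, OF G] by (simp only: e)
  show "(\<integral>x. F (x $ i) \<partial>(gam :: (real ^ 'd) measure)) = (\<integral>t. F t \<partial>N01)"
    using gam_integral_prod[of ?G, OF G] by (simp only: e v)
qed

text \<open>Each letter of the word is one derivative. A derivative in x_i multiplies by a and
  advances the phase by pi/2, one in any other coordinate gives 0; hence the induction over the word
  with arbitrary phase.\<close>

lemma hcoeff_cos:
  fixes i :: "'d::finite"
  shows "hcoeff (\<lambda>x. cos (a * x $ i + c)) l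
    = (if set l \<subseteq> {i} then a ^ length l * (cos (c + real (length l) * (pi / 2)) * exp (- a\<^sup>2 / 2)) else 0)"
proof (induction l arbitrary: c)
  case Nil
  show ?case
    using gam_integral_coord[OF N01_integrable_cos[of a c], of i] by (simp add: hcoeff_def He_def N01_integral_cos)
next
  case (Cons k l)
  let ?u = "\<lambda>x :: real ^ 'd. cos (a * x $ i + c)" and ?h' = "\<lambda>t. - a * sin (a * t + c)"
  let ?g = "\<lambda>x :: real ^ 'd. ?h' (x $ i) *\<^sub>R axis i (1 :: real) :: real ^ 'd"
  have w: "has_weak_gradient ?u ?g"
    by (rule has_weak_gradient_coord) (auto intro!: derivative_eq_intros continuous_intros)
  have um: "?u \<in> borel_measurable borel" by measurable
  have gm: "?g \<in> borel_measurable borel" by measurable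
  have "integrable gam (\<lambda>x. (norm (?g x))\<^sup>2)"
  proof (rule gam.integrable_const_bound[where B="a\<^sup>2"])
    have "a\<^sup>2 * (sin y)\<^sup>2 \<le> a\<^sup>2" for y
      using mult_left_mono[of "(sin y)\<^sup>2" 1 "a\<^sup>2"] by (simp add: abs_square_le_1)
    then show "AE x in gam. norm ((norm (?g x))\<^sup>2) \<le> a\<^sup>2"
      by (intro AE_I2) (simp add: norm_axis_1 abs_mult power_mult_distrib)
  qed (use gm in measurable)
  then have "grad_coeffs ?u ?g"
    by (rule grad_coeffs_weak[OF w um gm _ _ abs_cos_le_one, rotated 2]) auto
  then have r: "hcoeff ?u (k # l) = hcoeff (\<lambda>x. ?g x $ k) l" by (simp add: grad_coeffs_def)
  show ?case
  proof (cases "k = i")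
    case False
    then have "hcoeff ?u (k # l) = 0" unfolding r by (simp add: hcoeff_def axis_def)
    then show ?thesis using False by simp
  next
    case True
    have "(\<lambda>x. ?g x $ k) = (\<lambda>x. a * cos (a * x $ i + (c + pi / 2)))"
      using True by (simp add: fun_eq_iff axis_def cos_add sin_add algebra_simps)
    then have "hcoeff ?u (k # l) = a * hcoeff (\<lambda>x. cos (a * x $ i + (c + pi / 2))) l"
      unfolding r by (simp add: hcoeff_def mult.assoc)
    then show ?thesis using True unfolding Cons by (simp add: algebra_simps add_divide_distrib)
  qed
qed

text \<open>A bounded substitute for \<open>h\<^sub>n\<close>: the \<open>n\<close>-th finite difference in \<open>s\<close> of the generating function
  \<open>exp(\<i> s x + s\<^sup>2 / 2)\<close>, rotated so that its degree \<open>n\<close> part is real.\<close>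

definition trig :: "nat \<Rightarrow> real \<Rightarrow> real \<Rightarrow> real" where
  "trig n \<tau> x = (\<Sum>j\<le>n. diff_weight n j * exp ((real j * \<tau>)\<^sup>2 / 2) * cos (real j * \<tau> * x + - (real n * (pi / 2))))"

definition trig' :: "nat \<Rightarrow> real \<Rightarrow> real \<Rightarrow> real" where
  "trig' n \<tau> x = (\<Sum>j\<le>n. diff_weight n j * exp ((real j * \<tau>)\<^sup>2 / 2) * (- (real j * \<tau>) * sin (real j * \<tau> * x + - (real n * (pi / 2)))))"

lemma trig_deriv: "(trig n \<tau> has_real_derivative trig' n \<tau> x) (at x)"
  unfolding trig_def[abs_def] trig'_def by (intro DERIV_sum) (auto intro!: derivative_eq_intros)

lemma trig_continuous: "continuous_on UNIV (trig n \<tau>)" "continuous_on UNIV (trig' n \<tau>)"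
  unfolding trig_def[abs_def] trig'_def[abs_def] by (intro continuous_intros)+

lemma trig_measurable[measurable]: "trig n \<tau> \<in> borel_measurable borel" "trig' n \<tau> \<in> borel_measurable borel"
  by (intro borel_measurable_continuous_onI trig_continuous)+

text \<open>A common sup bound for the sum and its derivative; the summand 1 makes it safe to divide
  by.\<close>

definition trig_bound :: "nat \<Rightarrow> real \<Rightarrow> real" where
  "trig_bound n \<tau> = 1 + (\<Sum>j\<le>n. \<bar>diff_weight n j\<bar> * exp ((real j * \<tau>)\<^sup>2 / 2) * (1 + real j * \<bar>\<tau>\<bar>))"

lemma trig_bounds: "\<bar>trig n \<tau> x\<bar> \<le> trig_bound n \<tau>" "\<bar>trig' n \<tau> x\<bar> \<le> trig_bound n \<tau>" "1 \<le> trig_bound n \<tau>"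
proof -
  have c: "\<bar>a * b * cos y\<bar> \<le> \<bar>a\<bar> * \<bar>b\<bar> * (1 + z)" if "0 \<le> z" for a b y z :: real
    unfolding abs_mult using that abs_cos_le_one[of y] by (intro mult_left_mono) (linarith | simp)+
  have s: "\<bar>a * b * (- z * sin y)\<bar> \<le> \<bar>a\<bar> * \<bar>b\<bar> * (1 + \<bar>z\<bar>)" for a b y z :: real
  proof -
    have "\<bar>z\<bar> * \<bar>sin y\<bar> \<le> \<bar>z\<bar> * 1" by (intro mult_left_mono) auto
    then show ?thesis unfolding abs_mult by (intro mult_left_mono) auto
  qed
  have "\<bar>trig n \<tau> x\<bar> \<le> (\<Sum>j\<le>n. \<bar>diff_weight n j\<bar> * exp ((real j * \<tau>)\<^sup>2 / 2) * (1 + real j * \<bar>\<tau>\<bar>))"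
    unfolding trig_def using c[of "real _ * \<bar>\<tau>\<bar>" _ "exp _"] by (intro order_trans[OF sum_abs] sum_mono) simp
  then show "\<bar>trig n \<tau> x\<bar> \<le> trig_bound n \<tau>" by (simp add: trig_bound_def)
  have "\<bar>trig' n \<tau> x\<bar> \<le> (\<Sum>j\<le>n. \<bar>diff_weight n j\<bar> * exp ((real j * \<tau>)\<^sup>2 / 2) * (1 + real j * \<bar>\<tau>\<bar>))"
    unfolding trig'_def using s[of _ "exp _" "real _ * \<tau>"] by (intro order_trans[OF sum_abs] sum_mono) (simp add: abs_mult)
  then show "\<bar>trig' n \<tau> x\<bar> \<le> trig_bound n \<tau>" by (simp add: trig_bound_def)
  show "1 \<le> trig_bound n \<tau>" unfolding trig_bound_def by (simp add: sum_nonneg)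
qed

text \<open>The weights exp((j tau)^2/2) cancel the Gaussian decay of the cosine coefficients and
  leave pure moments of \<open>diff_weight\<close>. These vanish in degrees below n, and the phase
  -n pi/2 makes the cosine equal to 1 in degree n.\<close>

lemma hcoeff_trig:
  fixes i :: "'d::finite"
  shows "hcoeff (\<lambda>x. trig n \<tau> (x $ i)) l
    = (if set l \<subseteq> {i} then \<tau> ^ length l * cos ((real (length l) - real n) * (pi / 2)) * (\<Sum>j\<le>n. diff_weight n j * real j ^ length l) else 0)"
proof -
  let ?c = "\<lambda>j x :: real ^ 'd. cos (real j * \<tau> * x $ i + - (real n * (pi / 2)))"
  have I: "integrable gam (\<lambda>x. ?c j x * He l x)" for j
    by (rule integrable_bounded_mult_He[OF _ abs_cos_le_one]) measurable
  have "hcoeff (\<lambda>x. trig n \<tau> (x $ i)) l = (\<integral>x. (\<Sum>j\<le>n. diff_weight n j * exp ((real j * \<tau>)\<^sup>2 / 2) * (?c j x * He l x)) \<partial>gam)"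
    by (simp add: hcoeff_def trig_def sum_distrib_right mult.assoc)
  also have "\<dots> = (\<Sum>j\<le>n. diff_weight n j * exp ((real j * \<tau>)\<^sup>2 / 2) * hcoeff (?c j) l)"
    using I by (subst Bochner_Integration.integral_sum) (auto simp: hcoeff_def intro!: integrable_mult_right)
  also have "\<dots> = (if set l \<subseteq> {i} then \<tau> ^ length l * cos ((real (length l) - real n) * (pi / 2)) * (\<Sum>j\<le>n. diff_weight n j * real j ^ length l) else 0)"
  proof (cases "set l \<subseteq> {i}")
    case True
    have "exp ((real j * \<tau>)\<^sup>2 / 2) * exp (- (real j * \<tau>)\<^sup>2 / 2) = 1" for j by (simp flip: exp_add)
    then have eq1: "diff_weight n j * exp ((real j * \<tau>)\<^sup>2 / 2) * ((real j * \<tau>) ^ length l * (C * exp (- (real j * \<tau>)\<^sup>2 / 2)))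
      = \<tau> ^ length l * C * (diff_weight n j * real j ^ length l)" for j C
      by (simp add: power_mult_distrib mult_ac)
    have eq2: "- (real n * (pi / 2)) + real (length l) * (pi / 2) = (real (length l) - real n) * (pi / 2)"
      by (simp add: algebra_simps)
    show ?thesis unfolding hcoeff_cos if_P[OF True] eq2 eq1 sum_distrib_left ..
  next
    case False
    then show ?thesis unfolding hcoeff_cos if_not_P[OF False] by simp
  qed
  finally show ?thesis .
qed

text \<open>Bessel's inequality in dimension one, keeping only the word of length n. Its coefficient
  is tau^n n!, which is squared and divided by n!.\<close>

lemma N01_trig_sq_ge: "\<tau> ^ (2 * n) * fact n \<le> (\<integral>x. (trig n \<tau> x)\<^sup>2 \<partial>N01)"
proof -
  define i :: "1" where "i = undefined"
  let ?F = "\<lambda>x :: real ^ 1. trig n \<tau> (x $ i)"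
  have sq: "integrable N01 (\<lambda>t. (trig n \<tau> t)\<^sup>2)"
    by (rule N01.integrable_const_bound[where B="(trig_bound n \<tau>)\<^sup>2"]) (use abs_square_le[OF trig_bounds(1)] in auto)
  have "set (replicate n i) \<subseteq> {i}" by auto
  then have "\<tau> ^ (2 * n) * fact n = (hcoeff ?F (replicate n i))\<^sup>2 / fact n"
    by (simp add: hcoeff_trig diff_weight_moment_same power_mult_distrib power2_eq_square power_add mult_2)
  also have "\<dots> \<le> hlevel ?F n"
    unfolding hlevel_def by (intro divide_right_mono member_le_sum) (auto simp: finite_lists_length)
  also have "\<dots> \<le> (\<Sum>m<Suc n. hlevel ?F m)" by (intro member_le_sum) (auto simp: hlevel_nonneg)
  also have "\<dots> \<le> (\<integral>x. (?F x)\<^sup>2 \<partial>gam)"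
    by (rule hlevel_bessel) (measurable, rule gam_integrable_coord[OF sq])
  also have "\<dots> = (\<integral>x. (trig n \<tau> x)\<^sup>2 \<partial>N01)" by (rule gam_integral_coord[OF sq])
  finally show ?thesis .
qed

text \<open>The coefficients of the energy of \<open>trig n \<tau>\<close> as a power series in \<open>\<tau>\<^sup>2\<close>.\<close>

definition energy_coeff :: "nat \<Rightarrow> nat \<Rightarrow> real" where
  "energy_coeff n m = (\<Sum>j\<le>n. diff_weight n j * real j ^ Suc m)\<^sup>2 * (1 - (- 1) ^ n * (- 1) ^ m) / (2 * fact m)"

text \<open>Products of sines become cosines, whose Gaussian means combine with the weights to
  exp(\<plusminus> j k tau^2); the sign (-1)^n comes from cos(n pi). Expanding in powers of j k
  tau^2 factorises the double sum into the square of a moment.\<close>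

lemma N01_trig'_sq: "(\<lambda>m. \<tau> ^ (2 * Suc m) * energy_coeff n m) sums (\<integral>x. (trig' n \<tau> x)\<^sup>2 \<partial>N01)"
proof -
  let ?\<theta> = "real n * (pi / 2)" and ?s = "(- 1 :: real) ^ n"
  let ?a = "\<lambda>j. diff_weight n j * exp ((real j * \<tau>)\<^sup>2 / 2) * (real j * \<tau>)"
  let ?S = "\<lambda>j x. sin (real j * \<tau> * x + - ?\<theta>)"
  have prod: "?S j x * ?S k x = (cos ((real j - real k) * \<tau> * x + 0) - cos ((real j + real k) * \<tau> * x + - (real n * pi))) / 2" for j k x
  proof -
    have "?S j x * ?S k x = (cos ((real j * \<tau> * x + - ?\<theta>) - (real k * \<tau> * x + - ?\<theta>)) - cos ((real j * \<tau> * x + - ?\<theta>) + (real k * \<tau> * x + - ?\<theta>))) / 2"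
      by (rule sin_times_sin)
    moreover have "(real j * \<tau> * x + - ?\<theta>) - (real k * \<tau> * x + - ?\<theta>) = (real j - real k) * \<tau> * x + 0"
      by (simp add: algebra_simps)
    moreover have "(real j * \<tau> * x + - ?\<theta>) + (real k * \<tau> * x + - ?\<theta>) = (real j + real k) * \<tau> * x + - (real n * pi)"
      by (simp add: algebra_simps)
    ultimately show ?thesis by (simp only:)
  qed
  have I: "integrable N01 (\<lambda>x. ?S j x * ?S k x)" for j k
    unfolding prod by (intro integrable_divide_zero Bochner_Integration.integrable_diff N01_integrable_cos)
  have V: "(\<integral>x. ?S j x * ?S k x \<partial>N01) = (exp (- ((real j - real k) * \<tau>)\<^sup>2 / 2) - ?s * exp (- ((real j + real k) * \<tau>)\<^sup>2 / 2)) / 2" for j k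
    unfolding prod integral_divide_zero Bochner_Integration.integral_diff[OF N01_integrable_cos N01_integrable_cos] N01_integral_cos
    by (simp add: cos_npi)
  have e: "exp ((real j * \<tau>)\<^sup>2 / 2) * exp ((real k * \<tau>)\<^sup>2 / 2) * exp (- ((real j - real k) * \<tau>)\<^sup>2 / 2) = exp (real j * real k * \<tau>\<^sup>2)"
    "exp ((real j * \<tau>)\<^sup>2 / 2) * exp ((real k * \<tau>)\<^sup>2 / 2) * exp (- ((real j + real k) * \<tau>)\<^sup>2 / 2) = exp (- (real j * real k * \<tau>\<^sup>2))" for j k
    unfolding exp_add[symmetric] by (rule arg_cong[of _ _ exp], simp add: power2_eq_square field_simps)+
  have T: "?a j * ?a k * (\<integral>x. ?S j x * ?S k x \<partial>N01)
    = diff_weight n j * diff_weight n k * ((real j * real k * \<tau>\<^sup>2) * (exp (real j * real k * \<tau>\<^sup>2) - ?s * exp (- (real j * real k * \<tau>\<^sup>2))) / 2)" for j k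
    unfolding V e[symmetric] by (simp add: power2_eq_square algebra_simps)
  have sq: "(trig' n \<tau> x)\<^sup>2 = (\<Sum>j\<le>n. \<Sum>k\<le>n. ?a j * ?a k * (?S j x * ?S k x))" for x
    unfolding power2_eq_square trig'_def sum_product by (intro sum.cong refl) (simp add: algebra_simps)
  have D: "(\<integral>x. (trig' n \<tau> x)\<^sup>2 \<partial>N01) = (\<Sum>j\<le>n. \<Sum>k\<le>n. ?a j * ?a k * (\<integral>x. ?S j x * ?S k x \<partial>N01))"
    unfolding sq using I
    by (subst Bochner_Integration.integral_sum, intro Bochner_Integration.integrable_sum integrable_mult_right)
      (auto intro!: sum.cong simp: Bochner_Integration.integral_sum)
  have ser: "(\<lambda>m. y ^ Suc m * (1 - ?s * (- 1) ^ m) / (2 * fact m)) sums (y * (exp y - ?s * exp (- y)) / 2)" for y :: real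
  proof -
    have "(\<lambda>m. y / 2 * (y ^ m /\<^sub>R fact m - ?s * ((- y) ^ m /\<^sub>R fact m))) sums (y / 2 * (exp y - ?s * exp (- y)))"
      by (intro sums_mult sums_diff exp_converges)
    moreover have "y / 2 * (y ^ m /\<^sub>R fact m - ?s * ((- y) ^ m /\<^sub>R fact m)) = y ^ Suc m * (1 - ?s * (- 1) ^ m) / (2 * fact m)" for m
      unfolding power_minus[of y m] by (simp add: field_simps)
    ultimately show ?thesis by (simp only: times_divide_eq_left)
  qed
  have "(\<lambda>m. \<Sum>j\<le>n. \<Sum>k\<le>n. diff_weight n j * diff_weight n k * ((real j * real k * \<tau>\<^sup>2) ^ Suc m * (1 - ?s * (- 1) ^ m) / (2 * fact m))) sums (\<integral>x. (trig' n \<tau> x)\<^sup>2 \<partial>N01)"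
    unfolding D T by (intro sums_sum sums_mult ser)
  moreover have "(\<Sum>j\<le>n. \<Sum>k\<le>n. diff_weight n j * diff_weight n k * ((real j * real k * \<tau>\<^sup>2) ^ Suc m * (1 - ?s * (- 1) ^ m) / (2 * fact m)))
    = \<tau> ^ (2 * Suc m) * energy_coeff n m" for m
  proof -
    have p: "(real j * real k * \<tau>\<^sup>2) ^ Suc m = real j ^ Suc m * real k ^ Suc m * \<tau> ^ (2 * Suc m)" for j k
      by (simp only: power_mult_distrib power_mult)
    let ?c = "\<tau> ^ (2 * Suc m) * (1 - ?s * (- 1) ^ m) / (2 * fact m)"
    have "\<tau> ^ (2 * Suc m) * energy_coeff n m = ?c * ((\<Sum>j\<le>n. diff_weight n j * real j ^ Suc m) * (\<Sum>k\<le>n. diff_weight n k * real k ^ Suc m))"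
      by (simp add: energy_coeff_def power2_eq_square)
    also have "\<dots> = (\<Sum>j\<le>n. \<Sum>k\<le>n. ?c * ((diff_weight n j * real j ^ Suc m) * (diff_weight n k * real k ^ Suc m)))"
      unfolding sum_product unfolding sum_distrib_left ..
    also have "\<dots> = (\<Sum>j\<le>n. \<Sum>k\<le>n. diff_weight n j * diff_weight n k * ((real j * real k * \<tau>\<^sup>2) ^ Suc m * (1 - ?s * (- 1) ^ m) / (2 * fact m)))"
      unfolding p by (intro sum.cong refl) (simp only: times_divide_eq_left times_divide_eq_right mult_ac)
    finally show ?thesis ..
  qed
  ultimately show ?thesis by simp
qed

lemma energy_coeff_below: "Suc m < n \<Longrightarrow> energy_coeff n m = 0"
  by (simp only: energy_coeff_def diff_weight_moment_zero) simp

lemma energy_coeff_top: "energy_coeff (Suc k) k = real (Suc k) * fact (Suc k)"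
proof -
  have "(- 1 :: real) ^ Suc k * (- 1) ^ k = - 1" by (simp flip: power_mult_distrib)
  then have "energy_coeff (Suc k) k = (fact (Suc k))\<^sup>2 / fact k"
    unfolding energy_coeff_def diff_weight_moment_same by simp
  also have "\<dots> = real (Suc k) * fact (Suc k)"
    by (simp add: power2_eq_square del: of_nat_Suc)
  finally show ?thesis .
qed

text \<open>As \<open>\<tau> \<rightarrow> 0\<close> the Rayleigh quotient of \<open>trig n \<tau>\<close> tends to that of \<open>h\<^sub>n\<close>, which is \<open>n\<close>.\<close>

lemma trig_rayleigh:
  assumes n: "n \<ge> 1" and c: "0 \<le> c" "c < 1 / real n"
  obtains \<tau> where "c * (\<integral>x. (trig' n \<tau> x)\<^sup>2 \<partial>N01) < (\<integral>x. (trig n \<tau> x)\<^sup>2 \<partial>N01)"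
proof -
  obtain k where k: "n = Suc k" using n by (cases n) auto
  define D where "D \<tau> = (\<integral>x. (trig' n \<tau> x)\<^sup>2 \<partial>N01)" for \<tau>
  \<comment> \<open>Energies below index k = n - 1 vanish, so dividing by tau^(2n) leaves a power
    series in tau^2 with constant term n n!; the index lags the degree by one because a derivative
    is taken.\<close>
  have s: "(\<lambda>m. energy_coeff n (m + k) * (\<tau>\<^sup>2) ^ m) sums (D \<tau> / \<tau> ^ (2 * n))" if "\<tau> \<noteq> 0" for \<tau>
  proof -
    have "(\<lambda>m. \<tau> ^ (2 * Suc (m + k)) * energy_coeff n (m + k)) sums (D \<tau> - (\<Sum>m<k. \<tau> ^ (2 * Suc m) * energy_coeff n m))"
      unfolding D_def by (rule sums_split_initial_segment[OF N01_trig'_sq])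
    moreover have "(\<Sum>m<k. \<tau> ^ (2 * Suc m) * energy_coeff n m) = 0"
      by (intro sum.neutral) (simp add: energy_coeff_below k)
    ultimately have "(\<lambda>m. \<tau> ^ (2 * Suc (m + k)) * energy_coeff n (m + k) / \<tau> ^ (2 * n)) sums (D \<tau> / \<tau> ^ (2 * n))"
      by (intro sums_divide) simp
    moreover have "\<tau> ^ (2 * Suc (m + k)) * energy_coeff n (m + k) / \<tau> ^ (2 * n) = energy_coeff n (m + k) * (\<tau>\<^sup>2) ^ m" for m
    proof -
      have "\<tau> ^ (2 * Suc (m + k)) = \<tau> ^ (2 * n) * (\<tau>\<^sup>2) ^ m"
        unfolding power_mult[symmetric] power_add[symmetric] k by (simp add: algebra_simps)
      then show ?thesis using that by simp
    qed
    ultimately show ?thesis by simp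
  qed
  define R where "R x = (\<Sum>m. energy_coeff n (m + k) * x ^ m)" for x :: real
  \<comment> \<open>Convergence at tau = 1 gives radius of convergence at least 1, and with it
    continuity of the series at 0.\<close>
  have sm: "summable (\<lambda>m. energy_coeff n (m + k) * x ^ m)" if "norm x < 1" for x :: real
  proof (rule powser_inside)
    show "norm x < norm (1 :: real)" using that by simp
    show "summable (\<lambda>m. energy_coeff n (m + k) * 1 ^ m)" using s[of 1] by (simp add: sums_iff)
  qed
  then have "(R \<longlongrightarrow> energy_coeff n (0 + k)) (at 0)"
    unfolding R_def by (intro powser_limit_0[of 1 "\<lambda>m. energy_coeff n (m + k)"]) (auto intro: summable_sums)
  then have "((\<lambda>x. c * R x) \<longlongrightarrow> c * (real n * fact n)) (at 0)"
    using energy_coeff_top[of k] by (intro tendsto_intros) (simp add: k)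
  moreover have "c * (real n * fact n) < fact n" using c n by (simp add: field_simps)
  ultimately have "\<forall>\<^sub>F x in at 0. c * R x < fact n" by (rule order_tendstoD)
  then obtain d where d: "d > 0" "\<And>x. x \<noteq> 0 \<Longrightarrow> dist x 0 < d \<Longrightarrow> c * R x < fact n"
    unfolding eventually_at by auto
  define \<tau> where "\<tau> = sqrt (d / 2)"
  have t: "\<tau> \<noteq> 0" "\<tau>\<^sup>2 = d / 2" using d by (auto simp: \<tau>_def)
  have "c * R (\<tau>\<^sup>2) < fact n" using d t by (intro d(2)) auto
  then have "c * (D \<tau> / \<tau> ^ (2 * n)) < fact n" using s[OF t(1)] by (simp add: R_def sums_iff)
  moreover have p: "0 < \<tau> ^ (2 * n)" using t by (simp add: power_mult)
  ultimately have "c * D \<tau> < \<tau> ^ (2 * n) * fact n" by (simp add: field_simps)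
  also have "\<dots> \<le> (\<integral>x. (trig n \<tau> x)\<^sup>2 \<partial>N01)" by (rule N01_trig_sq_ge)
  finally show ?thesis unfolding D_def by (rule that)
qed

section \<open>Small perturbations of the constant density\<close>

lemma h1_near_1:
  assumes "0 < e"
  obtains d where "0 < d" "\<And>v. \<bar>v\<bar> \<le> d \<Longrightarrow> \<bar>h1 (1 + v) - 1 / 2\<bar> \<le> e"
proof -
  have "((\<lambda>v. ((1 + v) * ln (1 + v) - v) / v\<^sup>2) \<longlongrightarrow> 1 / 2) (at_right (0::real))" by real_asymp
  moreover have "((\<lambda>v. ((1 + v) * ln (1 + v) - v) / v\<^sup>2) \<longlongrightarrow> 1 / 2) (at_left (0::real))" by real_asymp
  ultimately have "((\<lambda>v. ((1 + v) * ln (1 + v) - v) / v\<^sup>2) \<longlongrightarrow> 1 / 2) (at (0::real))"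
    by (simp add: filterlim_at_split)
  from tendstoD[OF this assms]
  obtain d where d: "0 < d" "\<And>v :: real. v \<noteq> 0 \<Longrightarrow> dist v 0 < d \<Longrightarrow> dist (((1 + v) * ln (1 + v) - v) / v\<^sup>2) (1 / 2) < e"
    unfolding eventually_at by auto
  \<comment> \<open>The bound 1/2 keeps 1 + v away from the exceptional value 0 of
    \<open>h1\<close>; d/2 gives the strict inequality required by the limit.\<close>
  have "\<bar>h1 (1 + v) - 1 / 2\<bar> \<le> e" if v: "\<bar>v\<bar> \<le> min (d / 2) (1 / 2)" for v
  proof (cases "v = 0")
    case True then show ?thesis using assms by (simp add: h1_def)
  next
    case False
    have "h1 (1 + v) = ((1 + v) * ln (1 + v) - v) / v\<^sup>2" using False v by (auto simp: h1_def)
    then show ?thesis using d(2)[OF False] v d(1) by (auto simp: dist_real_def)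
  qed
  then show ?thesis using d(1) by (intro that[of "min (d / 2) (1 / 2)"]) auto
qed

text \<open>For w = 1 + eps f(x_i) the factor eps^2 cancels from both sides, so it suffices that f
  has Rayleigh quotient below 1/c and that the relative errors of sup norm, \<open>h1\<close> and
  1/w are controlled by one parameter eta. A function of a single coordinate serves every
  dimension.\<close>

lemma optimality:
  assumes n: "n \<ge> 1" and c: "c < 1 / real n"
  shows "\<exists>w :: real ^ 'd \<Rightarrow> real. admissible n w \<and>
            \<not> ereal (entropy_gauss w) \<le> ereal c * H1 w * enn2ereal (fisher w)"
proof -
  define i :: 'd where "i = undefined"
  \<comment> \<open>Negative c reduces to c = 0, which allows monotonicity in the nonnegative
    factors.\<close>
  define c0 where "c0 = max c 0"
  have c0: "0 \<le> c0" "c0 < 1 / real n" "c \<le> c0" using c n by (auto simp: c0_def)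
  obtain \<tau> where t: "c0 * (\<integral>x. (trig' n \<tau> x)\<^sup>2 \<partial>N01) < (\<integral>x. (trig n \<tau> x)\<^sup>2 \<partial>N01)"
    by (rule trig_rayleigh[OF n c0(1,2)])
  define f f' B where "f = trig n \<tau>" and "f' = trig' n \<tau>" and "B = trig_bound n \<tau>"
  define Nf Df where "Nf = (\<integral>x. (f x)\<^sup>2 \<partial>N01)" and "Df = (\<integral>x. (f' x)\<^sup>2 \<partial>N01)"
  have ND: "c0 * Df < Nf" using t by (simp add: Nf_def Df_def f_def f'_def)
  have D0: "0 \<le> Df" unfolding Df_def by (rule integral_nonneg_AE) simp
  have fm[measurable]: "f \<in> borel_measurable borel" "f' \<in> borel_measurable borel" by (simp_all add: f_def f'_def)
  have fB: "\<bar>f x\<bar> \<le> B" "\<bar>f' x\<bar> \<le> B" and B1: "1 \<le> B" for x using trig_bounds by (auto simp: f_def f'_def B_def)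
  have fd: "(f has_real_derivative f' x) (at x)" for x by (simp add: f_def f'_def trig_deriv)
  have fc: "continuous_on UNIV f" "continuous_on UNIV f'" by (simp_all add: f_def f'_def trig_continuous)
  \<comment> \<open>The error budget: one factor 1 + eta each for the sup norm and for the supremum
    of \<open>h1\<close>, one factor 1/(1 - eta) each for 1/w in the Fisher information and for the
    lower bound of \<open>h1\<close> in the entropy.\<close>
  have "((\<lambda>\<eta>. c0 * Df * ((1 + \<eta>)\<^sup>2 / (1 - \<eta>)\<^sup>2)) \<longlongrightarrow> c0 * Df * ((1 + 0)\<^sup>2 / (1 - 0)\<^sup>2)) (at_right (0 :: real))"
    by (intro tendsto_intros) auto
  then have "\<forall>\<^sub>F \<eta> in at_right 0. c0 * Df * ((1 + \<eta>)\<^sup>2 / (1 - \<eta>)\<^sup>2) < Nf" using ND by (intro order_tendstoD) auto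
  moreover have "\<forall>\<^sub>F \<eta> in at_right (0 :: real). \<eta> \<in> {0<..<1 / 2}" by (rule eventually_at_right_real) simp
  ultimately have "\<forall>\<^sub>F \<eta> in at_right 0. c0 * Df * ((1 + \<eta>)\<^sup>2 / (1 - \<eta>)\<^sup>2) < Nf \<and> \<eta> \<in> {0<..<1 / 2}" by (rule eventually_conj)
  then obtain \<eta> where e: "c0 * Df * ((1 + \<eta>)\<^sup>2 / (1 - \<eta>)\<^sup>2) < Nf" "0 < \<eta>" "\<eta> < 1 / 2"
    using eventually_happens[of _ "at_right (0 :: real)"] by fastforce
  obtain d where d: "0 < d" "\<And>v. \<bar>v\<bar> \<le> d \<Longrightarrow> \<bar>h1 (1 + v) - 1 / 2\<bar> \<le> \<eta> / 2"
    using h1_near_1[of "\<eta> / 2"] e(2) by auto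
  define \<rho> where "\<rho> = min d \<eta>"
  have rho: "0 < \<rho>" "\<rho> \<le> d" "\<rho> \<le> \<eta>" "\<rho> < 1 / 2" using d e by (auto simp: \<rho>_def)
  \<comment> \<open>Scaled so that the perturbation eps f stays within rho: then w is positive and
    h1(w) is within eta/2 of 1/2.\<close>
  define \<epsilon> where "\<epsilon> = \<rho> / B"
  have ep: "0 < \<epsilon>" using rho B1 by (simp add: \<epsilon>_def)
  have ef: "\<bar>\<epsilon> * f x\<bar> \<le> \<rho>" for x
  proof -
    have "\<bar>\<epsilon> * f x\<bar> \<le> \<epsilon> * B" using ep fB(1)[of x] by (simp add: abs_mult)
    then show ?thesis using B1 by (simp add: \<epsilon>_def)
  qed
  define w :: "real ^ 'd \<Rightarrow> real" where "w x = 1 + \<epsilon> * f (x $ i)" for x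
  have wb: "1 - \<rho> \<le> w x" "w x \<le> 1 + \<rho>" "0 < w x" for x using ef[of "x $ i"] rho by (auto simp: w_def)
  have wm[measurable]: "w \<in> borel_measurable borel" unfolding w_def[abs_def] by measurable
  have wl: "w \<in> borel_measurable lebesgue" by (rule measurable_completion) simp
  have h1w: "(1 - \<eta>) / 2 \<le> h1 (w x)" "h1 (w x) \<le> (1 + \<eta>) / 2" for x
    using d(2)[OF order_trans[OF ef rho(2)], of "x $ i"] unfolding w_def by (auto simp: field_simps abs_le_iff)
  have g_eq: "(\<integral>x. F x \<partial>gauss) = (\<integral>x. F x \<partial>gam)" if "F \<in> borel_measurable borel" for F :: "real ^ 'd \<Rightarrow> real"
    by (rule gauss_integral) (use that in \<open>auto intro: measurable_completion\<close>)
  let ?F = "\<lambda>x :: real ^ 'd. f (x $ i)"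
  have Fl: "hcoeff ?F l = 0" if "length l < n" for l
    using that by (simp add: f_def hcoeff_trig diff_weight_moment_zero)
  have FI: "integrable gam (\<lambda>x. ?F x * He l x)" for l
    by (rule integrable_bounded_mult_He[OF _ fB(1)]) measurable
  have F0: "(\<integral>x. ?F x \<partial>gam) = 0" using Fl[of "[]"] n by (simp add: hcoeff_def He_def)
  have FI0: "integrable gam ?F" using FI[of "[]"] by (simp add: He_def)
  have Linf_le: "Linf_norm w \<le> ereal (1 + \<rho>)"
    unfolding Linf_norm_def
  proof (rule esssup_I)
    show "AE x in lebesgue. ereal \<bar>w x\<bar> \<le> ereal (1 + \<rho>)"
      using wb by (auto simp: abs_of_pos)
  qed (use wl in measurable)
  have adm: "admissible n w"
    unfolding admissible_def
  proof (intro conjI allI impI)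
    show "w \<in> Linf" using wl Linf_le by (auto simp: Linf_def intro: le_less_trans)
    show "AE x in lebesgue. 0 \<le> w x" using wb(3) by (auto intro: less_imp_le)
    show "(\<integral>x. w x \<partial>gauss) = 1"
      unfolding g_eq[OF wm] unfolding w_def using FI0 F0 by simp
    fix k :: "nat ^ 'd" assume k: "0 < mi_length k \<and> mi_length k < n"
    obtain l where l: "k = (\<chi> j. count_list l j)" by (rule ex_list_count)
    have len: "0 < length l" "length l < n" using k unfolding l mi_length_count by auto
    have m: "(\<lambda>x. w x * Hermite k x) \<in> borel_measurable borel" unfolding l Hermite_eq_He by measurable
    have "(\<integral>x. w x * He l x \<partial>gam) = (\<integral>x. He l x + \<epsilon> * (?F x * He l x) \<partial>gam)"
      by (simp add: w_def algebra_simps)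
    also have "\<dots> = (\<integral>x. He l x \<partial>gam) + \<epsilon> * hcoeff ?F l"
      using FI[of l] He_gam_integrable[of l] by (simp add: hcoeff_def)
    also have "\<dots> = 0" using len by (simp add: integral_He Fl)
    finally show "(\<integral>x. w x * Hermite k x \<partial>gauss) = 0"
      unfolding g_eq[OF m] unfolding l Hermite_eq_He by simp
  qed
  have f2I: "integrable N01 (\<lambda>x. (f x)\<^sup>2)" "integrable N01 (\<lambda>x. (f' x)\<^sup>2)"
    by (rule N01.integrable_const_bound[where B="B\<^sup>2"]; use abs_square_le[OF fB(1)] abs_square_le[OF fB(2)] in auto)+
  have ent: "(1 - \<eta>) / 2 * \<epsilon>\<^sup>2 * Nf \<le> entropy_gauss w"
  proof -
    have I1: "integrable gam (\<lambda>x. (1 - \<eta>) / 2 * \<epsilon>\<^sup>2 * (?F x)\<^sup>2)"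
      by (intro integrable_mult_right gam_integrable_coord[OF f2I(1)])
    have I2: "integrable gam (\<lambda>x. h1 (w x) * (\<epsilon> * ?F x)\<^sup>2)"
    proof (rule gam.integrable_const_bound[where B="1 * \<rho>\<^sup>2"])
      show "AE x in gam. norm (h1 (w x) * (\<epsilon> * ?F x)\<^sup>2) \<le> 1 * \<rho>\<^sup>2"
      proof (rule AE_I2)
        fix x :: "real ^ 'd"
        have "\<bar>h1 (w x)\<bar> \<le> 1" using h1w[of x] e by (auto simp: abs_le_iff)
        moreover have "\<bar>(\<epsilon> * ?F x)\<^sup>2\<bar> \<le> \<rho>\<^sup>2" by (rule abs_square_le[OF ef])
        ultimately show "norm (h1 (w x) * (\<epsilon> * ?F x)\<^sup>2) \<le> 1 * \<rho>\<^sup>2"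
          unfolding real_norm_def abs_mult[of "h1 (w x)"] by (intro mult_mono) auto
      qed
    qed measurable
    have "(1 - \<eta>) / 2 * \<epsilon>\<^sup>2 * Nf = (\<integral>x. (1 - \<eta>) / 2 * \<epsilon>\<^sup>2 * (?F x)\<^sup>2 \<partial>gam)"
      unfolding Nf_def gam_integral_coord[OF f2I(1), of i, symmetric] by simp
    also have "\<dots> \<le> (\<integral>x. h1 (w x) * (\<epsilon> * ?F x)\<^sup>2 \<partial>gam)"
    proof (rule integral_mono[OF I1 I2])
      fix x :: "real ^ 'd"
      show "(1 - \<eta>) / 2 * \<epsilon>\<^sup>2 * (?F x)\<^sup>2 \<le> h1 (w x) * (\<epsilon> * ?F x)\<^sup>2"
        using mult_right_mono[OF h1w(1)[of x] zero_le_power2[of "\<epsilon> * ?F x"]] by (simp add: power_mult_distrib mult.assoc)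
    qed
    also have "\<dots> = (\<integral>x. h1 (w x) * (\<epsilon> * ?F x)\<^sup>2 \<partial>gam) + \<epsilon> * (\<integral>x. ?F x \<partial>gam)" by (simp add: F0)
    also have "\<dots> = (\<integral>x. h1 (w x) * (\<epsilon> * ?F x)\<^sup>2 + \<epsilon> * ?F x \<partial>gam)"
      using I2 FI0 by simp
    also have "\<dots> = (\<integral>x. w x * ln (w x) \<partial>gam)"
    proof (rule Bochner_Integration.integral_cong)
      fix x :: "real ^ 'd"
      show "h1 (w x) * (\<epsilon> * ?F x)\<^sup>2 + \<epsilon> * ?F x = w x * ln (w x)" using h1_mult[of "w x"] by (simp add: w_def)
    qed simp
    also have "\<dots> = entropy_gauss w" unfolding entropy_gauss_def by (rule g_eq[symmetric]) measurable
    finally show ?thesis .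
  qed
  let ?S = "esssup lebesgue (\<lambda>x. ereal (h1 (w x)))"
  have hm: "(\<lambda>x. ereal (h1 (w x))) \<in> borel_measurable lebesgue" by (rule measurable_completion) measurable
  have Sle: "?S \<le> ereal ((1 + \<eta>) / 2)" by (rule esssup_I[OF hm]) (use h1w in auto)
  have ne: "\<not> (AE x in (lebesgue :: (real ^ 'd) measure). False)"
    using ae_filter_eq_bot_iff[of "lebesgue :: (real ^ 'd) measure"] by (simp add: trivial_limit_def)
  \<comment> \<open>Over a trivial measure an essential supremum would be minus infinity; that
    Lebesgue measure is nontrivial secures the signs needed to multiply extended reals
    monotonically.\<close>
  have nonneg_ess: "0 \<le> esssup lebesgue G" if "\<And>x. 0 \<le> G x" for G :: "real ^ 'd \<Rightarrow> ereal"
  proof (rule ccontr)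
    assume "\<not> 0 \<le> esssup lebesgue G"
    then have "\<not> G x \<le> esssup lebesgue G" for x using that order_trans by blast
    with esssup_AE[of G lebesgue] have "AE x in (lebesgue :: (real ^ 'd) measure). False" by simp
    then show False using ne by blast
  qed
  have L0: "0 \<le> Linf_norm w" unfolding Linf_norm_def by (rule nonneg_ess) simp
  have S0: "0 \<le> ?S" by (rule nonneg_ess) (use h1_pos wb(3) in \<open>auto intro: less_imp_le\<close>)
  have H1: "0 \<le> H1 w" "H1 w \<le> ereal ((1 + \<rho>) * ((1 + \<eta>) / 2))"
  proof -
    show "0 \<le> H1 w" unfolding H1_def using L0 S0 by simp
    show "H1 w \<le> ereal ((1 + \<rho>) * ((1 + \<eta>) / 2))"
      unfolding H1_def times_ereal.simps(1)[symmetric] using L0 S0 Linf_le Sle rho by (intro ereal_mult_mono) auto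
  qed
  have fis: "enn2ereal (fisher w) \<le> ereal (\<epsilon>\<^sup>2 * Df / (1 - \<rho>))"
  proof -
    let ?h = "\<lambda>t. sqrt (1 + \<epsilon> * f t)" and ?h' = "\<lambda>t. \<epsilon> * f' t / (2 * sqrt (1 + \<epsilon> * f t))"
    have p: "0 < 1 + \<epsilon> * f t" "1 - \<rho> \<le> 1 + \<epsilon> * f t" for t using ef[of t] rho by auto
    have "fisher w = 4 * (\<integral>\<^sup>+x. ennreal ((?h' (x $ i))\<^sup>2) \<partial>(gam :: (real ^ 'd) measure))"
    proof (rule fisher_coord)
      show "sqrt (w x) = ?h (x $ i)" for x by (simp add: w_def)
      show "(?h has_real_derivative ?h' t) (at t)" for t
        using p(1)[of t] by (auto intro!: derivative_eq_intros fd simp: field_simps)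
      show "continuous_on UNIV ?h'"
        using p(1) by (intro continuous_intros fc) (auto simp: less_imp_neq[THEN not_sym])
    qed
    also have "\<dots> \<le> 4 * (\<integral>\<^sup>+x. ennreal (\<epsilon>\<^sup>2 / (4 * (1 - \<rho>)) * (f' (x $ i))\<^sup>2) \<partial>(gam :: (real ^ 'd) measure))"
    proof (intro mult_left_mono nn_integral_mono ennreal_leI)
      fix x :: "real ^ 'd"
      have "(?h' (x $ i))\<^sup>2 = \<epsilon>\<^sup>2 * (f' (x $ i))\<^sup>2 / (4 * (1 + \<epsilon> * f (x $ i)))"
        using p(1)[of "x $ i"] by (simp add: power_divide power_mult_distrib)
      also have "\<dots> \<le> \<epsilon>\<^sup>2 * (f' (x $ i))\<^sup>2 / (4 * (1 - \<rho>))"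
        using p[of "x $ i"] rho by (intro divide_left_mono) auto
      finally show "(?h' (x $ i))\<^sup>2 \<le> \<epsilon>\<^sup>2 / (4 * (1 - \<rho>)) * (f' (x $ i))\<^sup>2" by simp
    qed simp
    also have "(\<integral>\<^sup>+x. ennreal (\<epsilon>\<^sup>2 / (4 * (1 - \<rho>)) * (f' (x $ i))\<^sup>2) \<partial>(gam :: (real ^ 'd) measure))
      = ennreal (\<integral>x. \<epsilon>\<^sup>2 / (4 * (1 - \<rho>)) * (f' (x $ i))\<^sup>2 \<partial>(gam :: (real ^ 'd) measure))"
      using rho by (intro nn_integral_eq_integral integrable_mult_right gam_integrable_coord[OF f2I(2)]) auto
    also have "(\<integral>x. \<epsilon>\<^sup>2 / (4 * (1 - \<rho>)) * (f' (x $ i))\<^sup>2 \<partial>(gam :: (real ^ 'd) measure)) = \<epsilon>\<^sup>2 / (4 * (1 - \<rho>)) * Df"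
      unfolding Df_def gam_integral_coord[OF f2I(2), of i, symmetric] by simp
    also have "4 * ennreal (\<epsilon>\<^sup>2 / (4 * (1 - \<rho>)) * Df) = ennreal (4 * (\<epsilon>\<^sup>2 / (4 * (1 - \<rho>)) * Df))"
      using rho D0 by (subst ennreal_mult) auto
    also have "4 * (\<epsilon>\<^sup>2 / (4 * (1 - \<rho>)) * Df) = \<epsilon>\<^sup>2 * Df / (1 - \<rho>)" using rho by (simp add: field_simps)
    finally have "fisher w \<le> ennreal (\<epsilon>\<^sup>2 * Df / (1 - \<rho>))" .
    then have "enn2ereal (fisher w) \<le> enn2ereal (ennreal (\<epsilon>\<^sup>2 * Df / (1 - \<rho>)))" by (simp only: less_eq_ennreal.rep_eq)
    then show ?thesis using rho D0 by simp
  qed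
  have "ereal c * H1 w * enn2ereal (fisher w) \<le> ereal c0 * H1 w * enn2ereal (fisher w)"
    using c0 H1(1) by (intro ereal_mult_right_mono) auto
  also have "\<dots> \<le> ereal c0 * ereal ((1 + \<rho>) * ((1 + \<eta>) / 2)) * ereal (\<epsilon>\<^sup>2 * Df / (1 - \<rho>))"
    using c0 H1 fis rho e by (intro ereal_mult_mono ereal_mult_left_mono) (auto intro!: mult_nonneg_nonneg)
  also have "\<dots> = ereal (c0 * ((1 + \<rho>) * ((1 + \<eta>) / 2)) * (\<epsilon>\<^sup>2 * Df / (1 - \<rho>)))" by simp
  also have "\<dots> < ereal (entropy_gauss w)"
  proof -
    have "c0 * ((1 + \<rho>) * ((1 + \<eta>) / 2)) * (\<epsilon>\<^sup>2 * Df / (1 - \<rho>)) = \<epsilon>\<^sup>2 / 2 * (c0 * Df) * ((1 + \<rho>) * (1 + \<eta>) / (1 - \<rho>))"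
      by simp
    also have "\<dots> \<le> \<epsilon>\<^sup>2 / 2 * (c0 * Df) * ((1 + \<eta>) * (1 + \<eta>) / (1 - \<eta>))"
      using rho e c0 D0 by (intro mult_left_mono frac_le mult_mono) auto
    also have "\<dots> = \<epsilon>\<^sup>2 / 2 * (1 - \<eta>) * (c0 * Df * ((1 + \<eta>)\<^sup>2 / (1 - \<eta>)\<^sup>2))"
      using e by (simp add: power2_eq_square)
    also have "\<dots> < \<epsilon>\<^sup>2 / 2 * (1 - \<eta>) * Nf"
      using e ep by (intro mult_strict_left_mono) auto
    also have "\<dots> \<le> entropy_gauss w" using ent by (simp add: mult_ac)
    finally show ?thesis by simp
  qed
  finally have "\<not> ereal (entropy_gauss w) \<le> ereal c * H1 w * enn2ereal (fisher w)" by (simp add: not_le)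
  with adm show ?thesis by blast
qed

theorem theorem2:
  fixes n :: nat
  assumes "n \<ge> 1"
  shows "(\<forall>w :: real ^ 'd \<Rightarrow> real. admissible n w \<longrightarrow>
            ereal (entropy_gauss w) \<le> H1 w / ereal (real n) * enn2ereal (fisher w)) \<and>
         (\<forall>c < 1 / real n. \<exists>w :: real ^ 'd \<Rightarrow> real. admissible n w \<and>
            \<not> ereal (entropy_gauss w) \<le> ereal c * H1 w * enn2ereal (fisher w))"
  using entropy_bound[OF assms] optimality[OF assms] by blast

end
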